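(* Let $D\ge 1$, $\lambda>0$, $\phi\in(0,\pi/2]$, and let $\Phi\in C^2(\mathbb{R}^D)$ satisfy: (H1) $\Phi(q)\ge 0$ for all $q$ and $\int_{\mathbb{R}^D}|q|^2e^{-\Phi(q)}\,dq<\infty$; (H2) there exist $a>0$ and $b\in(0,1)$ such that $$\tfrac12\langle\nabla\Phi(q),q\rangle\ \ge\ b\,\Phi(q)+\frac{(c_1b)^2+c_2b(1-b)}{2(1-b)}|q|^2-a\qquad\text{for all } q\in\mathbb{R}^D,$$ where $c_1=\frac{\lambda^{-1}}{4}\sin^2\phi$ and $c_2=\lambda^{-1}c_1(1-\cos\phi)$. Let $V(q,p)=\frac{|p|^2}{2}+\Phi(q)+c_1\langle q,p\rangle+c_2\frac{|q|^2}{2}$. Then the RHMC Markov process $Z$ on $\mathbb{R}^{2D}$ (the Markov process induced by the generator $L$) has a unique invariant probability measure, and it is the Boltzmann–Gibbs measure $\Pi_{\mathrm{BG}}$. Furthermore, there exist positive constants $r$ and $C$ such that $$\|\Pi_{t,z}-\Pi_{\mathrm{BG}}\|_{\mathrm{TV}}\le C\,V(z)\,e^{-rt}$$ for all $t\ge 0$ and all $z\in\mathbb{R}^{2D}$.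
   Context: Let $H(q,p)=\frac{|p|^2}{2}+\Phi(q)$ on $\mathbb{R}^{2D}$, and let $\theta_t:\mathbb{R}^{2D}\to\mathbb{R}^{2D}$ be the flow of Hamilton's equations $\dot q=p$, $\dot p=-\nabla\Phi(q)$ (globally defined since $\Phi\ge 0$). Boltzmann–Gibbs measure: $\Pi_{\mathrm{BG}}(dq,dp)=C_0^{-1}(2\pi)^{-D/2}e^{-H(q,p)}\,dq\,dp$ with $C_0=\int_{\mathbb{R}^D}e^{-\Phi(q)}dq$. Momentum randomization: $\Gamma(q,p)=(q,\cos(\phi)p+\sin(\phi)\xi)$ with $\xi\sim\mathcal N(0,1)^D$ a standard $D$-dimensional Gaussian vector. RHMC process $Z_t=(Q_t,P_t)$ with mean duration $\lambda$ and angle $\phi$, started at $Z_0=z$: the càdlàg Markov process with jump times $t_0=0$, $t_{n+1}=t_n+\delta t_n$, where $\delta t_n$ are i.i.d. exponential with mean $\lambda$; for $t_n\le s<t_{n+1}$, $Z_s=\theta_{s-t_n}(Z_{t_n})$, and $Z_{t_{n+1}}=\Gamma(\theta_{\delta t_n}(Z_{t_n}))$, a fresh independent Gaussian vector $\xi$ being used at each jump, all the $\delta t_n$ and Gaussian vectors being mutually independent. Its generator is $Lf(q,p)=\lambda^{-1}\mathbb{E}\{f(\Gamma(q,p))-f(q,p)\}+p^T\nabla_qf(q,p)-\nabla\Phi(q)^T\nabla_pf(q,p)$. $\Pi_{t,z}$ denotes the law of $Z_t$ given $Z_0=z$. The total variation distance is normalized as $\|\mu-\nu\|_{\mathrm{TV}}=2\sup_A|\mu(A)-\nu(A)|$,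 the supremum over measurable sets $A$.
   Formalization: The bound C V(z) e^{-rt} is proved when Φ(0)>0; in general the bound proved is C(1+V(z)) e^{-rt}, because if Φ(0)=0 then V(0,0)=0 while the total variation distance at t=0, z=(0,0) equals 2, so the literal bound fails. *)

theory Defs
  imports "HOL-Probability.Probability"
begin

definition grad :: "('a::real_inner \<Rightarrow> real) \<Rightarrow> 'a \<Rightarrow> 'a" where
  "grad f x = (THE D. GDERIV f x :> D)"

definition C2 :: "('a::euclidean_space \<Rightarrow> real) \<Rightarrow> bool" where
  "C2 f \<longleftrightarrow> (\<forall>x. f differentiable (at x)) \<and>
     (\<exists>f'' :: 'a \<Rightarrow> 'a \<Rightarrow>\<^sub>L 'a.
        (\<forall>x. (grad f has_derivative blinfun_apply (f'' x)) (at x)) \<and> continuous_on UNIV f'')"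

type_synonym 'n phase = "(real ^ 'n) \<times> (real ^ 'n)"

definition hamiltonian :: "(real ^ 'n \<Rightarrow> real) \<Rightarrow> 'n::finite phase \<Rightarrow> real" where
  "hamiltonian \<Phi> z = (norm (snd z))\<^sup>2 / 2 + \<Phi> (fst z)"

text \<open>The flow is pinned down as the unique global family of solutions of Hamilton's equations;
  such a family exists and is unique when the potential is C2 and nonnegative.\<close>

definition hamiltonian_flow :: "(real ^ 'n \<Rightarrow> real) \<Rightarrow> real \<Rightarrow> 'n::finite phase \<Rightarrow> 'n phase" where
  "hamiltonian_flow \<Phi> = (THE \<theta>. \<forall>z. \<theta> 0 z = z \<and>
     (\<forall>t. ((\<lambda>s. \<theta> s z) has_vector_derivative
            (snd (\<theta> t z), - grad \<Phi> (fst (\<theta> t z)))) (at t)))"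

definition boltzmann_gibbs :: "(real ^ 'n \<Rightarrow> real) \<Rightarrow> 'n::finite phase measure" where
  "boltzmann_gibbs \<Phi> = density lborel (\<lambda>z. ennreal
     (inverse (LINT q|lborel. exp (- \<Phi> q)) * (2 * pi) powr (- real CARD('n) / 2)
        * exp (- hamiltonian \<Phi> z)))"

definition std_gaussian :: "(real ^ 'n::finite) measure" where
  "std_gaussian = density lborel (\<lambda>x. ennreal (\<Prod>i\<in>UNIV. std_normal_density (x $ i)))"

definition momentum_randomization ::
    "real \<Rightarrow> real ^ 'n \<Rightarrow> 'n::finite phase \<Rightarrow> 'n phase" where
  "momentum_randomization \<phi> \<xi> z = (fst z, cos \<phi> *\<^sub>R snd z + sin \<phi> *\<^sub>R \<xi>)"

text \<open>Canonical sample space of the process: the coordinate \<open>\<omega> n\<close> is the pair consisting of the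
  \<open>n\<close>-th holding time, exponential with mean \<open>lam\<close> (rate \<open>1 / lam\<close>), and of the Gaussian vector used
  at the jump that ends it. All these variables are independent.\<close>

definition rhmc_noise :: "real \<Rightarrow> (nat \<Rightarrow> real \<times> (real ^ 'n::finite)) measure" where
  "rhmc_noise lam = (\<Pi>\<^sub>M n\<in>UNIV.
     density lborel (\<lambda>s. ennreal (exponential_density (1 / lam) s)) \<Otimes>\<^sub>M std_gaussian)"

definition jump_time :: "(nat \<Rightarrow> real \<times> 'b) \<Rightarrow> nat \<Rightarrow> real" where
  "jump_time \<omega> n = (\<Sum>k<n. fst (\<omega> k))"

text \<open>The state at the \<open>n\<close>-th jump time, just after the jump.\<close>

primrec jump_state ::
    "(real ^ 'n \<Rightarrow> real) \<Rightarrow> real \<Rightarrow> 'n::finite phase \<Rightarrow> (nat \<Rightarrow> real \<times> (real ^ 'n)) \<Rightarrow> nat \<Rightarrow> 'n phase"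
where
  "jump_state \<Phi> \<phi> z \<omega> 0 = z"
| "jump_state \<Phi> \<phi> z \<omega> (Suc n) = momentum_randomization \<phi> (snd (\<omega> n))
     (hamiltonian_flow \<Phi> (fst (\<omega> n)) (jump_state \<Phi> \<phi> z \<omega> n))"

text \<open>For nonnegative time, almost surely the index below is the unique one for which the time lies
  in the half-open interval from the \<open>n\<close>-th to the next jump time.\<close>

definition rhmc_process ::
    "(real ^ 'n \<Rightarrow> real) \<Rightarrow> real \<Rightarrow> real \<Rightarrow> 'n::finite phase \<Rightarrow> (nat \<Rightarrow> real \<times> (real ^ 'n)) \<Rightarrow> 'n phase"
where
  "rhmc_process \<Phi> \<phi> t z \<omega> =
     (let n = (LEAST n. t < jump_time \<omega> (Suc n))
      in hamiltonian_flow \<Phi> (t - jump_time \<omega> n) (jump_state \<Phi> \<phi> z \<omega> n))"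

definition rhmc_law ::
    "(real ^ 'n \<Rightarrow> real) \<Rightarrow> real \<Rightarrow> real \<Rightarrow> real \<Rightarrow> 'n::finite phase \<Rightarrow> 'n phase measure" where
  "rhmc_law \<Phi> lam \<phi> t z = distr (rhmc_noise lam) borel (rhmc_process \<Phi> \<phi> t z)"

definition invariant_prob :: "(real \<Rightarrow> 'a::topological_space \<Rightarrow> 'a measure) \<Rightarrow> 'a measure \<Rightarrow> bool" where
  "invariant_prob P \<mu> \<longleftrightarrow> prob_space \<mu> \<and> sets \<mu> = sets borel \<and>
     (\<forall>t\<ge>0. \<forall>A\<in>sets borel. (\<integral>\<^sup>+z. emeasure (P t z) A \<partial>\<mu>) = emeasure \<mu> A)"

definition tv_norm :: "'a measure \<Rightarrow> 'a measure \<Rightarrow> real" where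
  "tv_norm \<mu> \<nu> = 2 * (SUP A\<in>sets \<mu>. \<bar>measure \<mu> A - measure \<nu> A\<bar>)"

definition c1 :: "real \<Rightarrow> real \<Rightarrow> real" where
  "c1 lam \<phi> = inverse lam / 4 * (sin \<phi>)\<^sup>2"

definition c2 :: "real \<Rightarrow> real \<Rightarrow> real" where
  "c2 lam \<phi> = inverse lam * c1 lam \<phi> * (1 - cos \<phi>)"

text \<open>The quadratic part is positive definite, so for a nonnegative potential the function below
  vanishes somewhere iff the potential vanishes at the origin (and then it vanishes at the origin of
  phase space only).\<close>

definition lyapunov :: "(real ^ 'n \<Rightarrow> real) \<Rightarrow> real \<Rightarrow> real \<Rightarrow> 'n::finite phase \<Rightarrow> real" where
  "lyapunov \<Phi> lam \<phi> z = (case z of (q, p) \<Rightarrow>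
     (norm p)\<^sup>2 / 2 + \<Phi> q + c1 lam \<phi> * (q \<bullet> p) + c2 lam \<phi> * (norm q)\<^sup>2 / 2)"

end

theory Submission
  imports Defs
begin

text \<open>
  The proof follows Harris' scheme: an invariant measure that is known explicitly, a Lyapunov function,
  and a minorization on its sublevel sets together give geometric convergence in total variation.

  \<^emph>\<open>Dynamics.\<close>  Since the potential is nonnegative, energy conservation bounds the speed, so a trajectory
  stays up to any given time in a ball on which the force is Lipschitz.  Up to that time the flow
  coincides with the flow of a truncated, globally Lipschitz field (\<open>flow_eq_cutoff_flow\<close>), and this
  yields existence, uniqueness and joint continuity.  Liouville's theorem (\<open>liouville\<close>) is obtained without
  differentiating the flow: symplectic Euler steps are products of shears, hence preserve volume, and they
  converge pointwise to the flow.  Shears serve a second time: a rotation is a product of three of them, so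
  the momentum refreshment preserves the Gaussian.  Flow and refreshment therefore both preserve the
  Boltzmann--Gibbs measure.

  \<^emph>\<open>Process.\<close>  Conditioning on the first jump shows that the expectation of \<open>f (Z t)\<close> is the least nonnegative
  solution of a renewal equation (\<open>semigroup_renewal\<close>, \<open>semigroup_least\<close>); the jump times do not accumulate
  (\<open>no_explosion\<close>).  Minimality is the one tool behind three facts: the Markov property, the invariance of the
  Boltzmann--Gibbs measure, and the drift inequality, for which a supersolution is written down.

  \<^emph>\<open>Drift.\<close>  The mixed terms \<open>q \<bullet> p\<close> that flow and refreshment contribute to \<open>L V\<close> cancel, and the growth
  condition gives \<open>L V \<le> - \<kappa> V + K\<close> (\<open>generator_bound\<close>, where \<open>\<kappa>\<close> is \<open>rate\<close> and \<open>K\<close> is \<open>noise_level\<close>).  In integrated form the mean of \<open>V (Z t)\<close> is at most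
  \<open>exp (- \<kappa> t) V z + (K / \<kappa>) (1 - exp (- \<kappa> t))\<close> (\<open>lyapunov_drift\<close>).  The ratio of the additive constant to one
  minus the contraction factor is \<open>K / \<kappa>\<close> for every \<open>t\<close>; so the sublevel set that Harris' theorem needs can be
  fixed first and the time of the minorization chosen afterwards, as small as that set requires.

  \<^emph>\<open>Minorization.\<close>  A refreshed momentum has a density that is bounded below on balls.  For short times \<open>s\<close> the
  position reached from a fixed point is \<open>q + s p\<close> up to a perturbation that is Lipschitz in \<open>p\<close> with a small
  constant, so the momentum spreads the position over a unit ball; here again only Lipschitz estimates are
  used, through Vitali's covering theorem (\<open>lipschitz_preimage_volume\<close>).  A second refreshment spreads the
  momentum.  By Liouville's theorem the remaining flow keeps a multiple of Lebesgue measure on a small ball, so the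
  law after two jumps dominates this measure uniformly on sublevel sets of \<open>V\<close> (\<open>minorization\<close>).

  \<^emph>\<open>Conclusion.\<close>  Harris' theorem (\<open>harris_contraction\<close>) contracts weighted oscillations of the functions
  \<open>z \<mapsto> P (Z t \<in> A)\<close>.  Averaging over the Boltzmann--Gibbs measure, under which \<open>V\<close> is integrable by invariance
  and drift, turns this into the asserted rate; uniqueness follows by dominated convergence.
\<close>

section \<open>Differential equations with a globally Lipschitz right-hand side\<close>

lemma has_real_derivative_inner:
  fixes x y :: "real \<Rightarrow> 'a::real_inner"
  assumes "(x has_vector_derivative x') (at t)" "(y has_vector_derivative y') (at t)"
  shows "((\<lambda>s. x s \<bullet> y s) has_real_derivative (x t \<bullet> y' + x' \<bullet> y t)) (at t)"
  unfolding has_field_derivative_def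
  by (rule has_derivative_eq_rhs[OF has_derivative_inner[OF assms[unfolded has_vector_derivative_def]]])
    (auto simp: fun_eq_iff algebra_simps)

lemma increment_bound:
  fixes x :: "real \<Rightarrow> 'a::real_normed_vector"
  assumes u: "0 \<le> u" and x: "\<And>v. \<lbrakk>0 \<le> v; v \<le> u\<rbrakk> \<Longrightarrow> (x has_vector_derivative x' v) (at v)"
    and bnd: "\<And>v. \<lbrakk>0 \<le> v; v \<le> u\<rbrakk> \<Longrightarrow> norm (x' v) \<le> C"
  shows "norm (x u - x 0) \<le> C * u"
proof (cases "u = 0")
  case False
  with u have u': "0 < u" by simp
  have "norm (x u - x 0) \<le> C * u - C * 0"
  proof (rule differentiable_bound_general[OF u'])
    show "continuous_on {0..u} x"
      by (intro continuous_at_imp_continuous_on ballI has_vector_derivative_continuous[OF x]) auto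
    show "(x has_vector_derivative x' v) (at v)" "norm (x' v) \<le> C" if "0 < v" "v < u" for v
      using x[of v] bnd[of v] that by auto
  qed (auto intro!: continuous_intros derivative_eq_intros)
  then show ?thesis by simp
qed simp

text \<open>Gronwall's inequality: \<open>\<bar>x t\<bar>\<^sup>2 exp (- 2 L t)\<close> is nonincreasing.\<close>

lemma gronwall_forward:
  fixes x :: "real \<Rightarrow> 'a::real_inner"
  assumes T: "0 \<le> T" and L: "0 \<le> L"
    and x: "\<And>t. \<lbrakk>0 \<le> t; t \<le> T\<rbrakk> \<Longrightarrow> (x has_vector_derivative x' t) (at t)"
    and bnd: "\<And>t. \<lbrakk>0 \<le> t; t \<le> T\<rbrakk> \<Longrightarrow> norm (x' t) \<le> L * norm (x t)"
  shows "norm (x T) \<le> exp (L * T) * norm (x 0)"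
proof -
  define g where "g t = (x t \<bullet> x t) * exp (- 2 * L * t)" for t
  have der: "(g has_real_derivative (2 * (x t \<bullet> x' t) - 2 * L * (x t \<bullet> x t)) * exp (- 2 * L * t)) (at t)"
    if "0 \<le> t" "t \<le> T" for t
  proof -
    have "((\<lambda>t. x t \<bullet> x t) has_real_derivative 2 * (x t \<bullet> x' t)) (at t)"
      using has_real_derivative_inner[OF x[OF that] x[OF that]] by (simp add: inner_commute)
    then show ?thesis
      unfolding g_def by (auto intro!: derivative_eq_intros simp: algebra_simps)
  qed
  have "g T \<le> g 0"
  proof (rule DERIV_nonpos_imp_nonincreasing[OF T])
    fix t assume t: "0 \<le> t" "t \<le> T"
    have "x t \<bullet> x' t \<le> norm (x t) * norm (x' t)" by (rule norm_cauchy_schwarz)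
    also have "\<dots> \<le> norm (x t) * (L * norm (x t))"
      by (intro mult_left_mono bnd t) auto
    also have "\<dots> = L * (x t \<bullet> x t)" by (simp add: dot_square_norm power2_eq_square)
    finally have "(2 * (x t \<bullet> x' t) - 2 * L * (x t \<bullet> x t)) * exp (- 2 * L * t) \<le> 0"
      by (simp add: mult_nonpos_nonneg)
    with der[OF t] show "\<exists>y. (g has_real_derivative y) (at t) \<and> y \<le> 0" by blast
  qed
  then have "(norm (x T))\<^sup>2 * exp (- 2 * L * T) \<le> (norm (x 0))\<^sup>2"
    by (simp add: g_def dot_square_norm)
  then have "(norm (x T))\<^sup>2 * exp (- 2 * L * T) * exp (2 * L * T) \<le> (norm (x 0))\<^sup>2 * exp (2 * L * T)"
    by (rule mult_right_mono) auto
  then have "(norm (x T))\<^sup>2 \<le> (norm (x 0))\<^sup>2 * exp (2 * L * T)"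
    by (simp add: mult.assoc flip: exp_add)
  also have "\<dots> = (exp (L * T) * norm (x 0))\<^sup>2"
    by (simp add: power_mult_distrib flip: exp_double) 
  finally show ?thesis by (rule power2_le_imp_le) auto
qed

lemma has_vector_derivative_reflect:
  assumes "(x has_vector_derivative d) (at (- t))"
  shows "((\<lambda>s. x (- s)) has_vector_derivative (- d)) (at t)"
proof -
  have "(uminus has_vector_derivative (- 1 :: real)) (at t)"
    by (auto intro!: derivative_eq_intros)
  from vector_diff_chain_at[OF this assms] show ?thesis by (simp add: o_def)
qed

lemma lipschitz_solutions_close:
  fixes x y :: "real \<Rightarrow> 'a::real_inner"
  assumes f: "L-lipschitz_on UNIV f" and T: "0 \<le> T"
    and x: "\<And>t. \<lbrakk>0 \<le> t; t \<le> T\<rbrakk> \<Longrightarrow> (x has_vector_derivative f (x t)) (at t)"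
    and y: "\<And>t. \<lbrakk>0 \<le> t; t \<le> T\<rbrakk> \<Longrightarrow> (y has_vector_derivative f (y t)) (at t)"
  shows "norm (x T - y T) \<le> exp (L * T) * norm (x 0 - y 0)"
proof (rule gronwall_forward[OF T lipschitz_on_nonneg[OF f], where x="\<lambda>t. x t - y t"])
  show "((\<lambda>t. x t - y t) has_vector_derivative (f (x t) - f (y t))) (at t)" if "0 \<le> t" "t \<le> T" for t
    using x[OF that] y[OF that] by (rule has_vector_derivative_diff)
  show "norm (f (x t) - f (y t)) \<le> L * norm (x t - y t)" for t
    using lipschitz_onD[OF f, of "x t" "y t"] by (simp add: dist_norm)
qed

lemma antiderivative_growth_forward:
  fixes x :: "real \<Rightarrow> 'a::real_normed_vector"
  assumes T: "0 \<le> T" and k: "0 < k"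
    and x: "\<And>t. \<lbrakk>0 \<le> t; t \<le> T\<rbrakk> \<Longrightarrow> (x has_vector_derivative x' t) (at t)"
    and bnd: "\<And>t. \<lbrakk>0 \<le> t; t \<le> T\<rbrakk> \<Longrightarrow> norm (x' t) \<le> a * exp (k * t)"
  shows "norm (x T - x 0) \<le> a / k * (exp (k * T) - 1)"
proof (cases "T = 0")
  case False
  with T have T: "0 < T" by simp
  have "norm (x T - x 0) \<le> a / k * exp (k * T) - a / k * exp (k * 0)"
  proof (rule differentiable_bound_general[OF T])
    show "continuous_on {0..T} x"
      by (intro continuous_at_imp_continuous_on ballI has_vector_derivative_continuous[OF x]) auto
    show "((\<lambda>t. a / k * exp (k * t)) has_vector_derivative a * exp (k * t)) (at t)" for t
      unfolding has_real_derivative_iff_has_vector_derivative[symmetric]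
      using k by (auto intro!: derivative_eq_intros)
    show "(x has_vector_derivative x' t) (at t)" "norm (x' t) \<le> a * exp (k * t)" if "0 < t" "t < T" for t
      using x[of t] bnd[of t] that by auto
  qed (use k in \<open>auto intro!: continuous_intros\<close>)
  then show ?thesis by (simp add: algebra_simps)
qed simp

text \<open>Integration reproduces the weight \<open>exp (k \<bar>t\<bar>)\<close> and gains a factor \<open>1 / k\<close>; this gain is the source of
  the contraction constant in the Picard iteration.\<close>

lemma antiderivative_growth:
  fixes x :: "real \<Rightarrow> 'a::real_normed_vector"
  assumes k: "0 < k"
    and x: "\<And>t. (x has_vector_derivative x' t) (at t)"
    and bnd: "\<And>t. norm (x' t) \<le> a * exp (k * \<bar>t\<bar>)"
  shows "norm (x t - x 0) \<le> a / k * (exp (k * \<bar>t\<bar>) - 1)"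
proof (cases "0 \<le> t")
  case True
  then show ?thesis
    using antiderivative_growth_forward[OF True k, of x x' a] x bnd by (metis abs_of_nonneg)
next
  case False
  have *: "norm (x (- (-t)) - x (- 0)) \<le> a / k * (exp (k * (-t)) - 1)"
  proof (rule antiderivative_growth_forward[where x'="\<lambda>s. - x' (- s)"])
    show "((\<lambda>s. x (- s)) has_vector_derivative - x' (- s)) (at s)" for s
      by (rule has_vector_derivative_reflect[OF x])
    show "norm (- x' (- s)) \<le> a * exp (k * s)" if "0 \<le> s" for s
      using bnd[of "-s"] that by simp
  qed (use False k in auto)
  then show ?thesis using False by simp
qed

lemma continuous_antiderivative:
  fixes g :: "real \<Rightarrow> 'a::euclidean_space"
  assumes "continuous_on UNIV g"
  obtains G where "\<And>t. (G has_vector_derivative g t) (at t)" "G 0 = 0"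
proof -
  have "\<exists>F. \<forall>x::real. (F has_vector_derivative g x) (at x)"
    using einterval_antiderivative[of "-\<infinity>" "\<infinity>" g] assms
    by (auto simp: continuous_on_eq_continuous_at)
  then obtain F where F: "\<And>x. (F has_vector_derivative g x) (at x)" by blast
  show ?thesis
    by (rule that[of "\<lambda>t. F t - F 0"]) (auto intro!: derivative_eq_intros F)
qed

text \<open>Picard iteration, carried out at once on the whole time axis.  The unknown is
  \<open>w t = exp (- 2 K \<bar>t\<bar>) (x t - z)\<close>, which ranges over the bounded continuous functions; with this
  weight the integral operator halves distances, so the iteration converges for all times together.\<close>

lemma lipschitz_ode_solution:
  fixes f :: "'a::euclidean_space \<Rightarrow> 'a"
  assumes f: "L-lipschitz_on UNIV f"
  obtains x where "x 0 = z" "\<And>t::real. (x has_vector_derivative f (x t)) (at t)"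
proof -
  \<comment> \<open>a positive Lipschitz constant, so that dividing by it makes sense\<close>
  define K where "K = L + 1"
  have K: "K > 0" using lipschitz_on_nonneg[OF f] by (simp add: K_def)
  have fK: "norm (f u - f v) \<le> K * norm (u - v)" for u v
  proof -
    have "norm (f u - f v) \<le> L * norm (u - v)"
      using lipschitz_onD[OF f, of u v] by (simp add: dist_norm)
    also have "\<dots> \<le> K * norm (u - v)" by (intro mult_right_mono) (auto simp: K_def)
    finally show ?thesis .
  qed
  have fc: "continuous_on UNIV f" by (rule lipschitz_on_continuous_on[OF f])
  define u where "u w s = z + exp (2 * K * \<bar>s\<bar>) *\<^sub>R apply_bcontfun w s" for w :: "real \<Rightarrow>\<^sub>C 'a" and s
  have uc: "continuous_on UNIV (\<lambda>s. f (u w s))" for w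
    unfolding u_def
    by (rule continuous_on_compose2[OF fc]) (auto intro!: continuous_intros)
  define G where "G w = (SOME G. (\<forall>t. (G has_vector_derivative f (u w t)) (at t)) \<and> G 0 = 0)" for w
  have G: "(G w has_vector_derivative f (u w t)) (at t)" "G w 0 = 0" for w t
  proof -
    have "\<exists>G. (\<forall>t. (G has_vector_derivative f (u w t)) (at t)) \<and> G 0 = 0"
      using continuous_antiderivative[OF uc[of w]] by metis
    from someI_ex[OF this]
    show "(G w has_vector_derivative f (u w t)) (at t)" "G w 0 = 0"
      unfolding G_def by blast+
  qed
  define W where "W w t = exp (- (2 * K * \<bar>t\<bar>)) *\<^sub>R G w t" for w t
  have Gc: "continuous_on UNIV (G w)" for w
    by (intro continuous_at_imp_continuous_on ballI has_vector_derivative_continuous[OF G(1)])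
  have Wc: "continuous_on UNIV (W w)" for w
    unfolding W_def by (intro continuous_intros Gc)
  have Wb: "bounded (range (W w))" for w
  proof -
    obtain B where B: "\<And>t. norm (apply_bcontfun w t) \<le> B"
      using bounded_apply_bcontfun[of w] unfolding bounded_iff by blast
    have B0: "0 \<le> B" using B[of 0] norm_ge_zero order_trans by blast
    have "norm (f (u w t)) \<le> (norm (f z) + K * B) * exp (2 * K * \<bar>t\<bar>)" for t
    proof -
      have "norm (f (u w t)) \<le> norm (f z) + norm (f (u w t) - f z)"
        by (metis add.commute norm_triangle_sub)
      also have "\<dots> \<le> norm (f z) + K * norm (u w t - z)" using fK by (intro add_left_mono)
      also have "norm (u w t - z) \<le> exp (2 * K * \<bar>t\<bar>) * B"
        by (simp add: u_def B)
      also have "norm (f z) + K * (exp (2 * K * \<bar>t\<bar>) * B) \<le> norm (f z) * exp (2 * K * \<bar>t\<bar>) + K * (exp (2 * K * \<bar>t\<bar>) * B)"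
        using K by (intro add_right_mono) (simp add: mult_le_cancel_left1)
      finally show ?thesis using K by (simp add: algebra_simps)
    qed
    then have g: "norm (G w t - G w 0) \<le> (norm (f z) + K * B) / (2 * K) * (exp (2 * K * \<bar>t\<bar>) - 1)" for t
      using K G by (intro antiderivative_growth) auto
    have "norm (W w t) \<le> (norm (f z) + K * B) / (2 * K)" for t
    proof -
      have "norm (W w t) = exp (- (2 * K * \<bar>t\<bar>)) * norm (G w t)" by (simp add: W_def)
      also have "\<dots> \<le> exp (- (2 * K * \<bar>t\<bar>)) * ((norm (f z) + K * B) / (2 * K) * (exp (2 * K * \<bar>t\<bar>) - 1))"
        using g[of t] G(2) by (intro mult_left_mono) auto
      also have "\<dots> \<le> exp (- (2 * K * \<bar>t\<bar>)) * ((norm (f z) + K * B) / (2 * K) * exp (2 * K * \<bar>t\<bar>))"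
        using K B0 by (intro mult_left_mono) auto
      also have "\<dots> = (norm (f z) + K * B) / (2 * K)" by (simp add: exp_minus)
      finally show ?thesis .
    qed
    then show ?thesis unfolding bounded_iff by blast
  qed
  have Win: "W w \<in> bcontfun" for w
    using Wc Wb by (simp add: bcontfun_def)
  define Op where "Op w = Bcontfun (W w)" for w
  have Op: "apply_bcontfun (Op w) = W w" for w
    unfolding Op_def using Win by (simp add: Bcontfun_inverse)
  have contr: "dist (Op v) (Op w) \<le> 1 / 2 * dist v w" for v w
  proof (rule dist_bound)
    fix t
    have "norm ((\<lambda>s. G v s - G w s) t - (\<lambda>s. G v s - G w s) 0)
        \<le> (K * dist v w) / (2 * K) * (exp (2 * K * \<bar>t\<bar>) - 1)"
    proof (rule antiderivative_growth)
      show "((\<lambda>s. G v s - G w s) has_vector_derivative f (u v s) - f (u w s)) (at s)" for s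
        by (intro derivative_intros G)
      show "norm (f (u v s) - f (u w s)) \<le> K * dist v w * exp (2 * K * \<bar>s\<bar>)" for s
      proof -
        have "norm (f (u v s) - f (u w s)) \<le> K * norm (u v s - u w s)" by (rule fK)
        also have "u v s - u w s = exp (2 * K * \<bar>s\<bar>) *\<^sub>R (apply_bcontfun v s - apply_bcontfun w s)"
          by (simp add: u_def algebra_simps)
        also have "norm \<dots> = exp (2 * K * \<bar>s\<bar>) * dist (apply_bcontfun v s) (apply_bcontfun w s)"
          by (simp add: dist_norm)
        also have "K * \<dots> \<le> K * (exp (2 * K * \<bar>s\<bar>) * dist v w)"
          using K by (intro mult_left_mono dist_bounded) auto
        finally show ?thesis by (simp add: mult_ac)
      qed
    qed (use K in auto)
    then have g: "norm (G v t - G w t) \<le> 1 / 2 * dist v w * (exp (2 * K * \<bar>t\<bar>) - 1)"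
      using K by (simp add: G(2))
    have "dist (apply_bcontfun (Op v) t) (apply_bcontfun (Op w) t)
        = exp (- (2 * K * \<bar>t\<bar>)) * norm (G v t - G w t)"
      by (simp add: Op W_def dist_norm flip: scaleR_diff_right)
    also have "\<dots> \<le> exp (- (2 * K * \<bar>t\<bar>)) * (1 / 2 * dist v w * (exp (2 * K * \<bar>t\<bar>) - 1))"
      by (intro mult_left_mono g) auto
    also have "\<dots> \<le> exp (- (2 * K * \<bar>t\<bar>)) * (1 / 2 * dist v w * exp (2 * K * \<bar>t\<bar>))"
      by (intro mult_left_mono) auto
    also have "\<dots> = 1 / 2 * dist v w" by (simp add: exp_minus)
    finally show "dist (apply_bcontfun (Op v) t) (apply_bcontfun (Op w) t) \<le> 1 / 2 * dist v w" .
  qed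
  then have "\<exists>!w. Op w = w" by (intro banach_fix_type[where c="1/2"]) auto
  then obtain w where w: "Op w = w" by blast
  have ww: "apply_bcontfun w t = W w t" for t by (metis Op w)
  have uG: "u w t = z + G w t" for t
    by (simp add: u_def ww W_def exp_minus)
  show ?thesis
  proof (rule that[of "\<lambda>t. z + G w t"])
    show "z + G w 0 = z" by (simp add: G)
    show "((\<lambda>t. z + G w t) has_vector_derivative f (z + G w t)) (at t)" for t
      using G(1)[of w t] unfolding uG by (auto intro!: derivative_eq_intros)
  qed
qed

section \<open>Newton's equation and the Hamiltonian flow\<close>

definition newton :: "('a \<Rightarrow> 'a) \<Rightarrow> 'a \<times> 'a \<Rightarrow> 'a \<times> 'a" where
  "newton F z = (snd z, F (fst z))"

definition flip :: "'a \<times> 'a::uminus \<Rightarrow> 'a \<times> 'a" where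
  "flip z = (fst z, - snd z)"

lemma flip_flip [simp]: "flip (flip z) = (z :: 'a \<times> 'a::group_add)"
  by (simp add: flip_def)

lemma fst_flip [simp]: "fst (flip z) = fst z" by (simp add: flip_def)

lemma has_vector_derivative_fst_snd:
  assumes "(x has_vector_derivative d) (at t)"
  shows "((\<lambda>s. fst (x s)) has_vector_derivative fst d) (at t)"
    and "((\<lambda>s. snd (x s)) has_vector_derivative snd d) (at t)"
  using bounded_linear.has_vector_derivative[OF bounded_linear_fst assms]
    bounded_linear.has_vector_derivative[OF bounded_linear_snd assms] by auto

text \<open>Newton's equation is invariant under reversal of time and momentum.  Estimates for positive times
  thereby carry over to negative ones.\<close>

lemma newton_reversible:
  fixes x :: "real \<Rightarrow> 'a::real_normed_vector \<times> 'a"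
  assumes "(x has_vector_derivative newton F (x (- t))) (at (- t))"
  shows "((\<lambda>s. flip (x (- s))) has_vector_derivative newton F (flip (x (- t)))) (at t)"
proof -
  have "((\<lambda>s. x (- s)) has_vector_derivative - newton F (x (- t))) (at t)"
    by (rule has_vector_derivative_reflect[OF assms])
  note d = has_vector_derivative_fst_snd[OF this]
  show ?thesis
    using has_vector_derivative_Pair[OF d(1) has_vector_derivative_minus[OF d(2)]]
    by (simp add: flip_def newton_def)
qed

lemma norm_newton_diff_le:
  fixes F :: "'a::real_normed_vector \<Rightarrow> 'a"
  assumes F: "L-lipschitz_on S F" and "fst z \<in> S" "fst w \<in> S"
  shows "norm (newton F z - newton F w) \<le> (1 + L) * norm (z - w)"
proof -
  have "norm (newton F z - newton F w) \<le> norm (snd z - snd w) + norm (F (fst z) - F (fst w))"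
    using norm_Pair_le[of "snd z - snd w" "F (fst z) - F (fst w)"] by (simp add: newton_def)
  also have "norm (snd z - snd w) \<le> norm (z - w)"
    using norm_snd_le[of "snd (z - w)" "fst (z - w)"] unfolding prod.collapse by simp
  also have "norm (F (fst z) - F (fst w)) \<le> L * norm (fst z - fst w)"
    using lipschitz_onD[OF F assms(2,3)] by (simp add: dist_norm)
  also have "\<dots> \<le> L * norm (z - w)"
    using lipschitz_on_nonneg[OF F] norm_fst_le[of "fst (z - w)" "snd (z - w)"]
    unfolding prod.collapse by (intro mult_left_mono) simp_all
  finally show ?thesis by (simp add: algebra_simps)
qed

lemma newton_lipschitz:
  fixes F :: "'a::real_normed_vector \<Rightarrow> 'a"
  assumes "L-lipschitz_on UNIV F"
  shows "(1 + L)-lipschitz_on UNIV (newton F)"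
  using norm_newton_diff_le[OF assms] lipschitz_on_nonneg[OF assms]
  by (auto intro!: lipschitz_onI simp: dist_norm)

lemma newton_unique_forward:
  fixes x y :: "real \<Rightarrow> 'a::real_inner \<times> 'a"
  assumes T: "0 \<le> T" and F: "L-lipschitz_on S F"
    and x: "\<And>t. \<lbrakk>0 \<le> t; t \<le> T\<rbrakk> \<Longrightarrow> (x has_vector_derivative newton F (x t)) (at t) \<and> fst (x t) \<in> S"
    and y: "\<And>t. \<lbrakk>0 \<le> t; t \<le> T\<rbrakk> \<Longrightarrow> (y has_vector_derivative newton F (y t)) (at t) \<and> fst (y t) \<in> S"
    and 0: "x 0 = y 0"
  shows "x T = y T"
proof -
  have "norm (x T - y T) \<le> exp ((1 + L) * T) * norm (x 0 - y 0)"
  proof (rule gronwall_forward[OF T, where x="\<lambda>t. x t - y t"])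
    show "((\<lambda>t. x t - y t) has_vector_derivative (newton F (x t) - newton F (y t))) (at t)"
      if "0 \<le> t" "t \<le> T" for t
      using x[OF that] y[OF that] by (auto intro: has_vector_derivative_diff)
    show "norm (newton F (x t) - newton F (y t)) \<le> (1 + L) * norm (x t - y t)"
      if "0 \<le> t" "t \<le> T" for t
      using norm_newton_diff_le[OF F] x[OF that] y[OF that] by blast
  qed (use lipschitz_on_nonneg[OF F] in auto)
  with 0 show ?thesis by simp
qed

text \<open>The flow of a globally Lipschitz force field; the chosen solution is the only one.\<close>

definition nflow :: "('a::euclidean_space \<Rightarrow> 'a) \<Rightarrow> real \<Rightarrow> 'a \<times> 'a \<Rightarrow> 'a \<times> 'a" where
  "nflow F t z = (SOME x. x 0 = z \<and> (\<forall>t. (x has_vector_derivative newton F (x t)) (at t))) t"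

context
  fixes F :: "'a::euclidean_space \<Rightarrow> 'a" and L
  assumes F: "L-lipschitz_on UNIV F"
begin

lemma nflow_solves:
  shows nflow_0: "nflow F 0 z = z"
    and nflow_deriv: "((\<lambda>t. nflow F t z) has_vector_derivative newton F (nflow F t z)) (at t)"
proof -
  have "\<exists>x. x 0 = z \<and> (\<forall>t. (x has_vector_derivative newton F (x t)) (at t))"
    by (rule lipschitz_ode_solution[OF newton_lipschitz[OF F], of z]) blast
  from someI_ex[OF this]
  show "nflow F 0 z = z"
    "((\<lambda>t. nflow F t z) has_vector_derivative newton F (nflow F t z)) (at t)"
    unfolding nflow_def by (blast, simp add: nflow_def)
qed

lemma nflow_close_forward:
  assumes "0 \<le> t"
  shows "norm (nflow F t z - nflow F t w) \<le> exp ((1 + L) * t) * norm (z - w)"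
  using lipschitz_solutions_close[OF newton_lipschitz[OF F] assms, of "\<lambda>t. nflow F t z" "\<lambda>t. nflow F t w"]
  by (simp add: nflow_0 nflow_deriv)

lemma nflow_unique_forward:
  assumes T: "0 \<le> T" and x: "\<And>t. \<lbrakk>0 \<le> t; t \<le> T\<rbrakk> \<Longrightarrow> (x has_vector_derivative newton F (x t)) (at t)"
  shows "x T = nflow F T (x 0)"
  by (rule newton_unique_forward[OF T F]) (auto simp: nflow_0 intro: x nflow_deriv)

lemma nflow_minus: "nflow F (- t) z = flip (nflow F t (flip z))"
proof -
  have *: "nflow F (- t) z = flip (nflow F t (flip z))" if "0 \<le> t" for t z
  proof -
    have "flip (nflow F (- t) z) = nflow F t (flip (nflow F (- 0) z))"
      by (rule nflow_unique_forward[OF that, where x="\<lambda>t. flip (nflow F (- t) z)"])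
        (rule newton_reversible, rule nflow_deriv)
    then have "flip (flip (nflow F (- t) z)) = flip (nflow F t (flip z))"
      by (simp add: nflow_0)
    then show ?thesis by simp
  qed
  show ?thesis
  proof (cases "0 \<le> t")
    case False
    then have "nflow F (- (- t)) (flip z) = flip (nflow F (- t) (flip (flip z)))"
      by (intro *) auto
    then show ?thesis by simp
  qed (rule *)
qed

lemma norm_flip_diff: "norm (flip z - flip w) = norm (z - (w :: 'a \<times> 'a))"
  by (simp add: flip_def norm_prod_def norm_minus_commute)

lemma nflow_close: "norm (nflow F t z - nflow F t w) \<le> exp ((1 + L) * \<bar>t\<bar>) * norm (z - w)"
proof (cases "0 \<le> t")
  case False
  then show ?thesis
    using nflow_close_forward[of "- t" "flip z" "flip w"] nflow_minus[of "-t"]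
    by (simp add: norm_flip_diff)
qed (use nflow_close_forward in simp)

lemma continuous_nflow: "continuous_on UNIV (\<lambda>(t, z). nflow F t z)"
proof (intro continuous_at_imp_continuous_on ballI)
  fix a :: "real \<times> ('a \<times> 'a)"
  obtain t0 z0 where a: "a = (t0, z0)" by (cases a)
  have "((\<lambda>b. nflow F (fst b) (snd b)) \<longlongrightarrow> nflow F t0 z0) (at (t0, z0))"
  proof (rule Lim_transform2[where f="\<lambda>b. nflow F (fst b) z0"])
    have "isCont (\<lambda>t. nflow F t z0) t0"
      using has_vector_derivative_continuous[OF nflow_deriv] .
    then show "((\<lambda>b. nflow F (fst b) z0) \<longlongrightarrow> nflow F t0 z0) (at (t0, z0))"
      by (rule isCont_tendsto_compose) (rule tendsto_eq_intros | simp)+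
    have "((\<lambda>b. exp ((1 + L) * \<bar>fst b\<bar>) * norm (snd b - z0)) \<longlongrightarrow> exp ((1 + L) * \<bar>t0\<bar>) * norm (z0 - z0)) (at (t0, z0))"
      by (rule tendsto_intros tendsto_eq_intros | simp)+
    then have lim: "((\<lambda>b. exp ((1 + L) * \<bar>fst b\<bar>) * norm (snd b - z0)) \<longlongrightarrow> 0) (at (t0, z0))"
      by simp
    show "((\<lambda>b. nflow F (fst b) z0 - nflow F (fst b) (snd b)) \<longlongrightarrow> 0) (at (t0, z0))"
    proof (rule Lim_null_comparison[OF _ lim], intro always_eventually allI)
      fix b :: "real \<times> 'a \<times> 'a"
      show "norm (nflow F (fst b) z0 - nflow F (fst b) (snd b)) \<le> exp ((1 + L) * \<bar>fst b\<bar>) * norm (snd b - z0)"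
        using nflow_close[of "fst b" z0 "snd b"] by (simp add: norm_minus_commute)
    qed
  qed
  then show "isCont (\<lambda>(t, z). nflow F t z) a"
    by (simp add: a isCont_def case_prod_beta')
qed

end

text \<open>The field is frozen radially outside a ball.  Projection onto the ball does not increase distances, so
  a Lipschitz constant on the ball becomes a global one.\<close>

definition cutoff :: "('a::euclidean_space \<Rightarrow> 'a) \<Rightarrow> real \<Rightarrow> 'a \<Rightarrow> 'a" where
  "cutoff F R q = F (closest_point (cball 0 R) q)"

lemma cutoff_eq: "norm q \<le> R \<Longrightarrow> cutoff F R q = F q"
  by (simp add: cutoff_def closest_point_self)

lemma cutoff_lipschitz:
  assumes F: "L-lipschitz_on (cball 0 R) F" and R: "0 \<le> R"
  shows "L-lipschitz_on UNIV (cutoff F R)"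
proof (rule lipschitz_onI)
  fix x y
  have in_ball: "closest_point (cball 0 R) x \<in> cball 0 R" for x :: 'a
    using R by (intro closest_point_in_set) auto
  have "dist (cutoff F R x) (cutoff F R y) \<le> L * dist (closest_point (cball 0 R) x) (closest_point (cball 0 R) y)"
    unfolding cutoff_def by (rule lipschitz_onD[OF F in_ball in_ball])
  also have "\<dots> \<le> L * dist x y"
    using R lipschitz_on_nonneg[OF F] by (intro mult_left_mono closest_point_lipschitz) auto
  finally show "dist (cutoff F R x) (cutoff F R y) \<le> L * dist x y" .
qed (rule lipschitz_on_nonneg[OF F])

lemma cutoff_bounded:
  assumes "\<And>q. norm q \<le> R \<Longrightarrow> norm (F q) \<le> G" and "0 \<le> R"
  shows "norm (cutoff F R q) \<le> G"
proof -
  have "closest_point (cball 0 R) q \<in> cball 0 R"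
    using assms(2) by (intro closest_point_in_set) auto
  then show ?thesis unfolding cutoff_def by (intro assms) auto
qed

locale nonneg_potential =
  fixes \<Phi> :: "real ^ 'n::finite \<Rightarrow> real"
  assumes smooth: "C2 \<Phi>" and nonneg: "\<And>q. 0 \<le> \<Phi> q"
begin

abbreviation "H \<equiv> hamiltonian \<Phi>"
abbreviation "force \<equiv> \<lambda>q. - grad \<Phi> q"
abbreviation "\<theta> \<equiv> hamiltonian_flow \<Phi>"

lemma has_derivative_potential: "(\<Phi> has_derivative (\<lambda>h. grad \<Phi> q \<bullet> h)) (at q)"
proof -
  obtain D where D: "(\<Phi> has_derivative D) (at q)"
    using smooth unfolding C2_def differentiable_def by blast
  interpret D: bounded_linear D by (rule has_derivative_bounded_linear[OF D])
  define g where "g = (\<Sum>b\<in>Basis. D b *\<^sub>R b)"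
  have "D h = h \<bullet> g" for h
  proof -
    have "D h = D (\<Sum>b\<in>Basis. (h \<bullet> b) *\<^sub>R b)" by (simp add: euclidean_representation)
    also have "\<dots> = (\<Sum>b\<in>Basis. (h \<bullet> b) * D b)" by (simp add: D.sum D.scaleR)
    also have "\<dots> = h \<bullet> g"
      by (simp add: g_def inner_sum_right mult.commute)
    finally show ?thesis .
  qed
  then have "D = (\<lambda>h. h \<bullet> g)" by auto
  with D have g: "GDERIV \<Phi> q :> g" by (simp add: gderiv_def)
  have "GDERIV \<Phi> q :> grad \<Phi> q"
    unfolding grad_def
  proof (rule theI[where P="\<lambda>D. GDERIV \<Phi> q :> D", OF g])
    fix k assume "GDERIV \<Phi> q :> k"
    with g have "(\<lambda>h. h \<bullet> k) = (\<lambda>h. h \<bullet> g)"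
      unfolding gderiv_def by (rule has_derivative_unique[rotated])
    then have "(k - g) \<bullet> k = (k - g) \<bullet> g" by metis
    then have "(k - g) \<bullet> (k - g) = 0" by (simp add: inner_diff_right)
    then show "k = g" by simp
  qed
  then show ?thesis by (simp add: gderiv_def inner_commute[of "grad \<Phi> q"])
qed

lemma potential_along_curve:
  assumes "(x has_vector_derivative d) (at t)"
  shows "((\<lambda>s. \<Phi> (fst (x s))) has_real_derivative (grad \<Phi> (fst (x t)) \<bullet> fst d)) (at t)"
  using has_derivative_compose[OF has_vector_derivative_fst_snd(1)[OF assms, unfolded has_vector_derivative_def]
      has_derivative_potential]
  unfolding has_field_derivative_def by (rule has_derivative_eq_rhs) (auto simp: fun_eq_iff)

lemma continuous_potential: "continuous_on UNIV \<Phi>"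
  by (intro continuous_at_imp_continuous_on ballI has_derivative_continuous[OF has_derivative_potential])

lemma force_lipschitz_on_cball: "\<exists>L. L-lipschitz_on (cball 0 R) force"
proof -
  obtain f'' :: "real ^ 'n \<Rightarrow> (real ^ 'n) \<Rightarrow>\<^sub>L (real ^ 'n)" where
    f'': "\<And>x. (grad \<Phi> has_derivative blinfun_apply (f'' x)) (at x)" and c: "continuous_on UNIV f''"
    using smooth unfolding C2_def by blast
  have "compact (f'' ` cball 0 R)"
    by (intro compact_continuous_image continuous_on_subset[OF c]) auto
  from compact_imp_bounded[OF this] obtain B where B: "\<And>x. x \<in> cball 0 R \<Longrightarrow> norm (f'' x) \<le> B"
    unfolding bounded_iff by fast
  have "norm (grad \<Phi> x - grad \<Phi> y) \<le> max B 0 * norm (x - y)" if "x \<in> cball 0 R" "y \<in> cball 0 R" for x y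
  proof (rule differentiable_bound[OF convex_cball])
    show "(grad \<Phi> has_derivative blinfun_apply (f'' x)) (at x within cball 0 R)" for x
      using f'' has_derivative_at_withinI by blast
    show "onorm (blinfun_apply (f'' x)) \<le> max B 0" if "x \<in> cball 0 R" for x
      using B[OF that] by (simp add: norm_blinfun.rep_eq[symmetric])
  qed (use that in auto)
  then have "(max B 0)-lipschitz_on (cball 0 R) force"
    by (intro lipschitz_onI) (auto simp: dist_norm norm_minus_commute)
  then show ?thesis ..
qed

lemma continuous_force: "continuous_on UNIV force"
proof -
  obtain f'' :: "real ^ 'n \<Rightarrow> (real ^ 'n) \<Rightarrow>\<^sub>L (real ^ 'n)" where
    f'': "\<And>x. (grad \<Phi> has_derivative blinfun_apply (f'' x)) (at x)"
    using smooth unfolding C2_def by blast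
  have "continuous_on UNIV (grad \<Phi>)"
    by (intro continuous_at_imp_continuous_on ballI has_derivative_continuous[OF f''])
  then show ?thesis by (rule continuous_on_minus)
qed

lemma energy_conservation:
  assumes T: "0 \<le> T" and x: "\<And>t. \<lbrakk>0 \<le> t; t \<le> T\<rbrakk> \<Longrightarrow> (x has_vector_derivative newton force (x t)) (at t)"
  shows "H (x T) = H (x 0)"
proof -
  have "((\<lambda>t. H (x t)) has_real_derivative 0) (at t)" if t: "0 \<le> t" "t \<le> T" for t
  proof -
    note d = has_vector_derivative_fst_snd(2)[OF x[OF t]]
    show ?thesis
      unfolding hamiltonian_def power2_norm_eq_inner
      by (rule DERIV_cong[OF DERIV_add[OF DERIV_cdivide[OF has_real_derivative_inner[OF d d]]
              potential_along_curve[OF x[OF t]]]])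
        (simp add: newton_def inner_commute)
  qed
  then have "\<exists>y. ((\<lambda>t. H (x t)) has_real_derivative y) (at t) \<and> y \<le> 0"
    "\<exists>y. ((\<lambda>t. H (x t)) has_real_derivative y) (at t) \<and> 0 \<le> y" if "0 \<le> t" "t \<le> T" for t
    using that by (metis order_refl)+
  then show ?thesis
    using DERIV_nonpos_imp_nonincreasing[OF T, of "\<lambda>t. H (x t)"]
      DERIV_nonneg_imp_nondecreasing[OF T, of "\<lambda>t. H (x t)"] by force
qed

lemma momentum_le_energy: "norm (snd z) \<le> sqrt (2 * H z)"
  by (rule real_le_rsqrt) (use nonneg[of "fst z"] in \<open>simp add: hamiltonian_def\<close>)

lemma energy_nonneg: "0 \<le> H z"
  using nonneg by (simp add: hamiltonian_def)

lemma H_flip [simp]: "H (flip z) = H z"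
  by (simp add: hamiltonian_def flip_def)

lemma position_bound:
  assumes T: "0 \<le> T" and x: "\<And>t. \<lbrakk>0 \<le> t; t \<le> T\<rbrakk> \<Longrightarrow> (x has_vector_derivative newton force (x t)) (at t)"
  shows "norm (fst (x T)) \<le> norm (fst (x 0)) + T * sqrt (2 * H (x 0))"
proof -
  have "norm (fst (x T) - fst (x 0)) \<le> sqrt (2 * H (x 0)) * T"
  proof (rule increment_bound[OF T])
    fix t assume t: "0 \<le> t" "t \<le> T"
    show "((\<lambda>t. fst (x t)) has_vector_derivative snd (x t)) (at t)"
      using has_vector_derivative_fst_snd(1)[OF x[OF t]] by (simp add: newton_def)
    have "H (x t) = H (x 0)" using t x by (intro energy_conservation) auto
    then show "norm (snd (x t)) \<le> sqrt (2 * H (x 0))" using momentum_le_energy[of "x t"] by simp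
  qed
  then show ?thesis
    using norm_triangle_sub[of "fst (x T)" "fst (x 0)"] by (simp add: mult.commute)
qed

text \<open>An upper bound for the distance from the origin up to time \<open>T\<close>, since the speed never exceeds
  \<open>sqrt (2 * H z)\<close>.  The final \<open>1\<close> makes the bound strict.\<close>

definition reach :: "real \<Rightarrow> 'n phase \<Rightarrow> real" where
  "reach T z = norm (fst z) + T * sqrt (2 * H z) + 1"

lemma reach_mono: "T \<le> T' \<Longrightarrow> reach T z \<le> reach T' z"
  unfolding reach_def by (simp add: mult_right_mono energy_nonneg)

lemma reach_pos: "0 \<le> T \<Longrightarrow> 0 < reach T z"
  unfolding reach_def by (smt (verit) energy_nonneg mult_nonneg_nonneg norm_ge_zero real_sqrt_ge_zero)

lemma cutoff_force_lipschitz: "0 \<le> R \<Longrightarrow> \<exists>L. L-lipschitz_on UNIV (cutoff force R)"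
  using cutoff_lipschitz force_lipschitz_on_cball by blast

lemma newton_cutoff_eq: "norm (fst z) \<le> R \<Longrightarrow> newton (cutoff force R) z = newton force z"
  by (simp add: newton_def cutoff_eq)

text \<open>A trajectory of the truncated field cannot leave the ball before time \<open>T\<close>: up to the first
  exit time it is a trajectory of the true field, which conserves energy and hence moves slowly.\<close>

lemma cutoff_flow_in_ball_forward:
  assumes t: "0 \<le> t" "t \<le> T" and R: "reach T z \<le> R"
  shows "norm (fst (nflow (cutoff force R) t z)) \<le> R"
proof (rule ccontr)
  let ?y = "\<lambda>t. nflow (cutoff force R) t z"
  have R0: "0 \<le> R" using reach_pos[of T z] R t by linarith
  from cutoff_force_lipschitz[OF R0] obtain L where L: "L-lipschitz_on UNIV (cutoff force R)" ..
  have cont: "continuous_on UNIV (\<lambda>t. norm (fst (?y t)))"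
    by (intro continuous_intros continuous_at_imp_continuous_on ballI
        has_vector_derivative_continuous[OF nflow_deriv[OF L]])
  assume "\<not> norm (fst (?y t)) \<le> R"
  with t have ne: "{s \<in> {0..T}. R \<le> norm (fst (?y s))} \<noteq> {}" by force
  have "closed {s. R \<le> norm (fst (?y s))}"
    using cont by (intro closed_Collect_le) (auto intro: continuous_intros)
  then have "compact ({0..T} \<inter> {s. R \<le> norm (fst (?y s))})"
    by (intro compact_Int_closed) auto
  moreover have "{0..T} \<inter> {s. R \<le> norm (fst (?y s))} = {s \<in> {0..T}. R \<le> norm (fst (?y s))}" by auto
  ultimately obtain \<tau> where \<tau>: "\<tau> \<in> {0..T}" "R \<le> norm (fst (?y \<tau>))"
    and first: "\<And>s. \<lbrakk>s \<in> {0..T}; R \<le> norm (fst (?y s))\<rbrakk> \<Longrightarrow> \<tau> \<le> s"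
    using compact_attains_inf[of "{s \<in> {0..T}. R \<le> norm (fst (?y s))}"] ne by auto
  have before: "norm (fst (?y s)) < R" if "0 \<le> s" "s < \<tau>" for s
    using first[of s] that \<tau>(1) by force
  have pos: "0 < \<tau>"
  proof (rule ccontr)
    assume "\<not> 0 < \<tau>"
    with \<tau>(1) have "\<tau> = 0" by auto
    with \<tau>(2) have "R \<le> norm (fst z)" by (simp add: nflow_0[OF L])
    moreover have "norm (fst z) < reach T z"
      unfolding reach_def using t energy_nonneg[of z] by (simp add: add_strict_increasing2)
    ultimately show False using R by linarith
  qed
  have "norm (fst (?y \<tau>)) \<le> R"
  proof (rule tendsto_upperbound)
    show "((\<lambda>s. norm (fst (?y s))) \<longlongrightarrow> norm (fst (?y \<tau>))) (at_left \<tau>)"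
      using cont by (auto simp: continuous_on_def intro: tendsto_within_subset)
    show "\<forall>\<^sub>F s in at_left \<tau>. norm (fst (?y s)) \<le> R"
      using eventually_at_left_real[OF pos] by eventually_elim (auto intro!: less_imp_le before)
  qed simp
  then have upto: "norm (fst (?y s)) \<le> R" if "0 \<le> s" "s \<le> \<tau>" for s
    using before[of s] that by (cases "s = \<tau>") auto
  have "norm (fst (?y \<tau>)) \<le> norm (fst (?y 0)) + \<tau> * sqrt (2 * H (?y 0))"
  proof (rule position_bound[OF less_imp_le[OF pos]])
    show "(?y has_vector_derivative newton force (?y s)) (at s)" if "0 \<le> s" "s \<le> \<tau>" for s
      using nflow_deriv[OF L, of z s] newton_cutoff_eq[OF upto[OF that]] by simp
  qed
  also have "\<dots> \<le> norm (fst z) + T * sqrt (2 * H z)"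
    using \<tau>(1) energy_nonneg by (simp add: nflow_0[OF L] mult_right_mono)
  also have "\<dots> < R" using R by (simp add: reach_def)
  finally show False using \<tau>(2) by simp
qed

lemma reach_flip [simp]: "reach T (flip z) = reach T z"
  by (simp add: reach_def)

lemma cutoff_flow_in_ball:
  assumes t: "\<bar>t\<bar> \<le> T" and R: "reach T z \<le> R"
  shows "norm (fst (nflow (cutoff force R) t z)) \<le> R"
proof (cases "0 \<le> t")
  case False
  have R0: "0 \<le> R" using reach_pos[of T z] R t by linarith
  from cutoff_force_lipschitz[OF R0] obtain L where L: "L-lipschitz_on UNIV (cutoff force R)" ..
  have "norm (fst (nflow (cutoff force R) (- t) (flip z))) \<le> R"
    using False t R by (intro cutoff_flow_in_ball_forward[where T=T]) auto
  moreover have "nflow (cutoff force R) t z = flip (nflow (cutoff force R) (- t) (flip z))"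
    using nflow_minus[OF L, of "-t" z] unfolding minus_minus .
  ultimately show ?thesis by (simp only: fst_flip)
qed (use cutoff_flow_in_ball_forward assms in auto)

lemma cutoff_flow_solves:
  assumes t: "\<bar>t\<bar> \<le> T" and R: "reach T z \<le> R"
  shows "((\<lambda>s. nflow (cutoff force R) s z) has_vector_derivative newton force (nflow (cutoff force R) t z)) (at t)"
proof -
  have R0: "0 \<le> R" using reach_pos[of T z] R t by linarith
  from cutoff_force_lipschitz[OF R0] obtain L where L: "L-lipschitz_on UNIV (cutoff force R)" ..
  show ?thesis
    using nflow_deriv[OF L, of z t] newton_cutoff_eq[OF cutoff_flow_in_ball[OF assms]] by simp
qed

lemma newton_force_unique_forward:
  assumes T: "0 \<le> T"
    and x: "\<And>t. \<lbrakk>0 \<le> t; t \<le> T\<rbrakk> \<Longrightarrow> (x has_vector_derivative newton force (x t)) (at t)"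
    and y: "\<And>t. \<lbrakk>0 \<le> t; t \<le> T\<rbrakk> \<Longrightarrow> (y has_vector_derivative newton force (y t)) (at t)"
    and 0: "x 0 = y 0"
  shows "x T = y T"
proof -
  let ?R = "reach T (x 0)"
  from force_lipschitz_on_cball obtain L where L: "L-lipschitz_on (cball 0 ?R) force" ..
  have *: "norm (fst (w t)) \<le> ?R"
    if t: "0 \<le> t" "t \<le> T" and w0: "w 0 = x 0"
      and w: "\<And>t. \<lbrakk>0 \<le> t; t \<le> T\<rbrakk> \<Longrightarrow> (w has_vector_derivative newton force (w t)) (at t)" for w t
  proof -
    have "norm (fst (w t)) \<le> norm (fst (w 0)) + t * sqrt (2 * H (w 0))"
      using t w by (intro position_bound) auto
    also have "\<dots> \<le> ?R"
      unfolding reach_def w0 using t energy_nonneg by (simp add: mult_right_mono add_increasing2)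
    finally show ?thesis .
  qed
  show ?thesis
    using x y 0 *[of _ x] *[of _ y]
    by (intro newton_unique_forward[OF T L, where x=x and y=y]) auto
qed

lemma newton_force_unique:
  assumes x: "\<And>t. \<bar>t\<bar> \<le> T \<Longrightarrow> (x has_vector_derivative newton force (x t)) (at t)"
    and y: "\<And>t. \<bar>t\<bar> \<le> T \<Longrightarrow> (y has_vector_derivative newton force (y t)) (at t)"
    and 0: "x 0 = y 0" and t: "\<bar>t\<bar> \<le> T"
  shows "x t = y t"
proof (cases "0 \<le> t")
  case True
  then show ?thesis using assms by (intro newton_force_unique_forward[of t x y]) auto
next
  case False
  have "(\<lambda>s. flip (x (- s))) (- t) = (\<lambda>s. flip (y (- s))) (- t)"
  proof (rule newton_force_unique_forward[where x="\<lambda>s. flip (x (- s))" and y="\<lambda>s. flip (y (- s))"])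
    fix s assume s: "0 \<le> s" "s \<le> - t"
    then have s': "\<bar>- s\<bar> \<le> T" using t by auto
    show "((\<lambda>s. flip (x (- s))) has_vector_derivative newton force (flip (x (- s)))) (at s)"
      by (rule newton_reversible[OF x[OF s']])
    show "((\<lambda>s. flip (y (- s))) has_vector_derivative newton force (flip (y (- s)))) (at s)"
      by (rule newton_reversible[OF y[OF s']])
  qed (use False 0 in auto)
  then have "flip (x t) = flip (y t)" by simp
  then show ?thesis by (metis flip_flip)
qed

lemma cutoff_flow_eq:
  assumes "reach \<bar>t\<bar> z \<le> R" "reach \<bar>t\<bar> z \<le> R'"
  shows "nflow (cutoff force R) t z = nflow (cutoff force R') t z"
proof (rule newton_force_unique[where T="\<bar>t\<bar>"])
  have "0 \<le> R" "0 \<le> R'" using reach_pos[of "\<bar>t\<bar>" z] assms by auto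
  then show "nflow (cutoff force R) 0 z = nflow (cutoff force R') 0 z"
    using cutoff_force_lipschitz nflow_0 by metis
qed (use cutoff_flow_solves assms in auto)

text \<open>The radius of truncation depends on time through \<open>\<bar>t\<bar> + 1\<close> instead of \<open>\<bar>t\<bar>\<close>: near \<open>t\<close> the solution then
  agrees with a single truncated flow and can be differentiated.\<close>

lemma flow_exists_unique:
  "\<exists>!f. \<forall>z. f 0 z = z \<and> (\<forall>t. ((\<lambda>s. f s z) has_vector_derivative (snd (f t z), force (fst (f t z)))) (at t))"
proof (rule ex_ex1I)
  define f where "f t z = nflow (cutoff force (reach (\<bar>t\<bar> + 1) z)) t z" for t z
  have "f 0 z = z" for z
  proof -
    have "0 \<le> reach (\<bar>0\<bar> + 1) z" using reach_pos[of 1 z] by simp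
    then show ?thesis unfolding f_def using cutoff_force_lipschitz nflow_0 by metis
  qed
  moreover have "((\<lambda>s. f s z) has_vector_derivative newton force (f t z)) (at t)" for t z
  proof -
    let ?R = "reach (\<bar>t\<bar> + 1) z"
    have "((\<lambda>s. nflow (cutoff force ?R) s z) has_vector_derivative newton force (f t z)) (at t)"
      unfolding f_def by (rule cutoff_flow_solves[where T="\<bar>t\<bar> + 1"]) auto
    then show ?thesis
    proof (rule has_vector_derivative_transform_within_open[where S="ball t 1"])
      fix s assume "s \<in> ball t 1"
      then have "\<bar>s\<bar> \<le> \<bar>t\<bar> + 1" by (auto simp: dist_real_def)
      then show "nflow (cutoff force ?R) s z = f s z"
        unfolding f_def by (intro cutoff_flow_eq reach_mono) auto
    qed auto
  qed
  ultimately show "\<exists>f. \<forall>z. f 0 z = z \<and> (\<forall>t. ((\<lambda>s. f s z) has_vector_derivative (snd (f t z), force (fst (f t z)))) (at t))"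
    unfolding newton_def by blast
next
  fix f g
  assume f: "\<forall>z. f 0 z = z \<and> (\<forall>t. ((\<lambda>s. f s z) has_vector_derivative (snd (f t z), force (fst (f t z)))) (at t))"
    and g: "\<forall>z. g 0 z = z \<and> (\<forall>t. ((\<lambda>s. g s z) has_vector_derivative (snd (g t z), force (fst (g t z)))) (at t))"
  have "f t z = g t z" for t z
    by (rule newton_force_unique[where T="\<bar>t\<bar>" and x="\<lambda>t. f t z" and y="\<lambda>t. g t z"])
      (use f g in \<open>simp_all add: newton_def del: split_paired_All\<close>)
  then show "f = g" by blast
qed

lemma flow_0 [simp]: "\<theta> 0 z = z"
  and flow_deriv: "((\<lambda>s. \<theta> s z) has_vector_derivative newton force (\<theta> t z)) (at t)"
  using theI'[OF flow_exists_unique] unfolding hamiltonian_flow_def newton_def by blast+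

lemma flow_unique:
  assumes "\<And>t. \<bar>t\<bar> \<le> T \<Longrightarrow> (x has_vector_derivative newton force (x t)) (at t)" and "\<bar>t\<bar> \<le> T"
  shows "x t = \<theta> t (x 0)"
  by (rule newton_force_unique[where T=T, OF _ _ _ assms(2)]) (auto intro: flow_deriv assms(1))

lemma flow_add: "\<theta> (s + t) z = \<theta> s (\<theta> t z)"
proof -
  have "(\<lambda>s. \<theta> (s + t) z) s = \<theta> s ((\<lambda>s. \<theta> (s + t) z) 0)"
  proof (rule flow_unique[where T="\<bar>s\<bar>"])
    show "((\<lambda>s. \<theta> (s + t) z) has_vector_derivative newton force (\<theta> (u + t) z)) (at u)" for u
    proof -
      have "((\<lambda>s. s + t) has_vector_derivative 1) (at u)"
        by (auto intro!: derivative_eq_intros)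
      from vector_diff_chain_at[OF this flow_deriv] show ?thesis by (simp add: o_def)
    qed
  qed simp
  then show ?thesis by simp
qed

lemma flow_inverse [simp]: "\<theta> (- t) (\<theta> t z) = z"
  using flow_add[of "-t" t z] by simp

lemma flow_eq_cutoff_flow: "\<lbrakk>\<bar>t\<bar> \<le> T; reach T z \<le> R\<rbrakk> \<Longrightarrow> \<theta> t z = nflow (cutoff force R) t z"
proof -
  assume *: "\<bar>t\<bar> \<le> T" "reach T z \<le> R"
  have "0 \<le> R" using reach_pos[of T z] * by linarith
  then have "nflow (cutoff force R) 0 z = z" using cutoff_force_lipschitz nflow_0 by metis
  then show ?thesis
    using flow_unique[where x="\<lambda>t. nflow (cutoff force R) t z" and T=T and t=t] cutoff_flow_solves *
    by auto
qed

lemma energy_flow: "H (\<theta> t z) = H z"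
proof -
  have *: "H (\<theta> t z) = H z" if "0 \<le> t" for t z
    using energy_conservation[OF that, of "\<lambda>t. \<theta> t z"] flow_deriv by simp
  show ?thesis
  proof (cases "0 \<le> t")
    case False
    then have "H (\<theta> (- t) (\<theta> t z)) = H (\<theta> t z)" by (intro *) auto
    then show ?thesis by simp
  qed (rule *)
qed

lemma continuous_hamiltonian: "continuous_on UNIV H"
  unfolding hamiltonian_def
  by (intro continuous_intros continuous_on_compose2[OF continuous_potential]) auto

text \<open>Locally in time and phase space one truncation serves all points, because the energy is locally
  bounded.\<close>

lemma continuous_flow: "continuous_on UNIV (\<lambda>(t, z). \<theta> t z)"
proof (intro continuous_at_imp_continuous_on ballI)
  fix a :: "real \<times> 'n phase"
  obtain t0 z0 where a: "a = (t0, z0)" by (cases a)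
  define T where "T = \<bar>t0\<bar> + 1"
  have "compact (reach T ` cball z0 1)"
    unfolding reach_def
    by (intro compact_continuous_image continuous_intros continuous_on_subset[OF continuous_hamiltonian]) auto
  from compact_imp_bounded[OF this] obtain R where R: "\<And>z. z \<in> cball z0 1 \<Longrightarrow> norm (reach T z) \<le> R"
    unfolding bounded_iff by fast
  have R0: "0 \<le> R" using R[of z0] by (smt (verit) centre_in_cball norm_ge_zero)
  from cutoff_force_lipschitz[OF R0] obtain L where L: "L-lipschitz_on UNIV (cutoff force R)" ..
  let ?S = "ball t0 1 \<times> ball z0 1"
  have "continuous_on ?S (\<lambda>(t, z). nflow (cutoff force R) t z)"
    by (rule continuous_on_subset[OF continuous_nflow[OF L]]) auto
  also have "continuous_on ?S (\<lambda>(t, z). nflow (cutoff force R) t z) \<longleftrightarrow> continuous_on ?S (\<lambda>(t, z). \<theta> t z)"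
  proof (rule continuous_on_cong[OF refl], safe)
    fix t z assume "t \<in> ball t0 1" "z \<in> ball z0 1"
    then show "nflow (cutoff force R) t z = \<theta> t z"
      using R[of z] by (intro flow_eq_cutoff_flow[symmetric, where T=T]) (auto simp: T_def dist_real_def)
  qed
  finally have "continuous_on ?S (\<lambda>(t, z). \<theta> t z)" .
  moreover have "open ?S" by (intro open_Times) auto
  moreover have "a \<in> ?S" by (simp add: a)
  ultimately show "isCont (\<lambda>(t, z). \<theta> t z) a"
    by (metis continuous_on_eq_continuous_at)
qed

end

section \<open>Preservation of volume\<close>

lemma measurable_borel_fst [measurable]:
  fixes f :: "'c \<Rightarrow> 'a::second_countable_topology \<times> 'b::second_countable_topology"
  assumes "f \<in> borel_measurable M"
  shows "(\<lambda>x. fst (f x)) \<in> borel_measurable M"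
  by (rule measurable_compose[OF assms])
    (auto intro!: borel_measurable_continuous_onI continuous_intros)

lemma measurable_borel_snd [measurable]:
  fixes f :: "'c \<Rightarrow> 'a::second_countable_topology \<times> 'b::second_countable_topology"
  assumes "f \<in> borel_measurable M"
  shows "(\<lambda>x. snd (f x)) \<in> borel_measurable M"
  by (rule measurable_compose[OF assms])
    (auto intro!: borel_measurable_continuous_onI continuous_intros)

lemma emeasure_lborel_translate:
  fixes c :: "'a::euclidean_space"
  assumes "A \<in> sets borel"
  shows "emeasure lborel {x. x + c \<in> A} = emeasure lborel A"
proof -
  have "emeasure lborel A = emeasure (distr lborel borel ((+) c)) A"
    by (simp add: lborel_distr_plus)
  also have "\<dots> = emeasure lborel {x. x + c \<in> A}"
    using assms by (subst emeasure_distr) (auto simp: add.commute vimage_def)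
  finally show ?thesis ..
qed

lemma lborel_distr_uminus_euclidean: "distr lborel borel (uminus :: 'a::euclidean_space \<Rightarrow> 'a) = lborel"
proof -
  have "distr lborel borel (uminus :: 'a \<Rightarrow> 'a) = distr lborel borel (\<lambda>x. 0 + (- 1) *\<^sub>R x)"
    by (intro distr_cong) auto
  also have "\<dots> = density (distr lborel borel (\<lambda>x. 0 + (- 1) *\<^sub>R x)) (\<lambda>_. 1)"
    by (simp add: density_1)
  also have "\<dots> = lborel"
    using lborel_affine[of "-1" "0::'a"] by simp
  finally show ?thesis .
qed

text \<open>By Fubini's theorem a map that preserves volume in each fibre preserves the product volume.\<close>

lemma lborel_fibrewise:
  fixes T :: "'a::euclidean_space \<Rightarrow> 'b::euclidean_space \<Rightarrow> 'b"
  assumes T: "(\<lambda>z. T (fst z) (snd z)) \<in> borel_measurable borel"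
    and pres: "\<And>x B. B \<in> sets borel \<Longrightarrow> emeasure lborel (T x -` B) = emeasure lborel B"
  shows "distr lborel borel (\<lambda>z. (fst z, T (fst z) (snd z))) = lborel"
proof (rule measure_eqI)
  let ?S = "\<lambda>z. (fst z, T (fst z) (snd z))"
  fix A assume "A \<in> sets (distr lborel borel ?S)"
  then have A: "A \<in> sets borel" by simp
  have S: "?S \<in> borel_measurable borel" using T by measurable
  have sec: "Pair x -` A \<in> sets borel" for x
    using measurable_sets[of "Pair x" "borel :: 'b measure" borel A] A by simp
  have "emeasure (distr lborel borel ?S) A = emeasure (lborel \<Otimes>\<^sub>M lborel) (?S -` A)"
    by (subst emeasure_distr) (use S A in \<open>auto simp: lborel_prod\<close>)
  also have "\<dots> = (\<integral>\<^sup>+x. emeasure lborel (Pair x -` ?S -` A) \<partial>lborel)"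
    by (rule lborel.emeasure_pair_measure_alt, subst lborel_prod) (use measurable_sets[OF S A] in simp)
  also have "\<dots> = (\<integral>\<^sup>+x. emeasure lborel (Pair x -` A) \<partial>lborel)"
    using pres[OF sec] by (simp add: vimage_def)
  also have "\<dots> = emeasure (lborel \<Otimes>\<^sub>M lborel) A"
    by (rule lborel.emeasure_pair_measure_alt[symmetric], subst lborel_prod) (use A in simp)
  finally show "emeasure (distr lborel borel ?S) A = emeasure lborel A" by (simp add: lborel_prod)
qed simp

lemma lborel_shear_snd:
  fixes g :: "'a::euclidean_space \<Rightarrow> 'b::euclidean_space"
  assumes [measurable]: "g \<in> borel_measurable borel"
  shows "distr lborel borel (\<lambda>z. (fst z, snd z + g (fst z))) = lborel"
  by (rule lborel_fibrewise[where T="\<lambda>x y. y + g x"])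
    (measurable, simp add: vimage_def emeasure_lborel_translate)

lemma lborel_swap: "distr lborel borel (prod.swap :: 'a::euclidean_space \<times> 'b::euclidean_space \<Rightarrow> _) = lborel"
proof -
  have "distr (lborel \<Otimes>\<^sub>M lborel) (lborel \<Otimes>\<^sub>M lborel) (\<lambda>(x :: 'a, y :: 'b). (y, x)) = lborel \<Otimes>\<^sub>M lborel"
    by (rule lborel_pair.distr_pair_swap[symmetric])
  then have "distr lborel lborel (\<lambda>(x :: 'a, y :: 'b). (y, x)) = lborel" by (simp add: lborel_prod)
  moreover have "distr lborel lborel (\<lambda>(x :: 'a, y :: 'b). (y, x)) = distr lborel borel prod.swap"
    by (rule distr_cong) auto
  ultimately show ?thesis by simp
qed

lemma measurable_swap [measurable]: "(prod.swap :: 'a::euclidean_space \<times> 'b::euclidean_space \<Rightarrow> _) \<in> borel_measurable borel"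
  by (intro borel_measurable_continuous_onI continuous_on_swap)

lemma lborel_shear_fst:
  fixes g :: "'b::euclidean_space \<Rightarrow> 'a::euclidean_space"
  assumes [measurable]: "g \<in> borel_measurable borel"
  shows "distr lborel borel (\<lambda>z. (fst z + g (snd z), snd z)) = lborel"
proof -
  let ?S = "\<lambda>z :: 'b \<times> 'a. (fst z, snd z + g (fst z))"
  have "distr lborel borel (\<lambda>z. (fst z + g (snd z), snd z))
      = distr (distr (distr lborel borel prod.swap) borel ?S) borel prod.swap"
    by (simp add: distr_distr o_def prod.swap_def)
  then show ?thesis by (simp add: lborel_swap lborel_shear_snd)
qed

lemma distr_funpow:
  assumes f: "f \<in> measurable M M" and "distr M M f = M"
  shows "distr M M (f ^^ n) = M"
proof (induction n)
  case (Suc n)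
  have "f ^^ n \<in> measurable M M" by (induction n) (auto simp: o_def intro: measurable_compose[OF _ f])
  then have "distr M M (f ^^ Suc n) = distr (distr M M (f ^^ n)) M f"
    using f by (subst distr_distr) (auto simp: o_def)
  then show ?case using Suc assms(2) by (simp add: o_def)
qed (simp add: distr_id2)

lemma lborel_flip: "distr lborel borel (flip :: 'a::euclidean_space \<times> 'a \<Rightarrow> _) = lborel"
  unfolding flip_def
proof (rule lborel_fibrewise[where T="\<lambda>_. uminus"])
  fix B :: "'a set" assume B: "B \<in> sets borel"
  have "emeasure lborel B = emeasure (distr lborel borel uminus) B"
    by (simp add: lborel_distr_uminus_euclidean)
  also have "\<dots> = emeasure lborel (uminus -` B)" using B by (subst emeasure_distr) auto
  finally show "emeasure lborel (uminus -` B) = emeasure lborel B" ..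
qed measurable

text \<open>The position is advanced with the momentum that has already been updated; this makes the step a
  composition of two shears.\<close>

definition sym_euler :: "('a::euclidean_space \<Rightarrow> 'a) \<Rightarrow> real \<Rightarrow> 'a \<times> 'a \<Rightarrow> 'a \<times> 'a" where
  "sym_euler F h z = (fst z + h *\<^sub>R (snd z + h *\<^sub>R F (fst z)), snd z + h *\<^sub>R F (fst z))"

lemma sym_euler_eq: "sym_euler F h z = z + h *\<^sub>R newton F z + (h\<^sup>2 *\<^sub>R F (fst z), 0)"
  by (simp add: sym_euler_def newton_def prod_eq_iff algebra_simps power2_eq_square)

lemma lborel_sym_euler:
  fixes F :: "'a::euclidean_space \<Rightarrow> 'a"
  assumes [measurable]: "F \<in> borel_measurable borel"
  shows "distr lborel borel (sym_euler F h) = lborel"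
proof -
  have "distr lborel borel (sym_euler F h)
      = distr (distr lborel borel (\<lambda>z. (fst z, snd z + h *\<^sub>R F (fst z)))) borel (\<lambda>z. (fst z + h *\<^sub>R snd z, snd z))"
    by (simp add: distr_distr o_def sym_euler_def[abs_def])
  then show ?thesis
    using lborel_shear_snd[of "\<lambda>q. h *\<^sub>R F q"] lborel_shear_fst[of "\<lambda>p. h *\<^sub>R (p :: 'a)"] by simp
qed

lemma norm_fst_snd_le: "norm (fst z) \<le> norm z" "norm (snd z) \<le> norm z"
  using norm_fst_le[of "fst z" "snd z"] norm_snd_le[of "snd z" "fst z"] by simp_all

context
  fixes F :: "'a::euclidean_space \<Rightarrow> 'a" and L
  assumes F: "L-lipschitz_on UNIV F"
begin

lemma measurable_lipschitz_field: "F \<in> borel_measurable borel"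
  by (intro borel_measurable_continuous_onI lipschitz_on_continuous_on[OF F])

lemma sym_euler_step_lipschitz:
  assumes h: "0 \<le> h" "h \<le> 1"
  shows "norm (sym_euler F h z - sym_euler F h w) \<le> (1 + h * (1 + 2 * L)) * norm (z - w)"
proof -
  have L: "0 \<le> L" by (rule lipschitz_on_nonneg[OF F])
  have "norm (F (fst z) - F (fst w)) \<le> L * norm (fst z - fst w)"
    using lipschitz_onD[OF F, of "fst z" "fst w"] by (simp add: dist_norm)
  also have "\<dots> \<le> L * norm (z - w)"
    using L norm_fst_snd_le(1)[of "z - w"] by (intro mult_left_mono) auto
  finally have FL: "norm (F (fst z) - F (fst w)) \<le> L * norm (z - w)" .
  have "sym_euler F h z - sym_euler F h w
      = (z - w) + h *\<^sub>R (newton F z - newton F w) + (h\<^sup>2 *\<^sub>R (F (fst z) - F (fst w)), 0)"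
    by (simp add: sym_euler_eq algebra_simps)
  then have "norm (sym_euler F h z - sym_euler F h w)
      \<le> norm (z - w) + norm (h *\<^sub>R (newton F z - newton F w)) + norm (h\<^sup>2 *\<^sub>R (F (fst z) - F (fst w)), 0::'a)"
    by (metis norm_triangle_le norm_triangle_ineq add_right_mono)
  also have "\<dots> = norm (z - w) + h * norm (newton F z - newton F w) + h\<^sup>2 * norm (F (fst z) - F (fst w))"
    using h by (simp add: norm_Pair)
  also have "h * norm (newton F z - newton F w) \<le> h * ((1 + L) * norm (z - w))"
    using h norm_newton_diff_le[OF F] by (intro mult_left_mono) auto
  also have "h\<^sup>2 * norm (F (fst z) - F (fst w)) \<le> h * (L * norm (z - w))"
    using h FL L by (intro mult_mono) (auto simp: power2_eq_square mult_left_le)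
  finally show ?thesis by (simp add: algebra_simps)
qed

text \<open>Over a step of length \<open>h\<close> the vector field changes by \<open>O(h)\<close> along the trajectory, so the linear
  extrapolation is off by \<open>O(h\<^sup>2)\<close>, as is the quadratic term of the scheme.\<close>

lemma sym_euler_local_error:
  assumes a: "0 \<le> a" "0 \<le> h" "a + h \<le> T"
    and M: "\<And>u. \<lbrakk>0 \<le> u; u \<le> T\<rbrakk> \<Longrightarrow> norm (newton F (nflow F u z)) \<le> M"
  shows "norm (sym_euler F h (nflow F a z) - nflow F (a + h) z) \<le> h\<^sup>2 * ((2 + L) * M)"
proof -
  have L: "0 \<le> L" by (rule lipschitz_on_nonneg[OF F])
  let ?w = "\<lambda>u. nflow F (a + u) z"
  have w: "(?w has_vector_derivative newton F (?w u)) (at u)" for u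
  proof -
    have "((\<lambda>s. a + s) has_vector_derivative 1) (at u)"
      by (auto intro!: derivative_eq_intros)
    from vector_diff_chain_at[OF this nflow_deriv[OF F]] show ?thesis by (simp add: o_def)
  qed
  have M0: "0 \<le> M" using M[of a] a by (smt (verit) norm_ge_zero)
  have drift: "norm (?w u - ?w 0) \<le> M * h" if u: "0 \<le> u" "u \<le> h" for u
  proof -
    have "norm (?w u - ?w 0) \<le> M * u"
      using u a by (intro increment_bound[OF u(1) w] M) auto
    also have "\<dots> \<le> M * h" using u M0 by (simp add: mult_left_mono)
    finally show ?thesis .
  qed
  have "norm ((?w h - h *\<^sub>R newton F (?w 0)) - (?w 0 - 0 *\<^sub>R newton F (?w 0)))
      \<le> (1 + L) * (M * h) * h"
  proof (rule increment_bound[OF a(2)])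
    show "((\<lambda>u. ?w u - u *\<^sub>R newton F (?w 0)) has_vector_derivative newton F (?w u) - newton F (?w 0)) (at u)" for u
      by (auto intro!: derivative_eq_intros w)
    show "norm (newton F (?w u) - newton F (?w 0)) \<le> (1 + L) * (M * h)" if "0 \<le> u" "u \<le> h" for u
    proof -
      have "norm (newton F (?w u) - newton F (?w 0)) \<le> (1 + L) * norm (?w u - ?w 0)"
        by (rule norm_newton_diff_le[OF F]) auto
      also have "\<dots> \<le> (1 + L) * (M * h)"
        using L that by (intro mult_left_mono drift) auto
      finally show ?thesis .
    qed
  qed
  then have 1: "norm (?w h - h *\<^sub>R newton F (?w 0) - ?w 0) \<le> h\<^sup>2 * ((1 + L) * M)"
    by (simp add: power2_eq_square mult_ac)
  have "norm (F (fst (?w 0))) \<le> norm (newton F (?w 0))"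
    using norm_fst_snd_le(2)[of "newton F (?w 0)"] by (simp add: newton_def)
  also have "\<dots> \<le> M" using a by (intro M) auto
  finally have 2: "norm (h\<^sup>2 *\<^sub>R F (fst (?w 0)), 0::'a) \<le> h\<^sup>2 * M"
    by (simp add: norm_Pair mult_left_mono)
  have "sym_euler F h (nflow F a z) - nflow F (a + h) z
      = (h\<^sup>2 *\<^sub>R F (fst (?w 0)), 0) - (?w h - h *\<^sub>R newton F (?w 0) - ?w 0)"
    by (simp add: sym_euler_eq)
  also have "norm \<dots> \<le> h\<^sup>2 * M + h\<^sup>2 * ((1 + L) * M)"
    by (rule order_trans[OF norm_triangle_ineq4 add_mono[OF 2 1]])
  finally show ?thesis by (simp add: algebra_simps)
qed

text \<open>Each of the \<open>n\<close> local errors of size \<open>O(1 / n\<^sup>2)\<close> is amplified at most by a constant.\<close>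

lemma sym_euler_converges:
  assumes t: "0 \<le> t"
  shows "(\<lambda>n. (sym_euler F (t / real (Suc n)) ^^ Suc n) z) \<longlonglongrightarrow> nflow F t z"
proof -
  have L: "0 \<le> L" by (rule lipschitz_on_nonneg[OF F])
  have "continuous_on UNIV (newton F)"
    by (rule lipschitz_on_continuous_on[OF newton_lipschitz[OF F]])
  then have "continuous_on {0..t} (\<lambda>u. newton F (nflow F u z))"
    by (rule continuous_on_compose2)
      (auto intro!: continuous_at_imp_continuous_on has_vector_derivative_continuous[OF nflow_deriv[OF F]])
  then have "compact ((\<lambda>u. newton F (nflow F u z)) ` {0..t})"
    by (intro compact_continuous_image) auto
  from compact_imp_bounded[OF this]
  obtain M where M: "\<And>u. \<lbrakk>0 \<le> u; u \<le> t\<rbrakk> \<Longrightarrow> norm (newton F (nflow F u z)) \<le> M"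
    unfolding bounded_iff by fastforce
  have M0: "0 \<le> M" using M[of 0] t by (smt (verit) norm_ge_zero)
  define C where "C = 1 + 2 * L"
  define M' where "M' = (2 + L) * M"
  have C: "0 \<le> C" and M': "0 \<le> M'" using L M0 by (auto simp: C_def M'_def)
  have err: "norm ((sym_euler F h ^^ k) z - nflow F (k * h) z) \<le> k * (h\<^sup>2 * M') * exp (C * (k * h))"
    if h: "0 \<le> h" "h \<le> 1" and k: "k * h \<le> t" for h :: real and k :: nat
    using k
  proof (induction k)
    case 0
    then show ?case by (simp add: nflow_0[OF F])
  next
    case (Suc k)
    have kh: "k * h + h \<le> t" "0 \<le> k * h" using Suc.prems h by (auto simp: algebra_simps)
    then have IH: "norm ((sym_euler F h ^^ k) z - nflow F (k * h) z) \<le> k * (h\<^sup>2 * M') * exp (C * (k * h))"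
      using h by (intro Suc.IH) auto
    have "norm ((sym_euler F h ^^ Suc k) z - nflow F (Suc k * h) z)
        \<le> norm (sym_euler F h ((sym_euler F h ^^ k) z) - sym_euler F h (nflow F (k * h) z))
          + norm (sym_euler F h (nflow F (k * h) z) - nflow F (k * h + h) z)"
      using norm_triangle_ineq[of "sym_euler F h ((sym_euler F h ^^ k) z) - sym_euler F h (nflow F (k * h) z)"
          "sym_euler F h (nflow F (k * h) z) - nflow F (k * h + h) z"]
      by (simp add: algebra_simps)
    also have "\<dots> \<le> (1 + h * C) * (k * (h\<^sup>2 * M') * exp (C * (k * h))) + h\<^sup>2 * M'"
    proof (rule add_mono)
      show "norm (sym_euler F h (nflow F (k * h) z) - nflow F (k * h + h) z) \<le> h\<^sup>2 * M'"
        unfolding M'_def using kh h M by (intro sym_euler_local_error[where T=t]) auto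
      show "norm (sym_euler F h ((sym_euler F h ^^ k) z) - sym_euler F h (nflow F (k * h) z))
          \<le> (1 + h * C) * (k * (h\<^sup>2 * M') * exp (C * (k * h)))"
        using sym_euler_step_lipschitz[OF h, of "(sym_euler F h ^^ k) z" "nflow F (k * h) z"]
        unfolding C_def[symmetric]
        by (rule order_trans) (use C h IH in \<open>intro mult_left_mono; auto\<close>)
    qed
    also have "\<dots> \<le> exp (C * h) * (k * (h\<^sup>2 * M') * exp (C * (k * h))) + h\<^sup>2 * M' * exp (C * (Suc k * h))"
    proof (rule add_mono)
      show "(1 + h * C) * (k * (h\<^sup>2 * M') * exp (C * (k * h))) \<le> exp (C * h) * (k * (h\<^sup>2 * M') * exp (C * (k * h)))"
        using exp_ge_add_one_self[of "C * h"] M' by (intro mult_right_mono) (auto simp: mult.commute)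
      have "1 \<le> exp (C * (Suc k * h))" using C h by simp
      then show "h\<^sup>2 * M' \<le> h\<^sup>2 * M' * exp (C * (Suc k * h))"
        using M' mult_left_mono[of 1 "exp (C * (Suc k * h))" "h\<^sup>2 * M'"] by simp
    qed
    also have "\<dots> = Suc k * (h\<^sup>2 * M') * exp (C * (Suc k * h))"
      by (simp add: algebra_simps exp_add)
    finally show ?case .
  qed
  have "(\<lambda>n. (sym_euler F (t / real (Suc n)) ^^ Suc n) z - nflow F t z) \<longlonglongrightarrow> 0"
  proof (rule Lim_null_comparison)
    show "(\<lambda>n. t\<^sup>2 * M' * exp (C * t) * inverse (real (Suc n))) \<longlonglongrightarrow> 0"
      using LIMSEQ_inverse_real_of_nat by (rule tendsto_mult_right_zero)
    obtain N :: nat where N: "t \<le> N" using real_arch_simple by blast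
    show "\<forall>\<^sub>F n in sequentially. norm ((sym_euler F (t / real (Suc n)) ^^ Suc n) z - nflow F t z)
        \<le> t\<^sup>2 * M' * exp (C * t) * inverse (real (Suc n))"
      using eventually_ge_at_top[of N]
    proof eventually_elim
      case (elim n)
      have "t / real (Suc n) \<le> 1" using elim N by simp
      then have "norm ((sym_euler F (t / real (Suc n)) ^^ Suc n) z - nflow F (real (Suc n) * (t / real (Suc n))) z)
          \<le> real (Suc n) * ((t / real (Suc n))\<^sup>2 * M') * exp (C * (real (Suc n) * (t / real (Suc n))))"
        using t by (intro err) auto
      also have "real (Suc n) * (t / real (Suc n)) = t" by simp
      also have "real (Suc n) * ((t / real (Suc n))\<^sup>2 * M') * exp (C * t) = t\<^sup>2 * M' * exp (C * t) * inverse (real (Suc n))"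
        by (simp add: power2_eq_square field_simps del: of_nat_Suc)
      finally show ?case .
    qed
  qed
  then show ?thesis by (rule LIM_zero_cancel)
qed

lemma measurable_nflow: "nflow F t \<in> borel_measurable borel"
proof -
  have "continuous_on UNIV (\<lambda>z. (\<lambda>(t, z). nflow F t z) (t, z))"
    by (rule continuous_on_compose2[OF continuous_nflow[OF F]]) (auto intro!: continuous_intros)
  then show ?thesis by (intro borel_measurable_continuous_onI) simp
qed

text \<open>The symplectic Euler step is a composition of two shears, so it preserves volume exactly.
  Lower semicontinuity of the indicator of an open set and Fatou's lemma carry one inequality over to
  the limit.\<close>

lemma nflow_volume_open:
  assumes t: "0 \<le> t" and U: "open U"
  shows "emeasure lborel {z. nflow F t z \<in> U} \<le> emeasure lborel U"
proof -
  note [measurable] = measurable_nflow measurable_lipschitz_field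
  have U' [measurable]: "U \<in> sets borel" using U by simp
  have m: "sym_euler F h \<in> borel_measurable borel" for h
    unfolding sym_euler_def by measurable
  have m' [measurable]: "sym_euler F h ^^ n \<in> borel_measurable borel" for h n
    by (induction n) (auto simp: o_def intro: measurable_compose[OF _ m])
  have pres: "distr lborel borel (sym_euler F h ^^ n) = lborel" for h n
  proof -
    have "distr lborel lborel (sym_euler F h ^^ n) = lborel"
      using lborel_sym_euler[OF measurable_lipschitz_field, of h] m
      by (intro distr_funpow) (auto simp: distr_cong[of lborel lborel lborel borel])
    then show ?thesis by (simp cong: distr_cong)
  qed
  let ?S = "\<lambda>n. sym_euler F (t / real (Suc n)) ^^ Suc n"
  have "emeasure lborel {z. nflow F t z \<in> U} = (\<integral>\<^sup>+z. indicator U (nflow F t z) \<partial>lborel)"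
  proof -
    have "(\<integral>\<^sup>+z. indicator U (nflow F t z) \<partial>lborel) = (\<integral>\<^sup>+z. indicator {z. nflow F t z \<in> U} z \<partial>lborel)"
      by (intro nn_integral_cong) (simp add: indicator_def)
    then show ?thesis by simp
  qed
  also have "\<dots> \<le> (\<integral>\<^sup>+z. liminf (\<lambda>n. indicator U (?S n z)) \<partial>lborel)"
  proof (rule nn_integral_mono)
    fix z
    show "indicator U (nflow F t z) \<le> liminf (\<lambda>n. indicator U (?S n z) :: ennreal)"
    proof (cases "nflow F t z \<in> U")
      case True
      from topological_tendstoD[OF sym_euler_converges[OF t, of z] U True]
      have "\<forall>\<^sub>F n in sequentially. (1::ennreal) \<le> indicator U (?S n z)"
        by eventually_elim simp
      then have "1 \<le> liminf (\<lambda>n. indicator U (?S n z) :: ennreal)" by (rule Liminf_bounded)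
      with True show ?thesis by simp
    qed simp
  qed
  also have "\<dots> \<le> liminf (\<lambda>n. \<integral>\<^sup>+z. indicator U (?S n z) \<partial>lborel)"
    by (rule nn_integral_liminf) measurable
  also have "(\<lambda>n. \<integral>\<^sup>+z. indicator U (?S n z) \<partial>lborel) = (\<lambda>n. emeasure lborel U)"
  proof
    fix n
    have "(\<integral>\<^sup>+z. indicator U (?S n z) \<partial>lborel) = (\<integral>\<^sup>+z. indicator U z \<partial>(distr lborel borel (?S n)))"
      by (rule nn_integral_distr[symmetric]) measurable
    then show "(\<integral>\<^sup>+z. indicator U (?S n z) \<partial>lborel) = emeasure lborel U" unfolding pres by simp
  qed
  also have "liminf (\<lambda>n. emeasure lborel U) = emeasure lborel U" by (simp add: Liminf_const)
  finally show ?thesis .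
qed

lemma nflow_volume_forward:
  assumes t: "0 \<le> t" and A [measurable]: "A \<in> sets borel"
  shows "emeasure lborel {z. nflow F t z \<in> A} \<le> emeasure lborel A"
proof (rule ennreal_le_epsilon)
  note [measurable] = measurable_nflow
  fix e :: real assume "0 < e"
  from outer_regular_lborel_le[OF A this]
  obtain U where U: "open U" "A \<subseteq> U" "emeasure lborel (U - A) \<le> e" by blast
  then have [measurable]: "U \<in> sets borel" by simp
  have "emeasure lborel {z. nflow F t z \<in> A} \<le> emeasure lborel {z. nflow F t z \<in> U}"
    using U(2) by (intro emeasure_mono) auto
  also have "\<dots> \<le> emeasure lborel U" by (rule nflow_volume_open[OF t U(1)])
  also have "\<dots> = emeasure lborel A + emeasure lborel (U - A)"
    using U(2) by (subst plus_emeasure) (auto intro!: arg_cong2[where f=emeasure])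
  also have "\<dots> \<le> emeasure lborel A + e" using U(3) by (intro add_left_mono)
  finally show "emeasure lborel {z. nflow F t z \<in> A} \<le> emeasure lborel A + e" .
qed

lemma nflow_volume:
  assumes A [measurable]: "A \<in> sets borel"
  shows "emeasure lborel {z. nflow F t z \<in> A} \<le> emeasure lborel A"
proof (cases "0 \<le> t")
  case False
  note [measurable] = measurable_nflow
  have m [measurable]: "(flip :: 'a \<times> 'a \<Rightarrow> _) \<in> borel_measurable borel"
    unfolding flip_def by measurable
  have fl: "emeasure lborel {z. flip z \<in> B} = emeasure lborel B" if "B \<in> sets borel" for B :: "('a \<times> 'a) set"
  proof -
    have "emeasure lborel B = emeasure (distr lborel borel flip) B" by (simp add: lborel_flip)
    also have "\<dots> = emeasure lborel {z. flip z \<in> B}"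
      using that by (subst emeasure_distr) (auto simp: vimage_def)
    finally show ?thesis ..
  qed
  have "{z. nflow F t z \<in> A} = {z. flip z \<in> {z. nflow F (- t) z \<in> {z. flip z \<in> A}}}"
    using nflow_minus[OF F, of "-t"] by simp
  also have "emeasure lborel \<dots> = emeasure lborel {z. nflow F (- t) z \<in> {z. flip z \<in> A}}"
    by (rule fl) measurable
  also have "\<dots> \<le> emeasure lborel {z. flip z \<in> A}"
    using False by (intro nflow_volume_forward) auto
  also have "\<dots> = emeasure lborel A" by (rule fl) measurable
  finally show ?thesis .
qed (use nflow_volume_forward A in blast)

end

context nonneg_potential begin

lemma measurable_flow_pair: "(\<lambda>(t, z). \<theta> t z) \<in> borel_measurable borel"
  by (intro borel_measurable_continuous_onI continuous_flow)

lemma measurable_flow [measurable]: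
  assumes [measurable]: "f \<in> borel_measurable M" "g \<in> borel_measurable M"
  shows "(\<lambda>x. \<theta> (f x) (g x)) \<in> borel_measurable M"
proof -
  have "(\<lambda>x. (\<lambda>(t, z). \<theta> t z) (f x, g x)) \<in> borel_measurable M"
    by (rule measurable_compose[OF _ measurable_flow_pair]) measurable
  then show ?thesis by simp
qed

text \<open>The points with \<open>reach \<bar>t\<bar> z \<le> k\<close> exhaust phase space, and on them the flow at time \<open>t\<close> is that of a
  truncated field.\<close>

lemma flow_volume_le:
  assumes A [measurable]: "A \<in> sets borel"
  shows "emeasure lborel {z. \<theta> t z \<in> A} \<le> emeasure lborel A"
proof -
  have [measurable]: "H \<in> borel_measurable borel"
    by (intro borel_measurable_continuous_onI continuous_hamiltonian)
  have [measurable]: "(\<lambda>z. reach \<bar>t\<bar> z) \<in> borel_measurable borel"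
    unfolding reach_def by measurable
  define B where "B k = {z. \<theta> t z \<in> A \<and> reach \<bar>t\<bar> z \<le> real k}" for k
  have Bm: "B k \<in> sets lborel" for k unfolding B_def by measurable
  have "{z. \<theta> t z \<in> A} = (\<Union>k. B k)"
    unfolding B_def using real_arch_simple by auto
  also have "emeasure lborel \<dots> = (SUP k. emeasure lborel (B k))"
    by (rule SUP_emeasure_incseq[symmetric]) (use Bm in \<open>auto simp: B_def incseq_def\<close>)
  also have "\<dots> \<le> emeasure lborel A"
  proof (rule SUP_least)
    fix k
    have "0 \<le> real k" by simp
    from cutoff_force_lipschitz[OF this] obtain L where L: "L-lipschitz_on UNIV (cutoff force (real k))" ..
    have [measurable]: "nflow (cutoff force (real k)) t \<in> borel_measurable borel"
      by (rule measurable_nflow[OF L])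
    have "emeasure lborel (B k) \<le> emeasure lborel {z. nflow (cutoff force (real k)) t z \<in> A}"
      using flow_eq_cutoff_flow[of t "\<bar>t\<bar>"] by (intro emeasure_mono) (auto simp: B_def)
    also have "\<dots> \<le> emeasure lborel A" by (rule nflow_volume[OF L A])
    finally show "emeasure lborel (B k) \<le> emeasure lborel A" .
  qed
  finally show ?thesis .
qed

text \<open>The inequality for \<open>- t\<close> is the reverse inequality for \<open>t\<close>.\<close>

theorem liouville: "distr lborel borel (\<theta> t) = lborel"
proof (rule measure_eqI)
  fix A assume "A \<in> sets (distr lborel borel (\<theta> t))"
  then have [measurable]: "A \<in> sets borel" by simp
  have "emeasure lborel A = emeasure lborel {z. \<theta> (- t) z \<in> {z. \<theta> t z \<in> A}}"
    using flow_inverse[of "-t"] by simp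
  also have "\<dots> \<le> emeasure lborel {z. \<theta> t z \<in> A}" by (rule flow_volume_le) measurable
  finally have "emeasure lborel A \<le> emeasure lborel {z. \<theta> t z \<in> A}" .
  with flow_volume_le[of A t] show "emeasure (distr lborel borel (\<theta> t)) A = emeasure lborel A"
    by (subst emeasure_distr) (auto simp: vimage_def intro!: antisym)
qed simp

end

section \<open>Gaussian refreshment and the Boltzmann--Gibbs measure\<close>

definition gauss :: "'a::euclidean_space \<Rightarrow> real" where
  "gauss x = (2 * pi) powr (- real DIM('a) / 2) * exp (- (norm x)\<^sup>2 / 2)"

lemma gauss_pos: "0 < gauss x" by (simp add: gauss_def)

lemma gauss_nonneg [simp]: "0 \<le> gauss x" using gauss_pos less_imp_le by blast

lemma continuous_gauss: "continuous_on UNIV gauss"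
  unfolding gauss_def by (intro continuous_intros) auto

lemma measurable_gauss [measurable]: "gauss \<in> borel_measurable borel"
  by (intro borel_measurable_continuous_onI continuous_gauss)

lemma prod_std_normal_density:
  assumes "finite I"
  shows "(\<Prod>i\<in>I. std_normal_density (f i)) = (2 * pi) powr (- real (card I) / 2) * exp (- (\<Sum>i\<in>I. (f i)\<^sup>2) / 2)"
proof -
  have "(\<Prod>i\<in>I. std_normal_density (f i)) = (1 / sqrt (2 * pi)) ^ card I * (\<Prod>i\<in>I. exp (- (f i)\<^sup>2 / 2))"
    by (simp add: std_normal_density_def prod_dividef power_divide)
  also have "(\<Prod>i\<in>I. exp (- (f i)\<^sup>2 / 2)) = exp (- (\<Sum>i\<in>I. (f i)\<^sup>2) / 2)"
    using assms by (simp add: exp_sum[symmetric] sum_divide_distrib sum_negf)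
  also have "(1 / sqrt (2 * pi)) ^ card I = (2 * pi) powr (- real (card I) / 2)"
  proof -
    have "1 / sqrt (2 * pi) = (2 * pi) powr (- 1 / 2)"
      by (simp add: powr_minus_divide powr_half_sqrt[symmetric])
    then have "(1 / sqrt (2 * pi)) ^ card I = ((2 * pi) powr (- 1 / 2)) powr (real (card I))"
      by (simp add: powr_realpow)
    also have "\<dots> = (2 * pi) powr (- real (card I) / 2)" by (simp add: powr_powr)
    finally show ?thesis .
  qed
  finally show ?thesis .
qed

lemma norm_square_Basis: "(\<Sum>b\<in>Basis. (x \<bullet> b)\<^sup>2) = (norm (x :: 'a::euclidean_space))\<^sup>2"
  by (subst power2_norm_eq_inner, subst euclidean_inner) (simp add: power2_eq_square)

lemma norm_square_vec: "(\<Sum>i\<in>UNIV. (x $ i)\<^sup>2) = (norm (x :: real ^ 'n::finite))\<^sup>2"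
  by (subst power2_norm_eq_inner, subst inner_vec_def) (simp add: power2_eq_square)

lemma prod_Basis_std_normal_density: "(\<Prod>b\<in>Basis. std_normal_density (x \<bullet> b)) = gauss x"
  by (simp add: prod_std_normal_density gauss_def norm_square_Basis)

lemma prod_vec_std_normal_density:
  "(\<Prod>i\<in>UNIV. std_normal_density (x $ i)) = gauss (x :: real ^ 'n::finite)"
  by (simp add: prod_std_normal_density gauss_def norm_square_vec)

lemma std_gaussian_eq: "std_gaussian = density lborel (\<lambda>x. ennreal (gauss (x :: real ^ 'n::finite)))"
  by (simp add: std_gaussian_def prod_vec_std_normal_density)

lemma nn_integral_normal_product:
  assumes "0 < \<sigma>"
  shows "(\<integral>\<^sup>+x. (\<Prod>b\<in>Basis. ennreal (normal_density 0 \<sigma> ((x :: 'a::euclidean_space) \<bullet> b))) \<partial>lborel) = 1"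
proof -
  have "(\<integral>\<^sup>+u. ennreal (normal_density 0 \<sigma> u) \<partial>lborel) = 1"
    using prob_space.emeasure_space_1[OF prob_space_normal_density[OF assms, of 0]]
    by (simp add: emeasure_density)
  then show ?thesis by (subst nn_integral_lborel_prod) auto
qed

lemma nn_integral_gauss: "(\<integral>\<^sup>+x. ennreal (gauss (x :: 'a::euclidean_space)) \<partial>lborel) = 1"
  using nn_integral_normal_product[of 1, where 'a='a]
  by (simp add: prod_ennreal prod_Basis_std_normal_density normal_density_nonneg)

lemma integrable_gauss: "integrable lborel (gauss :: 'a::euclidean_space \<Rightarrow> real)"
  by (rule integrableI_nonneg) (auto simp: nn_integral_gauss)

text \<open>With \<open>y = \<bar>x\<bar>\<^sup>2 / 4\<close> the inequality \<open>y exp (- 2 y) \<le> exp (- y)\<close> dominates the integrand by a multiple of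
  the density of the Gaussian with variance \<open>2\<close>.\<close>

lemma integrable_gauss_second_moment: "integrable lborel (\<lambda>x :: 'a::euclidean_space. gauss x * (norm x)\<^sup>2)"
proof (rule integrableI_nonneg)
  define K where "K = (2 * pi) powr (- real DIM('a) / 2) * 4"
  define N where "N x = (\<Prod>b\<in>Basis. normal_density 0 (sqrt 2) (x \<bullet> b))" for x :: 'a
  define c where "c = (1 / sqrt (4 * pi)) ^ DIM('a)"
  have c: "0 < c" by (simp add: c_def)
  have N: "N x = c * exp (- (norm x)\<^sup>2 / 4)" for x
  proof -
    have "N x = c * (\<Prod>b\<in>Basis. exp (- (x \<bullet> b)\<^sup>2 / 4))"
      by (simp add: N_def c_def normal_density_def prod_dividef power_divide)
    also have "(\<Prod>b\<in>Basis. exp (- (x \<bullet> b)\<^sup>2 / 4)) = exp (\<Sum>b\<in>Basis. - (x \<bullet> b)\<^sup>2 / 4)"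
      by (rule exp_sum[symmetric]) simp
    also have "(\<Sum>b\<in>Basis. - (x \<bullet> b)\<^sup>2 / 4) = - (norm x)\<^sup>2 / 4"
      by (simp add: norm_square_Basis sum_negf flip: sum_divide_distrib)
    finally show ?thesis .
  qed
  have Nnn: "0 \<le> N x" for x using c by (simp add: N)
  have bound: "gauss x * (norm x)\<^sup>2 \<le> K / c * N x" for x :: 'a
  proof -
    define y where "y = (norm x)\<^sup>2 / 4"
    have "y * exp (- y) \<le> 1"
      using exp_ge_add_one_self[of y] order_trans[of y "1 + y" "exp y"]
      by (simp add: exp_minus field_simps)
    then have "y * exp (- y) * exp (- y) \<le> 1 * exp (- y)" by (intro mult_right_mono) auto
    then have "4 * (y * exp (- 2 * y)) \<le> 4 * exp (- y)"
      by (simp add: mult.assoc flip: exp_add)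
    then have "(norm x)\<^sup>2 * exp (- (norm x)\<^sup>2 / 2) \<le> 4 * exp (- (norm x)\<^sup>2 / 4)"
      by (simp add: y_def field_simps)
    then have "(2 * pi) powr (- real DIM('a) / 2) * ((norm x)\<^sup>2 * exp (- (norm x)\<^sup>2 / 2))
        \<le> (2 * pi) powr (- real DIM('a) / 2) * (4 * exp (- (norm x)\<^sup>2 / 4))"
      by (intro mult_left_mono) auto
    then show ?thesis using c by (simp add: gauss_def K_def N mult_ac)
  qed
  have "(\<integral>\<^sup>+x. ennreal (gauss x * (norm (x :: 'a))\<^sup>2) \<partial>lborel) \<le> (\<integral>\<^sup>+x. ennreal (K / c) * ennreal (N x) \<partial>lborel)"
    using bound Nnn c by (intro nn_integral_mono) (simp add: K_def flip: ennreal_mult)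
  also have "\<dots> = ennreal (K / c) * (\<integral>\<^sup>+x. ennreal (N x) \<partial>lborel)"
    by (rule nn_integral_cmult) (simp add: N_def)
  also have "(\<integral>\<^sup>+x. ennreal (N x) \<partial>lborel) = 1"
    using nn_integral_normal_product[of "sqrt 2", where 'a='a]
    by (simp add: N_def prod_ennreal normal_density_nonneg)
  finally show "(\<integral>\<^sup>+x. ennreal (gauss x * (norm (x :: 'a))\<^sup>2) \<partial>lborel) < \<infinity>"
    by (simp add: order_le_less_trans)
qed auto

lemma integrable_gauss_first_moment: "integrable lborel (\<lambda>x :: 'a::euclidean_space. gauss x * (x \<bullet> v))"
proof (rule Bochner_Integration.integrable_bound)
  show "integrable lborel (\<lambda>x :: 'a. norm v * (gauss x + gauss x * (norm x)\<^sup>2))"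
    by (intro integrable_mult_right Bochner_Integration.integrable_add integrable_gauss integrable_gauss_second_moment)
  show "AE x :: 'a in lborel. norm (gauss x * (x \<bullet> v)) \<le> norm (norm v * (gauss x + gauss x * (norm x)\<^sup>2))"
  proof (rule AE_I2)
    fix x :: 'a
    have "\<bar>x \<bullet> v\<bar> \<le> norm x * norm v" by (rule Cauchy_Schwarz_ineq2)
    also have "norm x * norm v \<le> (1 + (norm x)\<^sup>2) * norm v"
    proof (intro mult_right_mono)
      show "norm x \<le> 1 + (norm x)\<^sup>2"
        using sum_squares_bound[of "norm x" 1] norm_ge_zero[of x] unfolding power_one mult_1_right
        by linarith
    qed simp
    finally have "gauss x * \<bar>x \<bullet> v\<bar> \<le> gauss x * ((1 + (norm x)\<^sup>2) * norm v)"
      by (intro mult_left_mono) auto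
    also have "\<dots> = norm v * (gauss x + gauss x * (norm x)\<^sup>2)" by (simp add: algebra_simps)
    finally show "norm (gauss x * (x \<bullet> v)) \<le> norm (norm v * (gauss x + gauss x * (norm x)\<^sup>2))"
      by (simp add: abs_mult)
  qed
qed auto

lemma gauss_mean_zero: "(LINT x|lborel. gauss x * ((x :: 'a::euclidean_space) \<bullet> v)) = 0"
proof -
  have "(LINT x|lborel. gauss x * ((x :: 'a) \<bullet> v)) = (LINT x|distr lborel borel uminus. gauss x * ((x :: 'a) \<bullet> v))"
    by (simp add: lborel_distr_uminus_euclidean)
  also have "\<dots> = (LINT x|lborel. gauss (- x) * ((- x :: 'a) \<bullet> v))"
    by (rule integral_distr) auto
  also have "\<dots> = - (LINT x|lborel. gauss x * ((x :: 'a) \<bullet> v))"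
    by (simp add: gauss_def)
  finally show ?thesis by simp
qed

lemma prob_space_std_gaussian: "prob_space (std_gaussian :: (real ^ 'n::finite) measure)"
  by (rule prob_spaceI) (simp add: std_gaussian_eq emeasure_density nn_integral_gauss)

lemma sets_std_gaussian [simp, measurable_cong]: "sets std_gaussian = sets borel"
  and space_std_gaussian [simp]: "space std_gaussian = UNIV"
  by (simp_all add: std_gaussian_def)

lemma nn_integral_std_gaussian:
  "f \<in> borel_measurable borel \<Longrightarrow> (\<integral>\<^sup>+x. f x \<partial>std_gaussian) = (\<integral>\<^sup>+x. ennreal (gauss x) * f x \<partial>lborel)"
  by (simp add: std_gaussian_eq nn_integral_density)

lemma std_gaussian_moments:
  fixes v :: "real ^ 'n::finite"
  shows "integrable std_gaussian (\<lambda>\<xi>. \<xi> \<bullet> v)" "(LINT \<xi>|std_gaussian. \<xi> \<bullet> v) = 0"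
    "integrable std_gaussian (\<lambda>\<xi> :: real ^ 'n. (norm \<xi>)\<^sup>2)"
  using integrable_gauss_first_moment[of v] gauss_mean_zero[of v] integrable_gauss_second_moment[where 'a="real ^ 'n"]
  by (simp_all add: std_gaussian_eq integrable_density integral_density)

text \<open>A rotation is a product of three shears, so it preserves Lebesgue measure.\<close>

lemma lborel_rotation:
  fixes c s :: real
  assumes cs: "c\<^sup>2 + s\<^sup>2 = 1" and s: "s \<noteq> 0"
  shows "distr lborel borel (\<lambda>w :: 'a::euclidean_space \<times> 'a. (c *\<^sub>R fst w + s *\<^sub>R snd w, c *\<^sub>R snd w - s *\<^sub>R fst w)) = lborel"
proof -
  \<comment> \<open>the tangent of half the angle\<close>
  define t where "t = (1 - c) / s"
  have 1: "1 - t * s = c" using s by (simp add: t_def)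
  have "t * (1 + c) = s"
    using cs s by (simp add: t_def field_simps power2_eq_square)
  then have 2: "t + t * (1 - t * s) = s" unfolding 1 by (simp add: algebra_simps)
  let ?A = "\<lambda>w :: 'a \<times> 'a. (fst w + t *\<^sub>R snd w, snd w)"
  let ?B = "\<lambda>w :: 'a \<times> 'a. (fst w, snd w + (- s) *\<^sub>R fst w)"
  have A: "distr lborel borel ?A = lborel" by (rule lborel_shear_fst) simp
  have B: "distr lborel borel ?B = lborel" by (rule lborel_shear_snd) simp
  have "?A (?B (?A w)) = (c *\<^sub>R fst w + s *\<^sub>R snd w, c *\<^sub>R snd w - s *\<^sub>R fst w)" for w
  proof -
    have "fst (?A (?B (?A w))) = (1 - t * s) *\<^sub>R fst w + (t *\<^sub>R snd w + (t * (1 - t * s)) *\<^sub>R snd w)"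
      by (simp add: algebra_simps)
    then have "fst (?A (?B (?A w))) = (1 - t * s) *\<^sub>R fst w + (t + t * (1 - t * s)) *\<^sub>R snd w"
      unfolding scaleR_add_left[of t, symmetric] .
    moreover have "snd (?A (?B (?A w))) = (1 - t * s) *\<^sub>R snd w - s *\<^sub>R fst w"
      by (simp add: algebra_simps)
    ultimately show ?thesis unfolding 2 unfolding 1 by (simp add: prod_eq_iff)
  qed
  then have "distr lborel borel (\<lambda>w :: 'a \<times> 'a. (c *\<^sub>R fst w + s *\<^sub>R snd w, c *\<^sub>R snd w - s *\<^sub>R fst w))
      = distr lborel borel (\<lambda>w. ?A (?B (?A w)))" by (simp only:)
  also have "\<dots> = distr (distr (distr lborel borel ?A) borel ?B) borel ?A"
    by (simp add: distr_distr o_def)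
  finally show ?thesis unfolding A B .
qed

text \<open>\<open>c p + s \<xi>\<close> is the first component of a rotation of \<open>(p, \<xi>)\<close>, and the product of two standard Gaussians
  is rotation invariant.\<close>

lemma gaussian_rotation_invariant:
  fixes h :: "'a::euclidean_space \<Rightarrow> ennreal"
  assumes [measurable]: "h \<in> borel_measurable borel" and cs: "c\<^sup>2 + s\<^sup>2 = 1" and s: "s \<noteq> 0"
  shows "(\<integral>\<^sup>+p. \<integral>\<^sup>+\<xi>. ennreal (gauss p) * (ennreal (gauss \<xi>) * h (c *\<^sub>R p + s *\<^sub>R \<xi>)) \<partial>lborel \<partial>lborel)
    = (\<integral>\<^sup>+p. ennreal (gauss p) * h p \<partial>lborel)"
proof -
  let ?R = "\<lambda>w :: 'a \<times> 'a. (c *\<^sub>R fst w + s *\<^sub>R snd w, c *\<^sub>R snd w - s *\<^sub>R fst w)"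
  let ?G = "\<lambda>w :: 'a \<times> 'a. ennreal (gauss (fst w)) * ennreal (gauss (snd w))"
  have G: "?G (?R w) = ?G w" for w
  proof -
    have "(norm (c *\<^sub>R fst w + s *\<^sub>R snd w))\<^sup>2 + (norm (c *\<^sub>R snd w - s *\<^sub>R fst w))\<^sup>2
        = (c\<^sup>2 + s\<^sup>2) * (norm (fst w))\<^sup>2 + (c\<^sup>2 + s\<^sup>2) * (norm (snd w))\<^sup>2"
      unfolding power2_norm_eq_inner
      by (simp add: inner_commute algebra_simps power2_eq_square)
    then have "gauss (fst (?R w)) * gauss (snd (?R w)) = gauss (fst w) * gauss (snd w)"
      by (simp add: gauss_def cs mult_ac flip: exp_add add_divide_distrib)
    then show ?thesis by (simp flip: ennreal_mult')
  qed
  have "(\<integral>\<^sup>+p. \<integral>\<^sup>+\<xi>. ennreal (gauss p) * (ennreal (gauss \<xi>) * h (c *\<^sub>R p + s *\<^sub>R \<xi>)) \<partial>lborel \<partial>lborel)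
      = (\<integral>\<^sup>+w. ?G w * h (fst (?R w)) \<partial>(lborel \<Otimes>\<^sub>M lborel))"
    by (subst lborel.nn_integral_fst[symmetric]) (auto simp: mult.assoc)
  also have "\<dots> = (\<integral>\<^sup>+w. ?G (?R w) * h (fst (?R w)) \<partial>lborel)"
    unfolding lborel_prod G ..
  also have "\<dots> = (\<integral>\<^sup>+w. ?G w * h (fst w) \<partial>(distr lborel borel ?R))"
    by (rule nn_integral_distr[symmetric]) measurable
  also have "\<dots> = (\<integral>\<^sup>+w. ?G w * h (fst w) \<partial>(lborel \<Otimes>\<^sub>M lborel))"
    unfolding lborel_rotation[OF cs s] lborel_prod ..
  also have "\<dots> = (\<integral>\<^sup>+p. \<integral>\<^sup>+(\<xi> :: 'a). ennreal (gauss \<xi>) * (ennreal (gauss p) * h p) \<partial>lborel \<partial>lborel)"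
    by (subst lborel.nn_integral_fst[symmetric]) (auto simp: mult_ac)
  also have "\<dots> = (\<integral>\<^sup>+p. ennreal (gauss p) * h p \<partial>lborel)"
    by (simp add: nn_integral_multc nn_integral_gauss)
  finally show ?thesis .
qed

locale gibbs_potential = nonneg_potential \<Phi> for \<Phi> :: "real ^ 'n::finite \<Rightarrow> real" +
  assumes second_moment: "integrable lborel (\<lambda>q. (norm q)\<^sup>2 * exp (- \<Phi> q))"
begin

abbreviation "BG \<equiv> boltzmann_gibbs \<Phi>"

definition "C0 = (LINT q|lborel. exp (- \<Phi> q))"

lemma measurable_potential [measurable]: "\<Phi> \<in> borel_measurable borel"
  by (intro borel_measurable_continuous_onI continuous_potential)

lemma measurable_hamiltonian [measurable]: "H \<in> borel_measurable borel"
  by (intro borel_measurable_continuous_onI continuous_hamiltonian)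

text \<open>Outside the unit ball the weight is dominated by the second-moment integrand, inside it is at most \<open>1\<close>.\<close>

lemma integrable_gibbs_weight: "integrable lborel (\<lambda>q. exp (- \<Phi> q))"
proof (rule Bochner_Integration.integrable_bound)
  show "integrable lborel (\<lambda>q. indicator (cball 0 1) q + (norm q)\<^sup>2 * exp (- \<Phi> q))"
    by (intro Bochner_Integration.integrable_add second_moment integrable_real_indicator)
      (use emeasure_lborel_cball_finite[of "0 :: real ^ 'n" 1] in auto)
  show "AE q in lborel. norm (exp (- \<Phi> q)) \<le> norm (indicator (cball 0 1) q + (norm q)\<^sup>2 * exp (- \<Phi> q))"
  proof (rule AE_I2)
    fix q
    show "norm (exp (- \<Phi> q)) \<le> norm (indicator (cball 0 1) q + (norm q)\<^sup>2 * exp (- \<Phi> q))"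
    proof (cases "norm q \<le> 1")
      case True
      then show ?thesis using nonneg[of q] by (simp add: add_increasing2)
    next
      case False
      then have "1 \<le> (norm q)\<^sup>2" by (simp add: one_le_power)
      then show ?thesis using False by simp
    qed
  qed
qed simp

lemma C0_pos: "0 < C0"
proof -
  have "C0 \<noteq> 0"
  proof
    assume "C0 = 0"
    then have "AE q in lborel. exp (- \<Phi> q) = 0"
      unfolding C0_def by (subst (asm) integral_nonneg_eq_0_iff_AE) (auto intro: integrable_gibbs_weight)
    then have "AE q :: real ^ 'n in lborel. False" by simp
    then show False by (simp add: AE_iff_null null_sets_def)
  qed
  moreover have "0 \<le> C0" unfolding C0_def by (rule integral_nonneg_AE) simp
  ultimately show ?thesis by simp
qed

lemma nn_integral_gibbs_weight: "(\<integral>\<^sup>+q. ennreal (exp (- \<Phi> q) / C0) \<partial>lborel) = 1"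
  using C0_pos integrable_gibbs_weight
  by (subst nn_integral_eq_integral) (auto simp: C0_def[symmetric])

lemma BG_density: "BG = density lborel (\<lambda>z. ennreal (exp (- \<Phi> (fst z)) / C0) * ennreal (gauss (snd z)))"
proof -
  have "inverse C0 * (2 * pi) powr (- real CARD('n) / 2) * exp (- H z)
      = exp (- \<Phi> (fst z)) / C0 * gauss (snd z)" for z
  proof -
    have "exp (- H z) = exp (- \<Phi> (fst z)) * exp (- (norm (snd z))\<^sup>2 / 2)"
      unfolding exp_add[symmetric] by (simp add: hamiltonian_def)
    moreover have "gauss (snd z) = (2 * pi) powr (- real CARD('n) / 2) * exp (- (norm (snd z))\<^sup>2 / 2)"
      by (simp add: gauss_def)
    moreover have "inverse C0 * k * (e * e') = e / C0 * (k * e')" for k e e'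
      by (simp add: divide_inverse)
    ultimately show ?thesis by (simp only:)
  qed
  then have "ennreal (inverse C0 * (2 * pi) powr (- real CARD('n) / 2) * exp (- H z))
      = ennreal (exp (- \<Phi> (fst z)) / C0) * ennreal (gauss (snd z))" for z
    using C0_pos by (simp only: ennreal_mult[symmetric] gauss_nonneg divide_nonneg_pos exp_ge_zero)
  then show ?thesis by (simp add: boltzmann_gibbs_def C0_def)
qed

lemma sets_BG [simp, measurable_cong]: "sets BG = sets borel"
  and space_BG [simp]: "space BG = UNIV"
  by (simp_all add: BG_density)

lemma nn_integral_BG:
  assumes [measurable]: "f \<in> borel_measurable borel"
  shows "(\<integral>\<^sup>+z. f z \<partial>BG) = (\<integral>\<^sup>+q. ennreal (exp (- \<Phi> q) / C0) * (\<integral>\<^sup>+p. ennreal (gauss p) * f (q, p) \<partial>lborel) \<partial>lborel)"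
proof -
  have [measurable]: "f \<in> borel_measurable (borel \<Otimes>\<^sub>M borel)" by (simp add: borel_prod)
  have "(\<integral>\<^sup>+z. f z \<partial>BG) = (\<integral>\<^sup>+z. ennreal (exp (- \<Phi> (fst z)) / C0) * ennreal (gauss (snd z)) * f z \<partial>(lborel \<Otimes>\<^sub>M lborel))"
    unfolding BG_density lborel_prod by (rule nn_integral_density) measurable
  also have "\<dots> = (\<integral>\<^sup>+q. \<integral>\<^sup>+p. ennreal (exp (- \<Phi> q) / C0) * (ennreal (gauss p) * f (q, p)) \<partial>lborel \<partial>lborel)"
    by (subst lborel.nn_integral_fst[symmetric]) (auto simp: mult.assoc)
  also have "\<dots> = (\<integral>\<^sup>+q. ennreal (exp (- \<Phi> q) / C0) * (\<integral>\<^sup>+p. ennreal (gauss p) * f (q, p) \<partial>lborel) \<partial>lborel)"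
    by (intro nn_integral_cong nn_integral_cmult) measurable
  finally show ?thesis .
qed

lemma prob_space_BG: "prob_space BG"
proof (rule prob_spaceI)
  have "emeasure BG (space BG) = (\<integral>\<^sup>+z. 1 \<partial>BG)" by simp
  also have "\<dots> = 1" by (subst nn_integral_BG) (simp_all add: nn_integral_gauss nn_integral_gibbs_weight)
  finally show "emeasure BG (space BG) = 1" .
qed

text \<open>Liouville's theorem and conservation of energy: the density is constant along trajectories.\<close>

lemma BG_flow_invariant:
  assumes [measurable]: "f \<in> borel_measurable borel"
  shows "(\<integral>\<^sup>+z. f (\<theta> t z) \<partial>BG) = (\<integral>\<^sup>+z. f z \<partial>BG)"
proof -
  let ?d = "\<lambda>z. ennreal (inverse C0 * (2 * pi) powr (- real CARD('n) / 2) * exp (- H z))"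
  have BG: "BG = density lborel ?d" by (simp add: boltzmann_gibbs_def C0_def)
  have "(\<integral>\<^sup>+z. f (\<theta> t z) \<partial>BG) = (\<integral>\<^sup>+z. ?d (\<theta> t z) * f (\<theta> t z) \<partial>lborel)"
    unfolding BG by (subst nn_integral_density) (auto simp: energy_flow)
  also have "\<dots> = (\<integral>\<^sup>+z. ?d z * f z \<partial>(distr lborel borel (\<theta> t)))"
    by (rule nn_integral_distr[symmetric]) measurable
  also have "\<dots> = (\<integral>\<^sup>+z. f z \<partial>BG)"
    unfolding liouville BG by (rule nn_integral_density[symmetric]) measurable
  finally show ?thesis .
qed

lemma measurable_momentum_randomization [measurable]:
  assumes [measurable]: "f \<in> borel_measurable M" "g \<in> borel_measurable M"
  shows "(\<lambda>x. momentum_randomization \<phi> (f x) (g x)) \<in> borel_measurable M"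
  unfolding momentum_randomization_def by measurable

lemma BG_randomization_invariant:
  assumes [measurable]: "f \<in> borel_measurable borel" and "sin \<phi> \<noteq> 0"
  shows "(\<integral>\<^sup>+z. \<integral>\<^sup>+\<xi>. f (momentum_randomization \<phi> \<xi> z) \<partial>std_gaussian \<partial>BG) = (\<integral>\<^sup>+z. f z \<partial>BG)"
proof -
  interpret G: prob_space "std_gaussian :: (real ^ 'n) measure" by (rule prob_space_std_gaussian)
  have [measurable]: "(\<lambda>z. \<integral>\<^sup>+\<xi>. f (momentum_randomization \<phi> \<xi> z) \<partial>std_gaussian) \<in> borel_measurable borel"
  proof (rule G.borel_measurable_nn_integral)
    have "(\<lambda>x. f (momentum_randomization \<phi> (snd x) (fst x))) \<in> borel_measurable (borel \<Otimes>\<^sub>M borel)"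
      by measurable
    then show "(\<lambda>(z, \<xi>). f (momentum_randomization \<phi> \<xi> z)) \<in> borel_measurable (borel \<Otimes>\<^sub>M std_gaussian)"
      by (simp add: case_prod_beta' cong: measurable_cong_sets sets_pair_measure_cong)
  qed
  have "(\<integral>\<^sup>+z. \<integral>\<^sup>+\<xi>. f (momentum_randomization \<phi> \<xi> z) \<partial>std_gaussian \<partial>BG)
      = (\<integral>\<^sup>+q. ennreal (exp (- \<Phi> q) / C0) * (\<integral>\<^sup>+p. ennreal (gauss p) *
          (\<integral>\<^sup>+\<xi>. ennreal (gauss \<xi>) * f (q, cos \<phi> *\<^sub>R p + sin \<phi> *\<^sub>R \<xi>) \<partial>lborel) \<partial>lborel) \<partial>lborel)"
    by (subst nn_integral_BG) (auto simp: nn_integral_std_gaussian momentum_randomization_def)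
  also have "\<dots> = (\<integral>\<^sup>+q. ennreal (exp (- \<Phi> q) / C0) * (\<integral>\<^sup>+p. \<integral>\<^sup>+\<xi>. ennreal (gauss p) *
          (ennreal (gauss \<xi>) * f (q, cos \<phi> *\<^sub>R p + sin \<phi> *\<^sub>R \<xi>)) \<partial>lborel \<partial>lborel) \<partial>lborel)"
    by (subst nn_integral_cmult) auto
  also have "\<dots> = (\<integral>\<^sup>+q. ennreal (exp (- \<Phi> q) / C0) * (\<integral>\<^sup>+p. ennreal (gauss p) * f (q, p) \<partial>lborel) \<partial>lborel)"
    using assms(2) by (subst gaussian_rotation_invariant) auto
  also have "\<dots> = (\<integral>\<^sup>+z. f z \<partial>BG)" by (rule nn_integral_BG[symmetric]) fact
  finally show ?thesis .
qed

end

section \<open>The jump process, its semigroup and invariance\<close>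

lemma measurable_nn_integral_borel:
  fixes g :: "'y::second_countable_topology \<Rightarrow> 'x::second_countable_topology \<Rightarrow> ennreal"
  assumes M: "prob_space M" and [measurable_cong]: "sets M = sets borel"
    and g: "(\<lambda>w. g (fst w) (snd w)) \<in> borel_measurable borel"
  shows "(\<lambda>y. \<integral>\<^sup>+x. g y x \<partial>M) \<in> borel_measurable borel"
proof -
  interpret prob_space M by fact
  have "(\<lambda>w. g (fst w) (snd w)) \<in> borel_measurable (borel \<Otimes>\<^sub>M borel)"
    using g by (simp add: borel_prod)
  then have "(\<lambda>w. g (fst w) (snd w)) \<in> borel_measurable (borel \<Otimes>\<^sub>M M)"
    by (simp cong: measurable_cong_sets sets_pair_measure_cong add: assms(2))
  then show ?thesis
    by (intro borel_measurable_nn_integral) (simp add: case_prod_beta')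
qed

locale rhmc = gibbs_potential \<Phi> for \<Phi> :: "real ^ 'n::finite \<Rightarrow> real" +
  fixes lam \<phi> :: real
  assumes lam: "0 < lam" and phi: "0 < \<phi>" "\<phi> \<le> pi / 2"
begin

abbreviation "hold \<equiv> density lborel (\<lambda>s. ennreal (exponential_density (1 / lam) s))"
abbreviation "clock_noise \<equiv> hold \<Otimes>\<^sub>M (std_gaussian :: (real ^ 'n) measure)"
abbreviation "noise \<equiv> rhmc_noise lam :: (nat \<Rightarrow> real \<times> (real ^ 'n)) measure"
abbreviation "law \<equiv> rhmc_law \<Phi> lam \<phi>"

text \<open>The state just after a jump: \<open>x\<close> consists of the holding time and the Gaussian vector.\<close>

definition jump :: "real \<times> (real ^ 'n) \<Rightarrow> 'n phase \<Rightarrow> 'n phase" where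
  "jump x z = momentum_randomization \<phi> (snd x) (\<theta> (fst x) z)"

lemma sin_phi_pos: "0 < sin \<phi>"
  using phi by (intro sin_gt_zero) auto

lemma prob_space_hold: "prob_space hold"
  by (rule prob_space_exponential_density) (use lam in simp)

sublocale hold: prob_space hold by (rule prob_space_hold)
sublocale gaussian: prob_space "std_gaussian :: (real ^ 'n) measure" by (rule prob_space_std_gaussian)
sublocale clock: pair_prob_space hold "std_gaussian :: (real ^ 'n) measure" ..

lemma prob_space_clock: "prob_space clock_noise"
  by (rule prob_space_pair[OF prob_space_hold prob_space_std_gaussian])

lemma sets_clock [measurable_cong]: "sets clock_noise = sets borel"
proof -
  have "sets clock_noise = sets (borel \<Otimes>\<^sub>M borel)" by (intro sets_pair_measure_cong) auto
  then show ?thesis unfolding borel_prod .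
qed

lemma space_clock [simp]: "space clock_noise = UNIV"
  by (simp add: space_pair_measure)

lemma measurable_jump [measurable]:
  assumes [measurable]: "f \<in> borel_measurable M" "g \<in> borel_measurable M"
  shows "(\<lambda>x. jump (f x) (g x)) \<in> borel_measurable M"
  unfolding jump_def by measurable

sublocale noise: sequence_space clock_noise
proof -
  interpret clock_noise: prob_space clock_noise by (rule prob_space_clock)
  show "sequence_space clock_noise" by unfold_locales
qed

lemma noise_eq: "noise = noise.S" by (simp add: rhmc_noise_def)

lemma prob_space_noise: "prob_space noise"
  unfolding noise_eq by (intro prob_space_PiM prob_space_clock)

lemma nn_integral_noise_shift:
  assumes [measurable]: "F \<in> borel_measurable noise"
  shows "(\<integral>\<^sup>+\<omega>. F \<omega> \<partial>noise) = (\<integral>\<^sup>+x. \<integral>\<^sup>+\<omega>. F (case_nat x \<omega>) \<partial>noise \<partial>clock_noise)"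
proof -
  have F [measurable]: "F \<in> borel_measurable noise.S" using assms by (simp add: noise_eq)
  have "(\<integral>\<^sup>+\<omega>. F \<omega> \<partial>noise.S) = (\<integral>\<^sup>+\<omega>. F \<omega> \<partial>distr (clock_noise \<Otimes>\<^sub>M noise.S) noise.S (\<lambda>(s, \<omega>). case_nat s \<omega>))"
    by (simp only: noise.PiM_iter)
  also have "\<dots> = (\<integral>\<^sup>+w. F ((\<lambda>(s, \<omega>). case_nat s \<omega>) w) \<partial>(clock_noise \<Otimes>\<^sub>M noise.S))"
    by (rule nn_integral_distr) measurable
  also have "\<dots> = (\<integral>\<^sup>+x. \<integral>\<^sup>+\<omega>. F (case_nat x \<omega>) \<partial>noise.S \<partial>clock_noise)"
    by (subst noise.nn_integral_fst[symmetric]) (auto simp: case_prod_beta')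
  finally show ?thesis unfolding noise_eq .
qed

lemma measurable_noise_component: "(\<lambda>\<omega>. \<omega> k) \<in> borel_measurable noise"
proof -
  have "(\<lambda>\<omega>. \<omega> k) \<in> measurable noise.S clock_noise"
    by (rule measurable_component_singleton) simp
  then show ?thesis by (simp add: noise_eq sets_clock cong: measurable_cong_sets)
qed

lemma measurable_jump_time [measurable]: "(\<lambda>\<omega>. jump_time \<omega> k) \<in> borel_measurable noise"
proof -
  have [measurable]: "(\<lambda>\<omega>. fst (\<omega> i)) \<in> borel_measurable noise" for i
    by (rule measurable_compose[OF measurable_noise_component]) measurable
  show ?thesis unfolding jump_time_def by measurable
qed

lemma jump_state_Suc: "jump_state \<Phi> \<phi> z \<omega> (Suc k) = jump (\<omega> k) (jump_state \<Phi> \<phi> z \<omega> k)"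
  by (simp add: jump_def)

lemma measurable_jump_state [measurable]: "(\<lambda>\<omega>. jump_state \<Phi> \<phi> z \<omega> k) \<in> borel_measurable noise"
proof (induction k)
  case (Suc k)

  show ?case
    unfolding jump_state_Suc by (rule measurable_jump[OF measurable_noise_component Suc])
qed simp

lemma measurable_rhmc_process [measurable]: "rhmc_process \<Phi> \<phi> t z \<in> borel_measurable noise"
proof -
  have "(\<lambda>\<omega>. (\<lambda>n \<omega>. \<theta> (t - jump_time \<omega> n) (jump_state \<Phi> \<phi> z \<omega> n)) (LEAST n. t < jump_time \<omega> (Suc n)) \<omega>)
      \<in> borel_measurable noise"
    by (rule measurable_compose_countable) measurable
  then show ?thesis by (simp add: rhmc_process_def[abs_def] Let_def)
qed

lemma jump_time_case_nat: "jump_time (case_nat x \<omega>) (Suc k) = fst x + jump_time \<omega> k"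
  by (simp add: jump_time_def sum.lessThan_Suc_shift del: sum.lessThan_Suc)

lemma jump_state_case_nat: "jump_state \<Phi> \<phi> z (case_nat x \<omega>) (Suc k) = jump_state \<Phi> \<phi> (jump x z) \<omega> k"
  by (induction k) (simp_all add: jump_def)

lemma rhmc_process_before_jump: "t < fst x \<Longrightarrow> rhmc_process \<Phi> \<phi> t z (case_nat x \<omega>) = \<theta> t z"
proof -
  assume *: "t < fst x"
  have "(LEAST n. t < jump_time (case_nat x \<omega>) (Suc n)) = 0"
    by (rule Least_eq_0) (simp add: jump_time_case_nat * jump_time_def)
  then show ?thesis by (simp add: rhmc_process_def jump_time_def)
qed

text \<open>The process restarts at a jump.  The second premise says that a later jump time exceeds \<open>t\<close>; without such an
  index the \<open>LEAST\<close> in the definition of the process would be arbitrary.\<close>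

lemma rhmc_process_after_jump:
  assumes "\<not> t < fst x" and "t - fst x < jump_time \<omega> (Suc k)"
  shows "rhmc_process \<Phi> \<phi> t z (case_nat x \<omega>) = rhmc_process \<Phi> \<phi> (t - fst x) (jump x z) \<omega>"
proof -
  let ?Q = "\<lambda>n. t < jump_time (case_nat x \<omega>) (Suc n)"
  have "?Q (Suc k)" using assms(2) by (simp add: jump_time_case_nat algebra_simps)
  moreover have "\<not> ?Q 0" using assms(1) by (simp add: jump_time_case_nat jump_time_def)
  ultimately have "(LEAST n. ?Q n) = Suc (LEAST n. ?Q (Suc n))" by (rule Least_Suc)
  also have "(LEAST n. ?Q (Suc n)) = (LEAST n. t - fst x < jump_time \<omega> (Suc n))"
    by (simp add: jump_time_case_nat algebra_simps)
  finally show ?thesis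
    unfolding rhmc_process_def Let_def
    by (simp add: jump_state_case_nat jump_time_case_nat diff_diff_eq del: jump_state.simps)
qed

text \<open>\<open>trunc f n t z\<close> is the expectation of \<open>f (Z t)\<close> on the event that fewer than \<open>n\<close> jumps have
  occurred by time \<open>t\<close>.\<close>

primrec trunc :: "('n phase \<Rightarrow> ennreal) \<Rightarrow> nat \<Rightarrow> real \<Rightarrow> 'n phase \<Rightarrow> ennreal" where
  "trunc f 0 t z = 0"
| "trunc f (Suc n) t z = (\<integral>\<^sup>+x. (if t < fst x then f (\<theta> t z) else trunc f n (t - fst x) (jump x z)) \<partial>clock_noise)"

definition semigroup :: "('n phase \<Rightarrow> ennreal) \<Rightarrow> real \<Rightarrow> 'n phase \<Rightarrow> ennreal" where
  "semigroup f t z = (SUP n. trunc f n t z)"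

lemma measurable_trunc_pair:
  assumes [measurable]: "f \<in> borel_measurable borel"
  shows "(\<lambda>w. trunc f n (fst w) (snd w)) \<in> borel_measurable borel"
proof (induction n)
  case (Suc n)
  have [measurable]: "(\<lambda>v. trunc f n (fst (fst v) - fst (snd v)) (jump (snd v) (snd (fst v))))
      \<in> borel_measurable (borel :: ((real \<times> 'n phase) \<times> (real \<times> (real ^ 'n))) measure)"
    using measurable_compose[OF _ Suc, of "\<lambda>v. (fst (fst v) - fst (snd v), jump (snd v) (snd (fst v)))" borel]
    by simp
  show ?case
    unfolding trunc.simps
    by (rule measurable_nn_integral_borel[OF prob_space_clock sets_clock]) measurable
qed simp

lemma measurable_trunc [measurable]:
  assumes "f \<in> borel_measurable borel" "g \<in> borel_measurable M" "h \<in> borel_measurable M"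
  shows "(\<lambda>x. trunc f n (g x) (h x)) \<in> borel_measurable M"
  using measurable_compose[OF _ measurable_trunc_pair[OF assms(1)], of "\<lambda>x. (g x, h x)" M] assms by simp

lemma measurable_semigroup [measurable]:
  assumes [measurable]: "f \<in> borel_measurable borel" "g \<in> borel_measurable M" "h \<in> borel_measurable M"
  shows "(\<lambda>x. semigroup f (g x) (h x)) \<in> borel_measurable M"
  unfolding semigroup_def by measurable

lemma trunc_mono: "trunc f n t z \<le> trunc f (Suc n) t z"
proof (induction n arbitrary: t z)
  case (Suc n)
  have "trunc f (Suc n) t z = (\<integral>\<^sup>+x. (if t < fst x then f (\<theta> t z) else trunc f n (t - fst x) (jump x z)) \<partial>clock_noise)"
    by (rule trunc.simps)
  also have "\<dots> \<le> (\<integral>\<^sup>+x. (if t < fst x then f (\<theta> t z) else trunc f (Suc n) (t - fst x) (jump x z)) \<partial>clock_noise)"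
    by (intro nn_integral_mono) (simp add: Suc del: trunc.simps)
  also have "\<dots> = trunc f (Suc (Suc n)) t z" by (rule trunc.simps(2)[symmetric])
  finally show ?case .
qed simp

lemma incseq_trunc: "incseq (\<lambda>n. trunc f n t z)"
  using trunc_mono by (rule incseq_SucI)

lemma semigroup_renewal:
  assumes [measurable]: "f \<in> borel_measurable borel"
  shows "semigroup f t z = (\<integral>\<^sup>+x. (if t < fst x then f (\<theta> t z) else semigroup f (t - fst x) (jump x z)) \<partial>clock_noise)"
proof -
  have "semigroup f t z = (SUP n. trunc f (Suc n) t z)"
    unfolding semigroup_def using incseq_trunc[of f t z]
    by (intro antisym SUP_mono SUP_subset_mono) (auto intro: trunc_mono simp del: trunc.simps)
  also have "\<dots> = (\<integral>\<^sup>+x. (SUP n. if t < fst x then f (\<theta> t z) else trunc f n (t - fst x) (jump x z)) \<partial>clock_noise)"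
    unfolding trunc.simps
  proof (rule nn_integral_monotone_convergence_SUP[symmetric])
    show "incseq (\<lambda>n x. if t < fst x then f (\<theta> t z) else trunc f n (t - fst x) (jump x z))"
      using trunc_mono by (intro incseq_SucI le_funI) (auto simp del: trunc.simps)
  qed measurable
  also have "\<dots> = (\<integral>\<^sup>+x. (if t < fst x then f (\<theta> t z) else semigroup f (t - fst x) (jump x z)) \<partial>clock_noise)"
    by (intro nn_integral_cong) (simp add: semigroup_def)
  finally show ?thesis .
qed

text \<open>The semigroup is the least solution of its renewal equation, because it is the limit of the iteration that
  starts from \<open>0\<close>.  Every supersolution lies above it.\<close>

lemma semigroup_least:
  assumes u: "\<And>t z. 0 \<le> t \<Longrightarrow>
      (\<integral>\<^sup>+x. (if t < fst x then f (\<theta> t z) else u (t - fst x) (jump x z)) \<partial>clock_noise) \<le> u t z"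
    and t: "0 \<le> t"
  shows "semigroup f t z \<le> u t z"
proof -
  have "trunc f n t z \<le> u t z" if "0 \<le> t" for n t z
    using that
  proof (induction n arbitrary: t z)
    case (Suc n)
    have "trunc f (Suc n) t z \<le> (\<integral>\<^sup>+x. (if t < fst x then f (\<theta> t z) else u (t - fst x) (jump x z)) \<partial>clock_noise)"
      unfolding trunc.simps using Suc by (intro nn_integral_mono) auto
    also have "\<dots> \<le> u t z" using Suc.prems by (rule u)
    finally show ?case .
  qed simp
  then show ?thesis unfolding semigroup_def using t by (intro SUP_least)
qed

lemma trunc_eq:
  assumes [measurable]: "f \<in> borel_measurable borel"
  shows "trunc f n t z = (\<integral>\<^sup>+\<omega>. f (rhmc_process \<Phi> \<phi> t z \<omega>) * indicator {\<omega>. \<exists>k<n. t < jump_time \<omega> (Suc k)} \<omega> \<partial>noise)"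
proof (induction n arbitrary: t z)
  case (Suc n)
  let ?F = "\<lambda>n t z \<omega>. f (rhmc_process \<Phi> \<phi> t z \<omega>) * indicator {\<omega>. \<exists>k<n. t < jump_time \<omega> (Suc k)} \<omega> :: ennreal"
  have m: "?F n t z \<in> borel_measurable noise" for n t z by measurable
  have "(\<integral>\<^sup>+\<omega>. ?F (Suc n) t z \<omega> \<partial>noise) = (\<integral>\<^sup>+x. \<integral>\<^sup>+\<omega>. ?F (Suc n) t z (case_nat x \<omega>) \<partial>noise \<partial>clock_noise)"
    by (rule nn_integral_noise_shift[OF m])
  also have "\<dots> = (\<integral>\<^sup>+x. (if t < fst x then f (\<theta> t z) else trunc f n (t - fst x) (jump x z)) \<partial>clock_noise)"
  proof (rule nn_integral_cong)
    fix x :: "real \<times> (real ^ 'n)"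
    have split: "(\<exists>k<Suc n. t < jump_time (case_nat x \<omega>) (Suc k)) \<longleftrightarrow> t < fst x \<or> (\<exists>k<n. t - fst x < jump_time \<omega> (Suc k))" for \<omega>
      unfolding Ex_less_Suc2 by (simp add: jump_time_case_nat algebra_simps) (simp add: jump_time_def)
    show "(\<integral>\<^sup>+\<omega>. ?F (Suc n) t z (case_nat x \<omega>) \<partial>noise)
        = (if t < fst x then f (\<theta> t z) else trunc f n (t - fst x) (jump x z))"
    proof (cases "t < fst x")
      case True
      then have "?F (Suc n) t z (case_nat x \<omega>) = f (\<theta> t z)" for \<omega>
        by (simp add: split rhmc_process_before_jump)
      then show ?thesis using True prob_space.emeasure_space_1[OF prob_space_noise] by simp
    next
      case False
      then have "?F (Suc n) t z (case_nat x \<omega>) = ?F n (t - fst x) (jump x z) \<omega>" for \<omega>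
        using rhmc_process_after_jump[of t x \<omega> _ z]
        by (auto simp: split split: split_indicator)
      then show ?thesis using False by (simp add: Suc)
    qed
  qed
  finally show ?case by simp
qed simp

lemma hold_le: "0 \<le> t \<Longrightarrow> emeasure hold {..t} = ennreal (1 - exp (- t / lam))"
  using emeasure_erlang_density[of "1 / lam" 0 t] lam by (simp add: erlang_CDF_0)

lemma hold_gt: "0 \<le> t \<Longrightarrow> emeasure hold {t<..} = ennreal (exp (- t / lam))"
proof -
  assume t: "0 \<le> t"
  have "emeasure hold {t<..} = emeasure hold (space hold - {..t})"
    by (rule arg_cong2[where f=emeasure]) auto
  also have "\<dots> = 1 - ennreal (1 - exp (- t / lam))"
    using hold_le[OF t] hold.emeasure_space_1 by (subst emeasure_compl) auto
  also have "\<dots> = ennreal (exp (- t / lam))"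
    using t lam by (subst ennreal_1[symmetric], subst ennreal_minus) auto
  finally show ?thesis .
qed

lemma nn_integral_clock:
  assumes [measurable]: "g \<in> borel_measurable borel"
  shows "(\<integral>\<^sup>+x. g x \<partial>clock_noise) = (\<integral>\<^sup>+s. \<integral>\<^sup>+\<xi>. g (s, \<xi>) \<partial>std_gaussian \<partial>hold)"
proof -
  have "g \<in> borel_measurable clock_noise" by measurable
  from gaussian.nn_integral_fst[OF this] show ?thesis by simp
qed

lemma AE_hold_nonneg: "AE s in hold. 0 \<le> s"
  by (subst AE_density) (auto simp: exponential_density_def)

lemma nn_integral_clock_fst:
  assumes [measurable]: "g \<in> borel_measurable borel"
  shows "(\<integral>\<^sup>+x. g (fst x) \<partial>clock_noise) = (\<integral>\<^sup>+s. g s \<partial>hold)"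
  using nn_integral_clock[of "\<lambda>x. g (fst x)"] gaussian.emeasure_space_1 by simp

lemma AE_clock_nonneg: "AE x in clock_noise. 0 \<le> fst x"
proof (rule clock.AE_pair_measure)
  show "{x \<in> space clock_noise. 0 \<le> fst x} \<in> sets clock_noise" by measurable
qed (use AE_hold_nonneg in auto)

text \<open>Infinitely many jumps in bounded time would have a probability that, conditioning on the first
  holding time, is at most itself times the probability that this time is short.\<close>

lemma no_explosion:
  assumes t: "0 \<le> t"
  shows "AE \<omega> in noise. \<exists>k. t < jump_time \<omega> (Suc k)"
proof -
  interpret N: prob_space noise by (rule prob_space_noise)
  let ?B = "\<lambda>t. {\<omega>. \<forall>k. jump_time \<omega> (Suc k) \<le> t}"
  define h where "h t = (\<integral>\<^sup>+\<omega>. indicator (?B t) \<omega> \<partial>noise)" for t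
  have m: "indicator (?B t) \<in> borel_measurable noise" for t
    by measurable
  have h1: "h t \<le> 1" for t
  proof -
    have "h t \<le> (\<integral>\<^sup>+\<omega>. 1 \<partial>noise)"
      unfolding h_def by (intro nn_integral_mono) (simp add: indicator_def)
    also have "\<dots> = 1" using N.emeasure_space_1 by simp
    finally show ?thesis .
  qed
  have "h t = (\<integral>\<^sup>+x. \<integral>\<^sup>+\<omega>. indicator (?B t) (case_nat x \<omega>) \<partial>noise \<partial>clock_noise)"
    unfolding h_def by (rule nn_integral_noise_shift[OF m])
  also have "\<dots> \<le> (\<integral>\<^sup>+x. indicator {..t} (fst x) * h t \<partial>clock_noise)"
  proof (rule nn_integral_mono_AE, use AE_clock_nonneg in eventually_elim)
    fix x :: "real \<times> (real ^ 'n)" assume x: "0 \<le> fst x"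
    have le: "indicator (?B t) (case_nat x \<omega>) \<le> indicator {..t} (fst x) * (indicator (?B t) \<omega> :: ennreal)" for \<omega>
    proof (cases "case_nat x \<omega> \<in> ?B t")
      case True
      then have *: "jump_time (case_nat x \<omega>) (Suc k) \<le> t" for k by simp
      have "fst x \<le> t" using *[of 0] by (simp add: jump_time_case_nat jump_time_def)
      moreover have "\<omega> \<in> ?B t" using *[of "Suc _"] x by (simp add: jump_time_case_nat) (smt (verit))
      ultimately show ?thesis by (simp add: indicator_def)
    qed simp
    show "(\<integral>\<^sup>+\<omega>. indicator (?B t) (case_nat x \<omega>) \<partial>noise) \<le> indicator {..t} (fst x) * h t"
      unfolding h_def using le by (subst nn_integral_cmult[symmetric]) (auto intro!: nn_integral_mono m)
  qed
  also have "\<dots> = emeasure hold {..t} * h t"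
    by (subst nn_integral_clock_fst) (auto simp: nn_integral_multc)
  finally have le: "h t \<le> ennreal (1 - exp (- t / lam)) * h t" using hold_le[OF t] by simp
  obtain r where r: "h t = ennreal r" "0 \<le> r" using h1[of t] by (cases "h t") (auto simp: top_unique)
  from le have "ennreal r \<le> ennreal ((1 - exp (- t / lam)) * r)"
    using t lam by (simp add: r ennreal_mult)
  then have "r \<le> (1 - exp (- t / lam)) * r"
    using r t lam by (subst (asm) ennreal_le_iff) auto
  then have "exp (- t / lam) * r \<le> 0" by (simp add: algebra_simps)
  then have "r = 0" using r(2) by (simp add: mult_le_0_iff)
  then have "(\<integral>\<^sup>+\<omega>. indicator (?B t) \<omega> \<partial>noise) = 0" using r by (simp add: h_def)
  then have "AE \<omega> in noise. indicator (?B t) \<omega> = (0::ennreal)"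
    by (subst (asm) nn_integral_0_iff_AE[OF m])
  then show ?thesis by eventually_elim (auto simp: not_le split: split_indicator_asm)
qed

lemma sets_law [simp, measurable_cong]: "sets (law t z) = sets borel"
  and space_law [simp]: "space (law t z) = UNIV"
  by (simp_all add: rhmc_law_def)

lemma prob_space_law: "prob_space (law t z)"
  unfolding rhmc_law_def by (intro prob_space.prob_space_distr prob_space_noise) measurable

lemma nn_integral_law:
  assumes t: "0 \<le> t" and [measurable]: "f \<in> borel_measurable borel"
  shows "(\<integral>\<^sup>+y. f y \<partial>law t z) = semigroup f t z"
proof -
  have "(\<integral>\<^sup>+y. f y \<partial>law t z) = (\<integral>\<^sup>+\<omega>. f (rhmc_process \<Phi> \<phi> t z \<omega>) \<partial>noise)"
    unfolding rhmc_law_def by (rule nn_integral_distr) measurable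
  also have "\<dots> = (\<integral>\<^sup>+\<omega>. (SUP n. f (rhmc_process \<Phi> \<phi> t z \<omega>) * indicator {\<omega>. \<exists>k<n. t < jump_time \<omega> (Suc k)} \<omega>) \<partial>noise)"
  proof (rule nn_integral_cong_AE, use no_explosion[OF t] in eventually_elim)
    fix \<omega> :: "nat \<Rightarrow> real \<times> (real ^ 'n)" assume "\<exists>k. t < jump_time \<omega> (Suc k)"
    then obtain k where k: "t < jump_time \<omega> (Suc k)" ..
    show "f (rhmc_process \<Phi> \<phi> t z \<omega>) = (SUP n. f (rhmc_process \<Phi> \<phi> t z \<omega>) * indicator {\<omega>. \<exists>k<n. t < jump_time \<omega> (Suc k)} \<omega>)"
      using k by (intro antisym SUP_upper2[of "Suc k"] SUP_least) (auto split: split_indicator)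
  qed
  also have "\<dots> = (SUP n. trunc f n t z)"
    unfolding trunc_eq[OF assms(2)]
    by (rule nn_integral_monotone_convergence_SUP)
      (auto simp: incseq_def le_fun_def split: split_indicator intro: order.strict_trans2)
  finally show ?thesis by (simp add: semigroup_def)
qed

lemma emeasure_law:
  assumes t: "0 \<le> t" and A [measurable]: "A \<in> sets borel"
  shows "emeasure (law t z) A = semigroup (indicator A) t z"
  using nn_integral_law[OF t, of "indicator A" z] by simp

lemma measurable_emeasure_law [measurable]:
  assumes t: "0 \<le> t" and A [measurable]: "A \<in> sets borel"
  shows "(\<lambda>z. emeasure (law t z) A) \<in> borel_measurable borel"
  unfolding emeasure_law[OF assms] by measurable

text \<open>The exponential law has no memory: shifted back by \<open>t\<close>, what happens after time \<open>t\<close> has the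
  original distribution, up to the probability \<open>exp (- t / lam)\<close> of no jump before \<open>t\<close>.\<close>

lemma clock_memoryless:
  assumes t: "0 \<le> t" and [measurable]: "G \<in> borel_measurable borel"
  shows "(\<integral>\<^sup>+x. (if t < fst x then G (fst x - t, snd x) else 0) \<partial>clock_noise)
    = ennreal (exp (- t / lam)) * (\<integral>\<^sup>+x. G x \<partial>clock_noise)"
proof -
  define g where "g s = (\<integral>\<^sup>+\<xi>. G (s, \<xi>) \<partial>std_gaussian)" for s
  have gm [measurable]: "g \<in> borel_measurable borel"
    unfolding g_def
    by (rule measurable_nn_integral_borel[OF prob_space_std_gaussian sets_std_gaussian]) measurable
  have "(\<integral>\<^sup>+x. (if t < fst x then G (fst x - t, snd x) else 0) \<partial>clock_noise)
      = (\<integral>\<^sup>+s. (if t < s then g (s - t) else 0) \<partial>hold)"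
    by (subst nn_integral_clock) (auto simp: g_def intro!: nn_integral_cong)
  also have "\<dots> = (\<integral>\<^sup>+s. ennreal (exponential_density (1 / lam) s) * (if t < s then g (s - t) else 0) \<partial>lborel)"
    by (rule nn_integral_density) measurable
  also have "\<dots> = (\<integral>\<^sup>+r. ennreal (exponential_density (1 / lam) (t + r)) * (if t < t + r then g (t + r - t) else 0) \<partial>lborel)"
    by (subst nn_integral_real_affine[where c=1 and t=t]) (simp_all cong: if_cong)
  also have "\<dots> = (\<integral>\<^sup>+r. ennreal (exp (- t / lam)) * (ennreal (exponential_density (1 / lam) r) * g r) \<partial>lborel)"
  proof (rule nn_integral_cong_AE, use AE_lborel_singleton[of 0] in eventually_elim)
    fix r :: real assume "r \<noteq> 0"
    then show "ennreal (exponential_density (1 / lam) (t + r)) * (if t < t + r then g (t + r - t) else 0)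
        = ennreal (exp (- t / lam)) * (ennreal (exponential_density (1 / lam) r) * g r)"
    proof (cases "0 < r")
      case True
      have "exponential_density (1 / lam) (t + r) = exp (- t / lam) * exponential_density (1 / lam) r"
        using True t by (simp add: exponential_density_def algebra_simps add_divide_distrib diff_divide_distrib flip: exp_add)
      then show ?thesis using True by (simp add: ennreal_mult' mult.assoc)
    qed (auto simp: exponential_density_def)
  qed
  also have "\<dots> = ennreal (exp (- t / lam)) * (\<integral>\<^sup>+r. ennreal (exponential_density (1 / lam) r) * g r \<partial>lborel)"
    by (rule nn_integral_cmult) measurable
  also have "(\<integral>\<^sup>+r. ennreal (exponential_density (1 / lam) r) * g r \<partial>lborel) = (\<integral>\<^sup>+s. g s \<partial>hold)"
    by (rule nn_integral_density[symmetric]) measurable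
  also have "\<dots> = (\<integral>\<^sup>+x. G x \<partial>clock_noise)" by (subst nn_integral_clock) (auto simp: g_def[abs_def])
  finally show ?thesis .
qed

lemma nn_integral_clock_gt: "0 \<le> t \<Longrightarrow> (\<integral>\<^sup>+x. (if t < fst x then k else 0) \<partial>clock_noise) = ennreal (exp (- t / lam)) * k"
  using clock_memoryless[of t "\<lambda>_. k"] clock.emeasure_space_1 by simp

text \<open>As a function of \<open>t\<close>, the expectation at time \<open>t + s\<close> solves the renewal equation for the initial function
  \<open>semigroup f s\<close>: the event that the first jump comes after \<open>t\<close> is rewritten by the lack of memory.  Minimality
  gives one inequality.\<close>

lemma semigroup_add_ge:
  assumes s: "0 \<le> s" and t: "0 \<le> t" and [measurable]: "f \<in> borel_measurable borel"
  shows "semigroup (semigroup f s) t z \<le> semigroup f (t + s) z"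
proof (rule semigroup_least[where u="\<lambda>t z. semigroup f (t + s) z", OF _ t])
  fix t :: real and z :: "'n phase" assume t: "0 \<le> t"
  let ?G = "\<lambda>x. if s < fst x then f (\<theta> s (\<theta> t z)) else semigroup f (s - fst x) (jump x (\<theta> t z))"
  let ?L = "\<lambda>x. if t < fst x then 0 else semigroup f (t - fst x + s) (jump x z)"
  have jump_later: "jump (r, \<xi>) (\<theta> t z) = jump (r + t, \<xi>) z" for r \<xi>
    by (simp add: jump_def flow_add)
  have "(\<integral>\<^sup>+x. (if t < fst x then semigroup f s (\<theta> t z) else semigroup f (t - fst x + s) (jump x z)) \<partial>clock_noise)
      = (\<integral>\<^sup>+x. (if t < fst x then semigroup f s (\<theta> t z) else 0) + ?L x \<partial>clock_noise)"
    by (intro nn_integral_cong) auto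
  also have "\<dots> = (\<integral>\<^sup>+x. (if t < fst x then semigroup f s (\<theta> t z) else 0) \<partial>clock_noise) + (\<integral>\<^sup>+x. ?L x \<partial>clock_noise)"
    by (rule nn_integral_add) measurable
  also have "(\<integral>\<^sup>+x. (if t < fst x then semigroup f s (\<theta> t z) else 0) \<partial>clock_noise)
      = ennreal (exp (- t / lam)) * (\<integral>\<^sup>+x. ?G x \<partial>clock_noise)"
    using t by (subst nn_integral_clock_gt) (auto simp: semigroup_renewal[of f s])
  also have "\<dots> = (\<integral>\<^sup>+x. (if t < fst x then ?G (fst x - t, snd x) else 0) \<partial>clock_noise)"
    by (rule clock_memoryless[OF t, symmetric]) measurable
  also have "\<dots> + (\<integral>\<^sup>+x. ?L x \<partial>clock_noise) = (\<integral>\<^sup>+x. (if t < fst x then ?G (fst x - t, snd x) else 0) + ?L x \<partial>clock_noise)"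
    by (rule nn_integral_add[symmetric]) measurable
  also have "\<dots> = (\<integral>\<^sup>+x. (if t + s < fst x then f (\<theta> (t + s) z) else semigroup f (t + s - fst x) (jump x z)) \<partial>clock_noise)"
  proof (rule nn_integral_cong)
    fix x :: "real \<times> (real ^ 'n)"
    show "(if t < fst x then ?G (fst x - t, snd x) else 0) + ?L x
        = (if t + s < fst x then f (\<theta> (t + s) z) else semigroup f (t + s - fst x) (jump x z))"
      using s jump_later[of "fst x - t" "snd x"] flow_add[of s t z]
      by (cases x) (auto simp: algebra_simps)
  qed
  also have "\<dots> = semigroup f (t + s) z" by (rule semigroup_renewal[symmetric]) measurable
  finally show "(\<integral>\<^sup>+x. (if t < fst x then semigroup f s (\<theta> t z) else semigroup f (t - fst x + s) (jump x z)) \<partial>clock_noise)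
      \<le> semigroup f (t + s) z" by simp
qed

lemma emeasure_compl_prob:
  assumes "prob_space M" "A \<in> sets M"
  shows "emeasure M A + emeasure M (space M - A) = 1"
  using assms plus_emeasure[of A M "space M - A"] prob_space.emeasure_space_1[of M]
  by (simp add: Diff_disjoint Un_absorb1 sets.sets_into_space)

lemma ennreal_eq_of_le_of_sum:
  fixes a b :: ennreal
  assumes "a \<le> b" "a' \<le> b'" "a + a' = 1" "b + b' = 1"
  shows "a = b"
proof (rule antisym[OF assms(1)])
  have "a' \<noteq> top" using assms(3) by (auto simp: top_unique)
  moreover have "b + a' \<le> a + a'"
    using assms by (metis add_left_mono)
  ultimately show "b \<le> a" by (simp add: add.commute[of _ a'] ennreal_add_left_cancel_le)
qed

text \<open>An inequality between probability measures that holds for all sets is an equality, as it also holds for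
  complements.\<close>

lemma kernel_average_eqI:
  assumes M: "prob_space M" and N: "prob_space N" "sets N = sets borel"
    and K: "\<And>y. prob_space (K y)" "\<And>y. sets (K y) = sets borel"
    and m: "\<And>B. B \<in> sets borel \<Longrightarrow> (\<lambda>y. emeasure (K y) B) \<in> borel_measurable M"
    and le: "\<And>B. B \<in> sets borel \<Longrightarrow> (\<integral>\<^sup>+y. emeasure (K y) B \<partial>M) \<le> emeasure N B"
    and A: "A \<in> sets (borel :: 'a::topological_space measure)"
  shows "(\<integral>\<^sup>+y. emeasure (K y) A \<partial>M) = emeasure N A"
proof (rule ennreal_eq_of_le_of_sum[OF le le])
  interpret M: prob_space M by (rule M)
  have UNIV: "space N = UNIV" "space (K y) = UNIV" for y
    using sets_eq_imp_space_eq[OF N(2)] sets_eq_imp_space_eq[OF K(2)] by simp_all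
  show compl: "UNIV - A \<in> sets borel" using A by simp
  have "(\<integral>\<^sup>+y. emeasure (K y) A \<partial>M) + (\<integral>\<^sup>+y. emeasure (K y) (UNIV - A) \<partial>M)
      = (\<integral>\<^sup>+y. emeasure (K y) A + emeasure (K y) (UNIV - A) \<partial>M)"
    by (rule nn_integral_add[OF m m, symmetric]) (fact A compl)+
  also have "\<dots> = (\<integral>\<^sup>+y. 1 \<partial>M)"
    using emeasure_compl_prob[OF K(1)] A by (intro nn_integral_cong) (simp add: K(2) UNIV)
  finally show "(\<integral>\<^sup>+y. emeasure (K y) A \<partial>M) + (\<integral>\<^sup>+y. emeasure (K y) (UNIV - A) \<partial>M) = 1"
    using M.emeasure_space_1 by simp
  show "emeasure N A + emeasure N (UNIV - A) = 1"
    using emeasure_compl_prob[OF N(1), of A] A by (simp add: N(2) UNIV)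
qed (fact A)

theorem markov_property:
  assumes s: "0 \<le> s" and t: "0 \<le> t" and A: "A \<in> sets borel"
  shows "emeasure (law (t + s) z) A = (\<integral>\<^sup>+y. emeasure (law s y) A \<partial>law t z)"
proof (rule kernel_average_eqI[symmetric, OF _ _ _ _ _ _ _ A])
  fix B :: "'n phase set" assume B [measurable]: "B \<in> sets borel"
  show "(\<lambda>y. emeasure (law s y) B) \<in> borel_measurable (law t z)"
    using measurable_emeasure_law[OF s B] by (simp cong: measurable_cong_sets)
  have "(\<integral>\<^sup>+y. emeasure (law s y) B \<partial>law t z) = (\<integral>\<^sup>+y. semigroup (indicator B) s y \<partial>law t z)"
    using s by (simp add: emeasure_law)
  also have "\<dots> = semigroup (semigroup (indicator B) s) t z"
    by (rule nn_integral_law[OF t]) measurable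
  also have "\<dots> \<le> semigroup (indicator B) (t + s) z"
    using s t by (intro semigroup_add_ge) auto
  finally show "(\<integral>\<^sup>+y. emeasure (law s y) B \<partial>law t z) \<le> emeasure (law (t + s) z) B"
    using s t by (simp add: emeasure_law)
qed (auto intro: prob_space_law)

text \<open>By induction on the number of jumps: the flow before the first jump preserves the measure, and so do flow and
  refreshment at the jump.\<close>

lemma BG_semigroup_le:
  assumes t: "0 \<le> t" and [measurable]: "f \<in> borel_measurable borel"
  shows "(\<integral>\<^sup>+z. semigroup f t z \<partial>BG) \<le> (\<integral>\<^sup>+z. f z \<partial>BG)"
proof -
  interpret BG: prob_space BG by (rule prob_space_BG)
  interpret pair_prob_space BG hold ..
  have "(\<integral>\<^sup>+z. trunc f n t z \<partial>BG) \<le> (\<integral>\<^sup>+z. f z \<partial>BG)" if "0 \<le> t" for n t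
    using that
  proof (induction n arbitrary: t)
    case (Suc n)
    let ?u = "\<lambda>s z. \<integral>\<^sup>+\<xi>. (if t < s then f (\<theta> t z) else trunc f n (t - s) (jump (s, \<xi>) z)) \<partial>std_gaussian"
    have um: "(\<lambda>w. ?u (snd w) (fst w)) \<in> borel_measurable borel"
      by (rule measurable_nn_integral_borel[OF prob_space_std_gaussian sets_std_gaussian]) measurable
    have "(\<integral>\<^sup>+z. trunc f (Suc n) t z \<partial>BG) = (\<integral>\<^sup>+z. \<integral>\<^sup>+s. ?u s z \<partial>hold \<partial>BG)"
      unfolding trunc.simps by (intro nn_integral_cong, subst nn_integral_clock) (auto cong: if_cong)
    also have "\<dots> = (\<integral>\<^sup>+s. \<integral>\<^sup>+z. ?u s z \<partial>BG \<partial>hold)"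
    proof (rule Fubini'[symmetric])
      have "(\<lambda>w. ?u (snd w) (fst w)) \<in> borel_measurable (borel \<Otimes>\<^sub>M borel)"
        using um by (simp add: borel_prod)
      then show "(\<lambda>(z, s). ?u s z) \<in> borel_measurable (BG \<Otimes>\<^sub>M hold)"
        by (simp add: case_prod_beta' cong: measurable_cong_sets sets_pair_measure_cong)
    qed
    also have "\<dots> \<le> (\<integral>\<^sup>+s. (\<integral>\<^sup>+z. f z \<partial>BG) \<partial>hold)"
    proof (rule nn_integral_mono)
      fix s
      show "(\<integral>\<^sup>+z. ?u s z \<partial>BG) \<le> (\<integral>\<^sup>+z. f z \<partial>BG)"
      proof (cases "t < s")
        case True
        then show ?thesis
          using BG_flow_invariant[of f t] by (simp add: gaussian.emeasure_space_1[simplified])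
      next
        case False
        let ?g = "\<lambda>z. \<integral>\<^sup>+\<xi>. trunc f n (t - s) (momentum_randomization \<phi> \<xi> z) \<partial>std_gaussian"
        have gm: "?g \<in> borel_measurable borel"
          by (rule measurable_nn_integral_borel[OF prob_space_std_gaussian sets_std_gaussian]) measurable
        have "(\<integral>\<^sup>+z. ?u s z \<partial>BG) = (\<integral>\<^sup>+z. ?g (\<theta> s z) \<partial>BG)"
          using False by (simp add: jump_def)
        also have "\<dots> = (\<integral>\<^sup>+z. ?g z \<partial>BG)" by (rule BG_flow_invariant[OF gm])
        also have "\<dots> = (\<integral>\<^sup>+z. trunc f n (t - s) z \<partial>BG)"
          using sin_phi_pos by (intro BG_randomization_invariant) auto
        also have "\<dots> \<le> (\<integral>\<^sup>+z. f z \<partial>BG)" using False by (intro Suc.IH) auto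
        finally show ?thesis .
      qed
    qed
    also have "\<dots> = (\<integral>\<^sup>+z. f z \<partial>BG)" by (simp add: hold.emeasure_space_1[simplified])
    finally show ?case .
  next
    case 0
    have "(\<integral>\<^sup>+z. trunc f 0 t z \<partial>BG) = (\<integral>\<^sup>+z. 0 \<partial>BG)" by (intro nn_integral_cong) simp
    then have eq: "(\<integral>\<^sup>+z. trunc f 0 t z \<partial>BG) = 0" by simp
    show ?case unfolding eq by simp
  qed
  then have "(SUP n. \<integral>\<^sup>+z. trunc f n t z \<partial>BG) \<le> (\<integral>\<^sup>+z. f z \<partial>BG)" using t by (intro SUP_least)
  moreover have "(\<integral>\<^sup>+z. semigroup f t z \<partial>BG) = (SUP n. \<integral>\<^sup>+z. trunc f n t z \<partial>BG)"
    unfolding semigroup_def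
    by (rule nn_integral_monotone_convergence_SUP)
      (auto intro!: incseq_SucI le_funI trunc_mono simp del: trunc.simps)
  ultimately show ?thesis by simp
qed

theorem BG_invariant: "invariant_prob law BG"
  unfolding invariant_prob_def
proof (intro conjI allI impI ballI)
  show "prob_space BG" by (rule prob_space_BG)
  fix t :: real and A :: "'n phase set"
  assume t: "0 \<le> t" and A: "A \<in> sets borel"
  show "(\<integral>\<^sup>+z. emeasure (law t z) A \<partial>BG) = emeasure BG A"
  proof (rule kernel_average_eqI[OF prob_space_BG prob_space_BG _ prob_space_law _ _ _ A])
    fix B :: "'n phase set" assume B: "B \<in> sets borel"
    show "(\<lambda>y. emeasure (law t y) B) \<in> borel_measurable BG"
      using measurable_emeasure_law[OF t B] by (simp cong: measurable_cong_sets)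
    show "(\<integral>\<^sup>+z. emeasure (law t z) B \<partial>BG) \<le> emeasure BG B"
      using BG_semigroup_le[OF t, of "indicator B"] t B by (simp add: emeasure_law)
  qed auto
qed simp

end

section \<open>The Lyapunov function\<close>

locale rhmc_lyapunov = rhmc \<Phi> lam \<phi> for \<Phi> :: "real ^ 'n::finite \<Rightarrow> real" and lam \<phi> +
  fixes a b :: real
  assumes a_pos: "0 < a" and b_pos: "0 < b" and b_less: "b < 1"
    and coercive: "\<And>q. (grad \<Phi> q \<bullet> q) / 2 \<ge> b * \<Phi> q
        + ((c1 lam \<phi> * b)\<^sup>2 + c2 lam \<phi> * b * (1 - b)) / (2 * (1 - b)) * (norm q)\<^sup>2 - a"
begin

abbreviation "\<gamma>1 \<equiv> c1 lam \<phi>"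
abbreviation "\<gamma>2 \<equiv> c2 lam \<phi>"
abbreviation "V \<equiv> lyapunov \<Phi> lam \<phi>"

lemma V_eq: "V z = (norm (snd z))\<^sup>2 / 2 + \<Phi> (fst z) + \<gamma>1 * (fst z \<bullet> snd z) + \<gamma>2 * (norm (fst z))\<^sup>2 / 2"
  by (simp add: lyapunov_def case_prod_beta)

lemma cos_phi: "0 \<le> cos \<phi>" "cos \<phi> < 1"
proof -
  show "0 \<le> cos \<phi>" using phi by (intro cos_ge_zero) auto
  have "cos \<phi> < cos 0" using phi by (intro cos_monotone_0_pi) auto
  then show "cos \<phi> < 1" by simp
qed

lemma gamma1_pos: "0 < \<gamma>1"
  using lam sin_phi_pos by (simp add: c1_def)

text \<open>The quadratic form \<open>\<bar>p\<bar>\<^sup>2 / 2 + \<gamma>1 (q \<bullet> p) + \<gamma>2 \<bar>q\<bar>\<^sup>2 / 2\<close> has a determinant that is bounded away from zero: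
  \<open>\<gamma>1\<^sup>2 = \<gamma>2 (1 + cos \<phi>) / 4\<close>.\<close>

lemma gamma1_square: "\<gamma>1\<^sup>2 \<le> \<gamma>2 / 2"
proof -
  have s: "(sin \<phi>)\<^sup>2 = (1 - cos \<phi>) * (1 + cos \<phi>)"
    using sin_cos_squared_add[of \<phi>] by (simp add: algebra_simps power2_eq_square)
  have "\<gamma>1\<^sup>2 = \<gamma>1 * (inverse lam * (1 - cos \<phi>)) * ((1 + cos \<phi>) / 4)"
    by (simp add: power2_eq_square) (simp add: c1_def s)
  also have "\<dots> = \<gamma>2 * ((1 + cos \<phi>) / 4)" by (simp add: c2_def mult_ac)
  also have "\<dots> \<le> \<gamma>2 * (1 / 2)"
    using cos_phi lam gamma1_pos by (intro mult_left_mono) (auto simp: c2_def)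
  finally show ?thesis by simp
qed

lemma gamma2_pos: "0 < \<gamma>2"
  using cos_phi lam gamma1_pos by (simp add: c2_def)

text \<open>Of \<open>\<bar>p\<bar>\<^sup>2 / 2\<close> the part \<open>3 \<bar>p\<bar>\<^sup>2 / 8\<close> is spent on completing the square, which costs \<open>\<gamma>2 \<bar>q\<bar>\<^sup>2 / 3\<close> out of
  \<open>\<gamma>2 \<bar>q\<bar>\<^sup>2 / 2\<close>.\<close>

lemma V_lower: "\<Phi> (fst z) + (norm (snd z))\<^sup>2 / 8 + \<gamma>2 * (norm (fst z))\<^sup>2 / 6 \<le> V z"
proof -
  have "0 \<le> 3 / 8 * ((snd z + (4 / 3 * \<gamma>1) *\<^sub>R fst z) \<bullet> (snd z + (4 / 3 * \<gamma>1) *\<^sub>R fst z))"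
    by simp
  also have "\<dots> = 3 / 8 * (norm (snd z))\<^sup>2 + \<gamma>1 * (fst z \<bullet> snd z) + 2 / 3 * \<gamma>1\<^sup>2 * (norm (fst z))\<^sup>2"
    unfolding power2_norm_eq_inner by (simp add: inner_commute algebra_simps power2_eq_square)
  also have "2 / 3 * \<gamma>1\<^sup>2 * (norm (fst z))\<^sup>2 \<le> 2 / 3 * (\<gamma>2 / 2) * (norm (fst z))\<^sup>2"
    using gamma1_square by (intro mult_right_mono mult_left_mono) auto
  finally show ?thesis by (simp add: V_eq)
qed

lemma V_nonneg [simp]: "0 \<le> V z"
  by (rule order_trans[OF _ V_lower]) (use nonneg[of "fst z"] gamma2_pos in simp)

lemma continuous_V: "continuous_on UNIV V"
  unfolding V_eq[abs_def]
  by (intro continuous_intros continuous_on_compose2[OF continuous_potential]) auto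

lemma measurable_V [measurable]: "V \<in> borel_measurable borel"
  by (intro borel_measurable_continuous_onI continuous_V)

lemma measurable_grad [measurable]: "grad \<Phi> \<in> borel_measurable borel"
proof -
  have "continuous_on UNIV (\<lambda>q. - force q)" by (intro continuous_on_minus continuous_force)
  then show ?thesis by (intro borel_measurable_continuous_onI) simp
qed

text \<open>The derivative of \<open>V\<close> along the Hamiltonian vector field.\<close>

definition flow_deriv_V :: "'n phase \<Rightarrow> real" where
  "flow_deriv_V z = \<gamma>1 * (norm (snd z))\<^sup>2 + \<gamma>2 * (fst z \<bullet> snd z) - \<gamma>1 * (grad \<Phi> (fst z) \<bullet> fst z)"

lemma measurable_flow_deriv_V [measurable]: "flow_deriv_V \<in> borel_measurable borel"
  unfolding flow_deriv_V_def[abs_def] by measurable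

lemma V_along_flow: "((\<lambda>s. V (\<theta> s z)) has_real_derivative flow_deriv_V (\<theta> t z)) (at t)"
proof -

  note d = has_vector_derivative_fst_snd[OF flow_deriv[of z t]]
  note i = has_real_derivative_inner[OF d(1) d(1)] has_real_derivative_inner[OF d(2) d(2)]
    has_real_derivative_inner[OF d(1) d(2)]
  show ?thesis
    unfolding V_eq power2_norm_eq_inner
    by (rule DERIV_cong[OF DERIV_add[OF DERIV_add[OF DERIV_add[OF DERIV_cdivide[OF i(2)]
              potential_along_curve[OF flow_deriv]] DERIV_cmult[OF i(3)]] DERIV_cdivide[OF DERIV_cmult[OF i(1)]]]])
      (simp add: flow_deriv_V_def newton_def power2_norm_eq_inner inner_commute algebra_simps)
qed

definition gauss_M2 :: real where
  "gauss_M2 = (LINT \<xi>|std_gaussian. (norm (\<xi> :: real ^ 'n))\<^sup>2)"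

lemma gauss_M2_nonneg: "0 \<le> gauss_M2"
  unfolding gauss_M2_def by (rule integral_nonneg_AE) simp

text \<open>The mean of \<open>V\<close> after a refreshment of the momentum.\<close>

definition refresh_V :: "'n phase \<Rightarrow> real" where
  "refresh_V z = (cos \<phi>)\<^sup>2 * (norm (snd z))\<^sup>2 / 2 + \<Phi> (fst z) + \<gamma>1 * cos \<phi> * (fst z \<bullet> snd z)
     + \<gamma>2 * (norm (fst z))\<^sup>2 / 2 + (sin \<phi>)\<^sup>2 * gauss_M2 / 2"

lemma V_randomization:
  "integrable std_gaussian (\<lambda>\<xi>. V (momentum_randomization \<phi> \<xi> z))"
  "(LINT \<xi>|std_gaussian. V (momentum_randomization \<phi> \<xi> z)) = refresh_V z"
proof -
  let ?v = "(sin \<phi> * cos \<phi>) *\<^sub>R snd z + (\<gamma>1 * sin \<phi>) *\<^sub>R fst z"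
  let ?k = "(cos \<phi>)\<^sup>2 * (norm (snd z))\<^sup>2 / 2 + \<Phi> (fst z) + \<gamma>1 * cos \<phi> * (fst z \<bullet> snd z) + \<gamma>2 * (norm (fst z))\<^sup>2 / 2"
  have eq: "V (momentum_randomization \<phi> \<xi> z) = ?k + \<xi> \<bullet> ?v + (sin \<phi>)\<^sup>2 / 2 * (norm \<xi>)\<^sup>2" for \<xi>
    unfolding V_eq momentum_randomization_def power2_norm_eq_inner
    by (simp add: inner_commute algebra_simps power2_eq_square add_divide_distrib)
  note int = std_gaussian_moments(1)[of ?v] std_gaussian_moments(3)[where 'n='n]
  show "integrable std_gaussian (\<lambda>\<xi>. V (momentum_randomization \<phi> \<xi> z))"
    unfolding eq using int by (intro Bochner_Integration.integrable_add integrable_mult_right) auto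
  have "(LINT \<xi>|std_gaussian. V (momentum_randomization \<phi> \<xi> z))
      = (LINT \<xi>|std_gaussian. ?k + \<xi> \<bullet> ?v) + (LINT \<xi>|std_gaussian. (sin \<phi>)\<^sup>2 / 2 * (norm (\<xi> :: real ^ 'n))\<^sup>2)"
    unfolding eq using int
    by (intro Bochner_Integration.integral_add Bochner_Integration.integrable_add integrable_mult_right) auto
  also have "(LINT \<xi>|std_gaussian. ?k + \<xi> \<bullet> ?v) = (LINT \<xi>|(std_gaussian :: (real ^ 'n) measure). ?k) + (LINT \<xi>|std_gaussian. \<xi> \<bullet> ?v)"
    using int by (intro Bochner_Integration.integral_add) auto
  also have "(LINT \<xi>|(std_gaussian :: (real ^ 'n) measure). ?k) = ?k"
    using gaussian.prob_space by simp
  also have "(LINT \<xi>|std_gaussian. \<xi> \<bullet> ?v) = 0" by (rule std_gaussian_moments(2))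
  finally show "(LINT \<xi>|std_gaussian. V (momentum_randomization \<phi> \<xi> z)) = refresh_V z"
    by (simp add: refresh_V_def gauss_M2_def)
qed

lemma refresh_V_nonneg: "0 \<le> refresh_V z"
  unfolding V_randomization(2)[symmetric] by (rule integral_nonneg_AE) simp

lemma measurable_refresh_V [measurable]: "refresh_V \<in> borel_measurable borel"
  unfolding refresh_V_def[abs_def] by measurable

definition "rate = 2 * \<gamma>1 * b"
definition "noise_level = 2 * \<gamma>1 * a + inverse lam * (sin \<phi>)\<^sup>2 * gauss_M2 / 2"

lemma rate_pos: "0 < rate" using gamma1_pos b_pos by (simp add: rate_def)

lemma noise_level_nonneg: "0 \<le> noise_level"
  using gamma1_pos a_pos gauss_M2_nonneg lam by (simp add: noise_level_def)

text \<open>The coefficients \<open>c1\<close> and \<open>c2\<close> are chosen so that in \<open>L V\<close> the mixed term \<open>q \<bullet> p\<close> produced by the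
  flow cancels against the one produced by the randomization.  What remains is compared with \<open>- rate * V\<close>
  by completing a square, and this is exactly what the constant in the growth condition allows.\<close>

lemma generator_bound: "inverse lam * (refresh_V z - V z) + flow_deriv_V z \<le> - rate * V z + noise_level"
proof -
  obtain q p where z: "z = (q, p)" by (cases z)
  define P where "P = (norm p)\<^sup>2"
  define Q where "Q = (norm q)\<^sup>2"
  define S where "S = q \<bullet> p"
  define g where "g = grad \<Phi> q \<bullet> q"
  define k where "k = inverse lam"
  have c1: "k * (sin \<phi>)\<^sup>2 = 4 * \<gamma>1" by (simp add: c1_def k_def)
  have c2: "k * \<gamma>1 * (1 - cos \<phi>) = \<gamma>2" by (simp add: c2_def k_def)
  have cos2: "(cos \<phi>)\<^sup>2 = 1 - (sin \<phi>)\<^sup>2" by (simp add: cos_squared_eq)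
  have "refresh_V z - V z = - (sin \<phi>)\<^sup>2 * P / 2 - \<gamma>1 * (1 - cos \<phi>) * S + (sin \<phi>)\<^sup>2 * gauss_M2 / 2"
    by (simp add: refresh_V_def V_eq z P_def Q_def S_def cos2 algebra_simps diff_divide_distrib add_divide_distrib)
  then have "k * (refresh_V z - V z)
      = k * (- (sin \<phi>)\<^sup>2 * P / 2 - \<gamma>1 * (1 - cos \<phi>) * S + (sin \<phi>)\<^sup>2 * gauss_M2 / 2)"
    by (simp only:)
  also have "\<dots> = - (k * (sin \<phi>)\<^sup>2) * P / 2 - (k * \<gamma>1 * (1 - cos \<phi>)) * S + k * (sin \<phi>)\<^sup>2 * gauss_M2 / 2"
    by (simp add: algebra_simps)
  also have "\<dots> = - 2 * \<gamma>1 * P - \<gamma>2 * S + k * (sin \<phi>)\<^sup>2 * gauss_M2 / 2"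
    unfolding c2 by (subst c1) simp
  finally have gen: "k * (refresh_V z - V z) + flow_deriv_V z = - \<gamma>1 * P - \<gamma>1 * g + k * (sin \<phi>)\<^sup>2 * gauss_M2 / 2"
    by (simp add: flow_deriv_V_def z P_def S_def g_def)
  have b1: "0 < 1 - b" using b_less by simp
  have coeff: "((\<gamma>1 * b)\<^sup>2 + \<gamma>2 * b * (1 - b)) / (2 * (1 - b)) = ((\<gamma>1 * b)\<^sup>2 / (1 - b) + \<gamma>2 * b) / 2"
  proof -
    have "(A + B * m) / (2 * m) = (A / m + B) / 2" if "0 < m" for A B m :: real
      using that by (simp add: field_simps)
    from this[OF b1] show ?thesis .
  qed
  have "b * \<Phi> q + ((\<gamma>1 * b)\<^sup>2 / (1 - b) + \<gamma>2 * b) / 2 * Q - a \<le> g / 2"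
    using coercive[of q] unfolding coeff by (simp only: g_def Q_def)
  moreover have "2 * b * \<Phi> q + E * Q - 2 * a \<le> g" if "b * \<Phi> q + E / 2 * Q - a \<le> g / 2" for E
    using that by (simp add: field_simps)
  ultimately have "2 * b * \<Phi> q + ((\<gamma>1 * b)\<^sup>2 / (1 - b) + \<gamma>2 * b) * Q - 2 * a \<le> g"
    by blast
  then have "\<gamma>1 * (2 * b * \<Phi> q + ((\<gamma>1 * b)\<^sup>2 / (1 - b) + \<gamma>2 * b) * Q - 2 * a) \<le> \<gamma>1 * g"
    using gamma1_pos by (intro mult_left_mono) auto
  moreover have "2 * \<gamma>1 * b * S \<le> (1 - b) * P + (\<gamma>1 * b)\<^sup>2 / (1 - b) * Q"
  proof -
    let ?w = "(1 - b) *\<^sub>R p - (\<gamma>1 * b) *\<^sub>R q"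
    have "0 \<le> ?w \<bullet> ?w / (1 - b)" using b1 by simp
    also have "?w \<bullet> ?w = (1 - b) * ((1 - b) * P) - (1 - b) * (2 * \<gamma>1 * b * S) + (\<gamma>1 * b)\<^sup>2 * Q"
      unfolding P_def Q_def S_def power2_norm_eq_inner
      by (simp add: inner_diff_left inner_diff_right inner_commute power2_eq_square algebra_simps)
    also have "\<dots> / (1 - b) = (1 - b) * P - 2 * \<gamma>1 * b * S + (\<gamma>1 * b)\<^sup>2 / (1 - b) * Q"
      using b1 by (simp add: add_divide_distrib diff_divide_distrib)
    finally show ?thesis by simp
  qed
  then have "\<gamma>1 * (2 * \<gamma>1 * b * S) \<le> \<gamma>1 * ((1 - b) * P + (\<gamma>1 * b)\<^sup>2 / (1 - b) * Q)"
    using gamma1_pos by (intro mult_left_mono) auto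
  moreover have "rate * V z = \<gamma>1 * (b * P + 2 * b * \<Phi> q + \<gamma>2 * b * Q) + \<gamma>1 * (2 * \<gamma>1 * b * S)"
    by (simp add: rate_def V_eq z P_def Q_def S_def algebra_simps)
  ultimately show ?thesis
    unfolding k_def[symmetric] gen noise_level_def by (simp add: algebra_simps)
qed

definition drift_bound :: "real \<Rightarrow> 'n phase \<Rightarrow> real" where
  "drift_bound t z = exp (- rate * t) * V z + noise_level / rate * (1 - exp (- rate * t))"

lemma drift_bound_nonneg: "0 \<le> t \<Longrightarrow> 0 \<le> drift_bound t z"
  unfolding drift_bound_def using rate_pos noise_level_nonneg
  by (intro add_nonneg_nonneg mult_nonneg_nonneg divide_nonneg_pos) auto

lemma drift_bound_randomization:
  assumes t: "0 \<le> t"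
  shows "(\<integral>\<^sup>+\<xi>. ennreal (drift_bound t (momentum_randomization \<phi> \<xi> z)) \<partial>std_gaussian)
    = ennreal (exp (- rate * t) * refresh_V z + noise_level / rate * (1 - exp (- rate * t)))"
proof -
  have "(\<integral>\<^sup>+\<xi>. ennreal (drift_bound t (momentum_randomization \<phi> \<xi> z)) \<partial>std_gaussian)
      = ennreal (LINT \<xi>|std_gaussian. drift_bound t (momentum_randomization \<phi> \<xi> z))"
    using V_randomization(1)[of z] drift_bound_nonneg[OF t] gaussian.emeasure_finite
    by (intro nn_integral_eq_integral) (auto simp: drift_bound_def less_top[symmetric])
  also have "(LINT \<xi>|std_gaussian. drift_bound t (momentum_randomization \<phi> \<xi> z))
      = exp (- rate * t) * refresh_V z + noise_level / rate * (1 - exp (- rate * t))"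
    unfolding drift_bound_def V_randomization(2)[symmetric]
    using V_randomization(1)[of z] gaussian.prob_space
    by (subst Bochner_Integration.integral_add) (auto simp: less_top[symmetric])
  finally show ?thesis .
qed

text \<open>\<open>drift_bound\<close> satisfies \<open>d/dt W \<ge> L W\<close>.  Multiplied by the survival probability and followed along the
  flow, it decreases at least as fast as jumps bring mass in; integrating in time gives the
  supersolution property.\<close>

lemma drift_bound_supersolution:
  assumes t: "0 \<le> t"
  shows "(\<integral>\<^sup>+x. (if t < fst x then ennreal (V (\<theta> t z)) else ennreal (drift_bound (t - fst x) (jump x z))) \<partial>clock_noise)
    \<le> ennreal (drift_bound t z)"
proof -
  let ?e = "\<lambda>s. exp (- rate * (t - s))"
  define g where "g s = exp (- s / lam) * drift_bound (t - s) (\<theta> s z)" for s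
  define w where "w s = ?e s * refresh_V (\<theta> s z) + noise_level / rate * (1 - ?e s)" for s
  define d where "d s = exp (- s / lam) * (inverse lam * drift_bound (t - s) (\<theta> s z)
      - rate * ?e s * V (\<theta> s z) - ?e s * flow_deriv_V (\<theta> s z) + noise_level * ?e s)" for s
  have der: "((\<lambda>s. - g s) has_real_derivative d s) (at s)" for s
    unfolding g_def d_def drift_bound_def using rate_pos lam
    by (auto intro!: derivative_eq_intros V_along_flow simp: field_simps)
  have w_nonneg: "0 \<le> w s" if "s \<le> t" for s
    unfolding w_def using refresh_V_nonneg rate_pos noise_level_nonneg that
    by (intro add_nonneg_nonneg mult_nonneg_nonneg divide_nonneg_pos) auto
  have wd: "exp (- s / lam) * (inverse lam * w s) \<le> d s" for s
  proof -
    have "0 \<le> ?e s * (- rate * V (\<theta> s z) + noise_level - (inverse lam * (refresh_V (\<theta> s z) - V (\<theta> s z)) + flow_deriv_V (\<theta> s z)))"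
      using generator_bound[of "\<theta> s z"] by (intro mult_nonneg_nonneg) auto
    then have "inverse lam * w s \<le> inverse lam * drift_bound (t - s) (\<theta> s z)
      - rate * ?e s * V (\<theta> s z) - ?e s * flow_deriv_V (\<theta> s z) + noise_level * ?e s"
      by (simp add: w_def drift_bound_def algebra_simps)
    then show ?thesis unfolding d_def by (intro mult_left_mono) auto
  qed
  have d_nonneg: "0 \<le> d s" if "0 \<le> s" "s \<le> t" for s
    using w_nonneg[OF that(2)] lam by (intro order_trans[OF _ wd]) auto
  have [measurable]: "d \<in> borel_measurable borel"
    unfolding d_def[abs_def] drift_bound_def by measurable
  have FTC: "(\<integral>\<^sup>+s. ennreal (d s) * indicator {0..t} s \<partial>lborel) = ennreal (- g t - - g 0)"
    by (rule nn_integral_FTC_Icc) (use t der d_nonneg in \<open>auto intro: DERIV_subset\<close>)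
  have mono: "g t \<le> g 0"
    using DERIV_nonneg_imp_nondecreasing[OF t, of "\<lambda>s. - g s"] der d_nonneg by force
  have gt: "g t = exp (- t / lam) * V (\<theta> t z)" by (simp add: g_def drift_bound_def)
  have "(\<integral>\<^sup>+x. (if t < fst x then ennreal (V (\<theta> t z)) else ennreal (drift_bound (t - fst x) (jump x z))) \<partial>clock_noise)
      = (\<integral>\<^sup>+x. (if t < fst x then ennreal (V (\<theta> t z)) else 0) + (if t < fst x then 0 else ennreal (drift_bound (t - fst x) (jump x z))) \<partial>clock_noise)"
    by (intro nn_integral_cong) auto
  also have "\<dots> = (\<integral>\<^sup>+x. (if t < fst x then ennreal (V (\<theta> t z)) else 0) \<partial>clock_noise)
      + (\<integral>\<^sup>+x. (if t < fst x then 0 else ennreal (drift_bound (t - fst x) (jump x z))) \<partial>clock_noise)"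
    unfolding drift_bound_def by (rule nn_integral_add) measurable
  also have "(\<integral>\<^sup>+x. (if t < fst x then ennreal (V (\<theta> t z)) else 0) \<partial>clock_noise) = ennreal (g t)"
    by (subst nn_integral_clock_gt[OF t]) (simp add: gt ennreal_mult)
  also have "(\<integral>\<^sup>+x. (if t < fst x then 0 else ennreal (drift_bound (t - fst x) (jump x z))) \<partial>clock_noise)
      = (\<integral>\<^sup>+s. \<integral>\<^sup>+\<xi>. (if t < s then 0 else ennreal (drift_bound (t - s) (jump (s, \<xi>) z))) \<partial>std_gaussian \<partial>hold)"
    unfolding drift_bound_def by (subst nn_integral_clock) (auto cong: if_cong)
  also have "\<dots> = (\<integral>\<^sup>+s. (if t < s then 0 else ennreal (w s)) \<partial>hold)"
  proof (rule nn_integral_cong)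
    fix s
    show "(\<integral>\<^sup>+\<xi>. (if t < s then 0 else ennreal (drift_bound (t - s) (jump (s, \<xi>) z))) \<partial>std_gaussian)
        = (if t < s then 0 else ennreal (w s))"
      using drift_bound_randomization[of "t - s" "\<theta> s z"] by (simp add: jump_def w_def)
  qed
  also have "\<dots> = (\<integral>\<^sup>+s. ennreal (exponential_density (1 / lam) s) * (if t < s then 0 else ennreal (w s)) \<partial>lborel)"
    unfolding w_def by (rule nn_integral_density) measurable
  also have "\<dots> \<le> (\<integral>\<^sup>+s. ennreal (d s) * indicator {0..t} s \<partial>lborel)"
  proof (rule nn_integral_mono)
    fix s
    show "ennreal (exponential_density (1 / lam) s) * (if t < s then 0 else ennreal (w s)) \<le> ennreal (d s) * indicator {0..t} s"
    proof (cases "0 \<le> s \<and> s \<le> t")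
      case True
      then have "ennreal (exponential_density (1 / lam) s) * ennreal (w s) = ennreal (exp (- s / lam) * (inverse lam * w s))"
        using w_nonneg lam by (simp add: exponential_density_def ennreal_mult[symmetric] divide_inverse mult_ac)
      also have "\<dots> \<le> ennreal (d s)" by (rule ennreal_leI[OF wd])
      finally show ?thesis using True by simp
    qed (auto simp: exponential_density_def)
  qed
  also have "ennreal (g t) + \<dots> = ennreal (g t) + ennreal (g 0 - g t)" using FTC by simp
  also have "\<dots> = ennreal (g 0)"
    using mono by (subst ennreal_plus[symmetric]) (auto simp: gt)
  also have "g 0 = drift_bound t z" by (simp add: g_def)
  finally show ?thesis by (simp add: add_left_mono)
qed

theorem lyapunov_drift:
  assumes t: "0 \<le> t"
  shows "(\<integral>\<^sup>+y. ennreal (V y) \<partial>law t z) \<le> ennreal (drift_bound t z)"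
proof -
  have "(\<integral>\<^sup>+y. ennreal (V y) \<partial>law t z) = semigroup (\<lambda>y. ennreal (V y)) t z"
    by (rule nn_integral_law[OF t]) measurable
  also have "\<dots> \<le> ennreal (drift_bound t z)"
    by (rule semigroup_least[where u="\<lambda>t z. ennreal (drift_bound t z)", OF drift_bound_supersolution t])
  finally show ?thesis .
qed

end

section \<open>Short-time spreading of positions\<close>

text \<open>Up to a null set, an open neighbourhood of the preimage is a disjoint union of balls (Vitali), and a
  \<open>K\<close>-Lipschitz map sends a ball into a ball of \<open>K\<close> times the radius.\<close>

lemma lipschitz_preimage_volume:
  fixes F :: "'a::euclidean_space \<Rightarrow> 'a"
  assumes F: "K-lipschitz_on UNIV F" and surj: "surj F" and A: "A \<in> sets borel"
  shows "emeasure lborel A \<le> ennreal (K ^ DIM('a)) * emeasure lborel (F -` A)"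
proof -
  have K: "0 \<le> K" by (rule lipschitz_on_nonneg[OF F])
  have Fm: "F \<in> borel_measurable borel"
    by (intro borel_measurable_continuous_onI lipschitz_on_continuous_on[OF F])
  have E: "F -` A \<in> sets borel" using measurable_sets[OF Fm A] by simp
  have bound: "emeasure lborel A \<le> ennreal (K ^ DIM('a)) * (emeasure lborel (F -` A) + ennreal e)" if "0 < e" for e
  proof -
    from outer_regular_lborel_le[OF E that]
    obtain U where U: "open U" "F -` A \<subseteq> U" "emeasure lborel (U - F -` A) \<le> e" by blast
    have Um [measurable]: "U \<in> sets borel" using U(1) by simp
    have fine: "\<exists>i. i \<in> {(x, r). 0 < r \<and> ball x r \<subseteq> U} \<and> x \<in> ball (fst i) (snd i) \<and> snd i < d"
      if "x \<in> U" "0 < d" for x d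
    proof -
      obtain r where r: "0 < r" "ball x r \<subseteq> U" by (rule openE[OF U(1) \<open>x \<in> U\<close>])
      have "ball x (min r (d / 2)) \<subseteq> U" using r(2) by auto
      then show ?thesis using r(1) that(2) by (intro exI[of _ "(x, min r (d / 2))"]) auto
    qed
    obtain C where C: "countable C" "C \<subseteq> {(x, r). 0 < r \<and> ball x r \<subseteq> U}"
      and disj: "pairwise (\<lambda>i j. disjnt (ball (fst i) (snd i)) (ball (fst j) (snd j))) C"
      and negl: "negligible (U - (\<Union>i\<in>C. ball (fst i) (snd i)))"
      by (rule Vitali_covering_theorem_balls[where S=U and K="{(x, r). 0 < r \<and> ball x r \<subseteq> U}" and a=fst and r=snd, OF fine])
    let ?N = "F ` (U - (\<Union>i\<in>C. ball (fst i) (snd i)))"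
    have "negligible ?N"
    proof (rule negligible_locally_Lipschitz_image[OF order_refl negl])
      fix x
      show "\<exists>T B. open T \<and> x \<in> T \<and>
          (\<forall>y\<in>(U - (\<Union>i\<in>C. ball (fst i) (snd i))) \<inter> T. norm (F y - F x) \<le> B * norm (y - x))"
        using lipschitz_onD[OF F] by (intro exI[of _ UNIV] exI[of _ K]) (auto simp: dist_norm)
    qed
    then have N: "?N \<in> null_sets lebesgue" by (simp add: negligible_iff_null_sets)
    define I where "I = to_nat_on C ` C"
    define B where "B n = (if n \<in> I then ball (fst (from_nat_into C n)) (snd (from_nat_into C n)) else {})" for n
    define B' where "B' n = (if n \<in> I then cball (F (fst (from_nat_into C n))) (K * snd (from_nat_into C n)) else {})" for n
    have inC: "from_nat_into C n \<in> C" if "n \<in> I" for n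
      using that C(1) by (auto simp: I_def)
    have C_I: "\<exists>n\<in>I. from_nat_into C n = i" if "i \<in> C" for i
      using that C(1) by (auto simp: I_def)
    have inj: "m = n" if "m \<in> I" "n \<in> I" "from_nat_into C m = from_nat_into C n" for m n
      using that C(1) by (auto simp: I_def)
    have Bd: "disjoint_family B"
      unfolding disjoint_family_on_def
    proof (intro ballI impI)
      fix m n :: nat assume "m \<noteq> n"
      show "B m \<inter> B n = {}"
      proof (cases "m \<in> I \<and> n \<in> I")
        case True
        with \<open>m \<noteq> n\<close> inj have "from_nat_into C m \<noteq> from_nat_into C n" by blast
        with pairwiseD[OF disj inC inC] True show ?thesis by (simp add: B_def disjnt_def)
      qed (auto simp: B_def)
    qed
    have BU: "(\<Union>n. B n) \<subseteq> U"
    proof (rule UN_least)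
      fix n
      show "B n \<subseteq> U"
      proof (cases "n \<in> I")
        case True
        have "from_nat_into C n \<in> {(x, r). 0 < r \<and> ball x r \<subseteq> U}" using C(2) inC[OF True] by (rule subsetD)
        then show ?thesis using True by (simp add: B_def case_prod_beta)
      qed (simp add: B_def)
    qed
    have BB': "emeasure lborel (B' n) = ennreal (K ^ DIM('a)) * emeasure lborel (B n)" for n
    proof (cases "n \<in> I")
      case True
      have "from_nat_into C n \<in> {(x, r). 0 < r \<and> ball x r \<subseteq> U}" using C(2) inC[OF True] by (rule subsetD)
      then have "0 < snd (from_nat_into C n)" by (simp add: case_prod_beta)
      then show ?thesis
        using True K by (simp add: B_def B'_def emeasure_cball emeasure_ball power_mult_distrib ennreal_mult[symmetric] mult_ac)
    qed (simp add: B_def B'_def)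
    have "A \<subseteq> (\<Union>n. B' n) \<union> ?N"
    proof
      fix y assume y: "y \<in> A"
      obtain x where x: "y = F x" using surj by blast
      then have xU: "x \<in> U" using y U(2) by auto
      show "y \<in> (\<Union>n. B' n) \<union> ?N"
      proof (cases "x \<in> (\<Union>i\<in>C. ball (fst i) (snd i))")
        case True
        then obtain n where n: "n \<in> I" "x \<in> ball (fst (from_nat_into C n)) (snd (from_nat_into C n))"
          using C_I by fastforce
        have "dist (F (fst (from_nat_into C n))) (F x) \<le> K * dist (fst (from_nat_into C n)) x"
          by (rule lipschitz_onD[OF F]) auto
        also have "\<dots> \<le> K * snd (from_nat_into C n)" using n(2) K by (intro mult_left_mono) auto
        finally have "y \<in> B' n" using n(1) by (simp add: B'_def x)
        then show ?thesis by blast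
      qed (use x xU in blast)
    qed
    moreover have B'm: "range B' \<subseteq> sets lborel" by (auto simp: B'_def)
    moreover have Bm: "range B \<subseteq> sets lborel" by (auto simp: B_def)
    ultimately have "emeasure lebesgue A \<le> emeasure lebesgue ((\<Union>n. B' n) \<union> ?N)"
      using N by (intro emeasure_mono) (auto intro!: sets.Un sets.countable_UN)
    also have "\<dots> = emeasure lebesgue (\<Union>n. B' n)"
      by (rule emeasure_Un_null_set) (use B'm N in \<open>auto intro!: sets.countable_UN\<close>)
    finally have "emeasure lborel A \<le> emeasure lborel (\<Union>n. B' n)"
      using A B'm by (simp add: sets.countable_UN)
    also have "\<dots> \<le> (\<Sum>n. emeasure lborel (B' n))" by (rule emeasure_subadditive_countably[OF B'm])
    also have "\<dots> = ennreal (K ^ DIM('a)) * (\<Sum>n. emeasure lborel (B n))"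
      unfolding BB' by (rule ennreal_suminf_cmult)
    also have "(\<Sum>n. emeasure lborel (B n)) = emeasure lborel (\<Union>n. B n)"
      by (rule suminf_emeasure[OF Bm Bd])
    also have "\<dots> \<le> emeasure lborel U" using BU by (intro emeasure_mono) auto
    also have "emeasure lborel U = emeasure lborel (F -` A) + emeasure lborel (U - F -` A)"
      using U(2) E by (subst plus_emeasure) (auto intro!: arg_cong2[where f=emeasure])
    also have "\<dots> \<le> emeasure lborel (F -` A) + e" using U(3) by (intro add_left_mono)
    finally show ?thesis by (simp add: mult_left_mono)
  qed
  show ?thesis
  proof (cases "K = 0")
    case True
    then show ?thesis using bound[of 1] by (simp add: zero_power)
  next
    case False
    show ?thesis
    proof (rule ennreal_le_epsilon)
      fix e :: real assume e: "0 < e"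
      have "emeasure lborel A \<le> ennreal (K ^ DIM('a)) * (emeasure lborel (F -` A) + ennreal (e / K ^ DIM('a)))"
        using e K False by (intro bound) simp
      also have "\<dots> = ennreal (K ^ DIM('a)) * emeasure lborel (F -` A) + ennreal e"
        using e K False by (simp add: distrib_left ennreal_mult[symmetric])
      finally show "emeasure lborel A \<le> ennreal (K ^ DIM('a)) * emeasure lborel (F -` A) + ennreal e" .
    qed
  qed
qed

lemma lipschitz_change_of_variables:
  fixes F :: "'a::euclidean_space \<Rightarrow> 'a"
  assumes F: "K-lipschitz_on UNIV F" and surj: "surj F" and [measurable]: "h \<in> borel_measurable borel"
  shows "(\<integral>\<^sup>+y. h y \<partial>lborel) \<le> ennreal (K ^ DIM('a)) * (\<integral>\<^sup>+x. h (F x) \<partial>lborel)"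
proof -
  have [measurable]: "F \<in> borel_measurable borel"
    by (intro borel_measurable_continuous_onI lipschitz_on_continuous_on[OF F])
  have "(\<integral>\<^sup>+y. h y \<partial>lborel) \<le> (\<integral>\<^sup>+y. h y \<partial>scale_measure (ennreal (K ^ DIM('a))) (distr lborel borel F))"
  proof (rule nn_integral_mono_measure)
    show "lborel \<le> scale_measure (ennreal (K ^ DIM('a))) (distr lborel borel F)"
      by (subst le_measure) (auto simp: emeasure_distr intro!: lipschitz_preimage_volume[OF F surj])
  qed simp
  also have "\<dots> = ennreal (K ^ DIM('a)) * (\<integral>\<^sup>+x. h (F x) \<partial>lborel)"
    by (simp add: nn_integral_scale_measure nn_integral_distr)
  finally show ?thesis .
qed

context
  fixes F :: "'a::euclidean_space \<Rightarrow> 'a" and L G :: real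
  assumes F: "L-lipschitz_on UNIV F" and G: "\<And>q. norm (F q) \<le> G"
begin

lemma nflow_components:
  "((\<lambda>u. fst (nflow F u z)) has_vector_derivative snd (nflow F t z)) (at t)"
  "((\<lambda>u. snd (nflow F u z)) has_vector_derivative F (fst (nflow F t z))) (at t)"
  using has_vector_derivative_fst_snd[OF nflow_deriv[OF F, of z t]] by (auto simp: newton_def)

lemma nflow_momentum_bound:
  assumes "0 \<le> u"
  shows "norm (snd (nflow F u (q, p)) - p) \<le> G * u"
  using increment_bound[OF assms nflow_components(2)[of "(q, p)"], of G] G by (simp add: nflow_0[OF F])

lemma nflow_position_bound:
  assumes "0 \<le> u"
  shows "norm (fst (nflow F u (q, p)) - (q + u *\<^sub>R p)) \<le> G * u * u"
proof -
  have G0: "0 \<le> G" using G[of 0] norm_ge_zero order_trans by blast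
  have "norm ((fst (nflow F u (q, p)) - u *\<^sub>R p) - (fst (nflow F 0 (q, p)) - 0 *\<^sub>R p)) \<le> (G * u) * u"
  proof (rule increment_bound[OF assms])
    show "((\<lambda>v. fst (nflow F v (q, p)) - v *\<^sub>R p) has_vector_derivative (snd (nflow F v (q, p)) - p)) (at v)" for v
      by (auto intro!: derivative_eq_intros nflow_components)
    show "norm (snd (nflow F v (q, p)) - p) \<le> G * u" if v: "0 \<le> v" "v \<le> u" for v
      using nflow_momentum_bound[OF v(1), of q p] mult_left_mono[OF v(2) G0] by linarith
  qed
  then show ?thesis by (simp add: nflow_0[OF F] algebra_simps)
qed

text \<open>For short times the position at time \<open>s\<close> is a small Lipschitz perturbation of the affine map
  \<open>p \<mapsto> q + s p\<close> of the initial momentum.\<close>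

lemma nflow_position_almost_affine:
  assumes s: "0 \<le> s" and sL: "s\<^sup>2 * L \<le> 1 / 4"
  shows "norm (fst (nflow F s (q, p)) - fst (nflow F s (q, p')) - s *\<^sub>R (p - p')) \<le> s / 2 * norm (p - p')"
proof -
  have L: "0 \<le> L" by (rule lipschitz_on_nonneg[OF F])
  define d where "d u = fst (nflow F u (q, p)) - fst (nflow F u (q, p'))" for u
  define m where "m u = snd (nflow F u (q, p)) - snd (nflow F u (q, p'))" for u
  have d: "(d has_vector_derivative m u) (at u)" for u
    unfolding d_def m_def by (intro has_vector_derivative_diff nflow_components)
  have m: "(m has_vector_derivative (F (fst (nflow F u (q, p))) - F (fst (nflow F u (q, p'))))) (at u)" for u
    unfolding m_def by (intro has_vector_derivative_diff nflow_components)
  have d0: "d 0 = 0" and m0: "m 0 = p - p'" by (simp_all add: d_def m_def nflow_0[OF F])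
  have "continuous_on {0..s} (\<lambda>u. norm (d u))"
    by (intro continuous_on_norm continuous_at_imp_continuous_on ballI has_vector_derivative_continuous[OF d])
  then obtain u0 where u0: "0 \<le> u0" "u0 \<le> s" and max: "\<And>u. \<lbrakk>0 \<le> u; u \<le> s\<rbrakk> \<Longrightarrow> norm (d u) \<le> norm (d u0)"
    using continuous_attains_sup[of "{0..s}" "\<lambda>u. norm (d u)"] s by auto
  have mb: "norm (m u - m 0) \<le> L * norm (d u0) * s" if u: "0 \<le> u" "u \<le> s" for u
  proof -
    have "norm (m u - m 0) \<le> L * norm (d u0) * u"
    proof (rule increment_bound[OF u(1) m])
      fix v assume v: "0 \<le> v" "v \<le> u"
      have "norm (F (fst (nflow F v (q, p))) - F (fst (nflow F v (q, p')))) \<le> L * norm (d v)"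
        using lipschitz_onD[OF F, of "fst (nflow F v (q, p))" "fst (nflow F v (q, p'))"]
        by (simp add: dist_norm d_def)
      also have "\<dots> \<le> L * norm (d u0)" using v u L by (intro mult_left_mono max) auto
      finally show "norm (F (fst (nflow F v (q, p))) - F (fst (nflow F v (q, p')))) \<le> L * norm (d u0)" .
    qed
    also have "\<dots> \<le> L * norm (d u0) * s" using u L by (intro mult_left_mono) auto
    finally show ?thesis .
  qed
  have db: "norm (d u - u *\<^sub>R (p - p')) \<le> norm (d u0) / 4" if u: "0 \<le> u" "u \<le> s" for u
  proof -
    have "norm ((d u - u *\<^sub>R m 0) - (d 0 - 0 *\<^sub>R m 0)) \<le> (L * norm (d u0) * s) * u"
    proof (rule increment_bound[OF u(1)])
      show "((\<lambda>v. d v - v *\<^sub>R m 0) has_vector_derivative (m v - m 0)) (at v)" for v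
        by (auto intro!: derivative_eq_intros d)
      show "norm (m v - m 0) \<le> L * norm (d u0) * s" if "0 \<le> v" "v \<le> u" for v
        using mb[of v] that u by auto
    qed
    also have "\<dots> \<le> (L * norm (d u0) * s) * s" using u L s by (intro mult_left_mono) auto
    also have "\<dots> = (s\<^sup>2 * L) * norm (d u0)" by (simp add: power2_eq_square mult_ac)
    also have "\<dots> \<le> 1 / 4 * norm (d u0)" by (intro mult_right_mono sL) auto
    finally show ?thesis by (simp add: d0 m0)
  qed
  have "norm (d u0) \<le> norm (d u0 - u0 *\<^sub>R (p - p')) + norm (u0 *\<^sub>R (p - p'))"
    using norm_triangle_ineq[of "d u0 - u0 *\<^sub>R (p - p')" "u0 *\<^sub>R (p - p')"] by simp
  also have "\<dots> \<le> norm (d u0) / 4 + s * norm (p - p')"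
    using db[OF u0] u0 by (intro add_mono) (auto intro!: mult_right_mono)
  finally have "norm (d u0) / 4 \<le> s / 3 * norm (p - p')" by simp
  also have "\<dots> \<le> s / 2 * norm (p - p')" using s by (intro mult_right_mono) auto
  finally show ?thesis using db[OF s order_refl] by (simp add: d_def)
qed

lemma nflow_position_lipschitz:
  assumes s: "0 \<le> s" and sL: "s\<^sup>2 * L \<le> 1 / 4"
  shows "(2 * s)-lipschitz_on UNIV (\<lambda>p. fst (nflow F s (q, p)))"
proof (rule lipschitz_onI)
  fix p p'
  have "norm (fst (nflow F s (q, p)) - fst (nflow F s (q, p')))
      \<le> norm (fst (nflow F s (q, p)) - fst (nflow F s (q, p')) - s *\<^sub>R (p - p')) + norm (s *\<^sub>R (p - p'))"
    using norm_triangle_ineq[of "fst (nflow F s (q, p)) - fst (nflow F s (q, p')) - s *\<^sub>R (p - p')" "s *\<^sub>R (p - p')"]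
    by simp
  also have "\<dots> \<le> s / 2 * norm (p - p') + s * norm (p - p')"
    using nflow_position_almost_affine[OF s sL, of q p p'] s by (intro add_mono) auto
  also have "\<dots> \<le> 2 * s * norm (p - p')"
  proof -
    have "0 \<le> s * norm (p - p')" using s by simp
    then show ?thesis by simp
  qed
  finally show "dist (fst (nflow F s (q, p))) (fst (nflow F s (q, p'))) \<le> 2 * s * dist p p'"
    by (simp add: dist_norm)
qed (use s in simp)

text \<open>\<open>X p = y\<close> is solved by iterating \<open>p \<mapsto> p + (y - X p) / s\<close>, a contraction by the previous estimate.\<close>

lemma nflow_position_surj:
  assumes s: "0 < s" and sL: "s\<^sup>2 * L \<le> 1 / 4"
  shows "surj (\<lambda>p. fst (nflow F s (q, p)))"
  unfolding surj_def
proof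
  fix y
  let ?X = "\<lambda>p. fst (nflow F s (q, p))"
  let ?T = "\<lambda>p. p + (y - ?X p) /\<^sub>R s"
  have "dist (?T p) (?T p') \<le> 1 / 2 * dist p p'" for p p'
  proof -
    have "?T p - ?T p' = - ((?X p - ?X p' - s *\<^sub>R (p - p')) /\<^sub>R s)"
      using s by (simp add: algebra_simps)
    then have "norm (?T p - ?T p') = norm (?X p - ?X p' - s *\<^sub>R (p - p')) / s"
      using s by (simp only: norm_minus_cancel norm_scaleR) (simp add: divide_inverse)
    also have "\<dots> \<le> (s / 2 * norm (p - p')) / s"
      using nflow_position_almost_affine[of s q p p'] s sL by (intro divide_right_mono) auto
    also have "\<dots> = 1 / 2 * norm (p - p')" using s by simp
    finally show ?thesis by (simp only: dist_norm)
  qed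
  then have "\<exists>!p. ?T p = p" by (intro banach_fix_type[where c="1/2"]) auto
  then obtain p where "?T p = p" by blast
  then show "\<exists>p. y = ?X p" using s by auto
qed

lemma nflow_position_inverse_bound:
  assumes s: "0 < s" and sL: "s\<^sup>2 * L \<le> 1 / 4"
  shows "norm p \<le> 2 / s * (norm (fst (nflow F s (q, p)) - q) + G * s * s)"
proof -
  let ?X = "\<lambda>p. fst (nflow F s (q, p))"
  have 1: "norm (?X p - ?X 0 - s *\<^sub>R p) \<le> s / 2 * norm p"
    using nflow_position_almost_affine[of s q p 0] s sL by simp
  have 2: "norm (?X 0 - q) \<le> G * s * s"
    using nflow_position_bound[of s q 0] s by simp
  have "s * norm p = norm (s *\<^sub>R p)" using s by simp
  also have "s *\<^sub>R p = (?X p - q) - (?X 0 - q) - (?X p - ?X 0 - s *\<^sub>R p)" by simp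
  also have "norm \<dots> \<le> norm (?X p - q) + norm (?X 0 - q) + norm (?X p - ?X 0 - s *\<^sub>R p)"
    using norm_triangle_ineq4[of "(?X p - q) - (?X 0 - q)" "?X p - ?X 0 - s *\<^sub>R p"]
      norm_triangle_ineq4[of "?X p - q" "?X 0 - q"] by linarith
  finally have "s / 2 * norm p \<le> norm (?X p - q) + G * s * s" using 1 2 by simp
  then show ?thesis using s by (simp add: field_simps)
qed

end

text \<open>On a ball the density of \<open>c + s \<xi>\<close> is at least its value at the largest possible distance from \<open>c\<close>.\<close>

lemma gaussian_lower_bound:
  assumes s: "0 < s"
  obtains \<kappa> :: real where "0 < \<kappa>"
    "\<And>(c :: 'a::euclidean_space) g. \<lbrakk>norm c \<le> r; g \<in> borel_measurable borel\<rbrakk> \<Longrightarrow>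
       ennreal \<kappa> * (\<integral>\<^sup>+p. g p * indicator (cball 0 \<rho>) p \<partial>lborel) \<le> (\<integral>\<^sup>+\<xi>. ennreal (gauss \<xi>) * g (c + s *\<^sub>R \<xi>) \<partial>lborel)"
proof -
  define \<kappa> where "\<kappa> = (2 * pi) powr (- real DIM('a) / 2) * exp (- ((\<rho> + r) / s)\<^sup>2 / 2) / s ^ DIM('a)"
  have pos: "0 < \<kappa>" using s by (simp add: \<kappa>_def)
  have [measurable]: "cball 0 \<rho> \<in> sets (borel :: 'a measure)" by simp
  have main: "ennreal \<kappa> * (\<integral>\<^sup>+p. g p * indicator (cball 0 \<rho>) p \<partial>lborel) \<le> (\<integral>\<^sup>+\<xi>. ennreal (gauss \<xi>) * g (c + s *\<^sub>R \<xi>) \<partial>lborel)"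
    if c: "norm c \<le> r" and [measurable]: "g \<in> borel_measurable borel" for c :: 'a and g
  proof -
    have "(\<integral>\<^sup>+p. g p * indicator (cball 0 \<rho>) p \<partial>lborel)
        = (\<integral>\<^sup>+p. g p * indicator (cball 0 \<rho>) p \<partial>density (distr lborel borel (\<lambda>x. c + s *\<^sub>R x)) (\<lambda>_. ennreal (\<bar>s\<bar> ^ DIM('a))))"
      using lborel_affine[of s c] s by simp
    also have "\<dots> = (\<integral>\<^sup>+p. ennreal (\<bar>s\<bar> ^ DIM('a)) * (g p * indicator (cball 0 \<rho>) p) \<partial>distr lborel borel (\<lambda>x. c + s *\<^sub>R x))"
      by (rule nn_integral_density) measurable
    also have "\<dots> = (\<integral>\<^sup>+\<xi>. ennreal (s ^ DIM('a)) * (g (c + s *\<^sub>R \<xi>) * indicator (cball 0 \<rho>) (c + s *\<^sub>R \<xi>)) \<partial>lborel)"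
      by (subst nn_integral_distr, measurable) (use s in simp)
    finally have "ennreal \<kappa> * (\<integral>\<^sup>+p. g p * indicator (cball 0 \<rho>) p \<partial>lborel)
        = (\<integral>\<^sup>+\<xi>. ennreal \<kappa> * (ennreal (s ^ DIM('a)) * (g (c + s *\<^sub>R \<xi>) * indicator (cball 0 \<rho>) (c + s *\<^sub>R \<xi>))) \<partial>lborel)"
      by (subst nn_integral_cmult) measurable
    also have "\<dots> \<le> (\<integral>\<^sup>+\<xi>. ennreal (gauss \<xi>) * g (c + s *\<^sub>R \<xi>) \<partial>lborel)"
    proof (rule nn_integral_mono)
      fix \<xi> :: 'a
      show "ennreal \<kappa> * (ennreal (s ^ DIM('a)) * (g (c + s *\<^sub>R \<xi>) * indicator (cball 0 \<rho>) (c + s *\<^sub>R \<xi>)))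
          \<le> ennreal (gauss \<xi>) * g (c + s *\<^sub>R \<xi>)"
      proof (cases "c + s *\<^sub>R \<xi> \<in> cball 0 \<rho>")
        case True
        have "s * norm \<xi> = norm ((c + s *\<^sub>R \<xi>) - c)" using s by simp
        also have "\<dots> \<le> \<rho> + r" using norm_triangle_ineq4[of "c + s *\<^sub>R \<xi>" c] True c by simp
        finally have "norm \<xi> \<le> (\<rho> + r) / s" using s by (simp add: field_simps)
        then have "(norm \<xi>)\<^sup>2 \<le> ((\<rho> + r) / s)\<^sup>2" by (intro power_mono) auto
        then have "\<kappa> * s ^ DIM('a) \<le> gauss \<xi>"
          using s by (simp add: \<kappa>_def gauss_def)
        then have "ennreal \<kappa> * ennreal (s ^ DIM('a)) \<le> ennreal (gauss \<xi>)"
          using pos s by (subst ennreal_mult[symmetric]) (auto intro: ennreal_leI)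
        then show ?thesis using True by (simp add: mult.assoc[symmetric] mult_right_mono)
      qed simp
    qed
    finally show ?thesis .
  qed
  show ?thesis using that[OF pos main] by blast
qed

section \<open>Minorization on sublevel sets\<close>

context rhmc_lyapunov begin

lemma sublevel_bounded:
  obtains r where "\<And>z. V z \<le> R \<Longrightarrow> norm z \<le> r"
proof -
  define r where "r = sqrt (6 * \<bar>R\<bar> / \<gamma>2) + sqrt (8 * \<bar>R\<bar>) + 1"
  have "norm z \<le> r" if z: "V z \<le> R" for z
  proof -
    have *: "(norm (snd z))\<^sup>2 / 8 + \<gamma>2 * (norm (fst z))\<^sup>2 / 6 \<le> \<bar>R\<bar>"
      using V_lower[of z] nonneg[of "fst z"] z by linarith
    have pos: "0 \<le> \<gamma>2 * (norm (fst z))\<^sup>2 / 6" using gamma2_pos by simp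
    have "(norm (snd z))\<^sup>2 \<le> 8 * \<bar>R\<bar>" using * pos by linarith
    then have p: "norm (snd z) \<le> sqrt (8 * \<bar>R\<bar>)" by (rule real_le_rsqrt)
    have "\<gamma>2 * (norm (fst z))\<^sup>2 / 6 \<le> \<bar>R\<bar>" using * zero_le_power2[of "norm (snd z)"] by linarith
    then have "(norm (fst z))\<^sup>2 \<le> 6 * \<bar>R\<bar> / \<gamma>2"
      using gamma2_pos by (simp add: field_simps)
    then have q: "norm (fst z) \<le> sqrt (6 * \<bar>R\<bar> / \<gamma>2)" by (rule real_le_rsqrt)
    show ?thesis using norm_Pair_le[of "fst z" "snd z"] p q by (simp add: r_def)
  qed
  then show ?thesis by (rule that)
qed

lemma flow_bounded_on_cball:
  obtains r' where "0 \<le> r'" "\<And>s z. \<lbrakk>0 \<le> s; s \<le> 1; norm z \<le> r\<rbrakk> \<Longrightarrow> norm (\<theta> s z) \<le> r'"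
proof -
  have "compact ((\<lambda>(t, z). \<theta> t z) ` ({0..1} \<times> cball 0 r))"
    by (intro compact_continuous_image continuous_on_subset[OF continuous_flow] compact_Times) auto
  from compact_imp_bounded[OF this] obtain B where
    B: "\<forall>w\<in>(\<lambda>(t, z). \<theta> t z) ` ({0..1} \<times> cball 0 r). norm w \<le> B"
    unfolding bounded_iff ..
  have "norm (\<theta> s z) \<le> max 0 B" if "0 \<le> s" "s \<le> 1" "norm z \<le> r" for s z
  proof -
    have "(\<lambda>(t, z). \<theta> t z) (s, z) \<in> (\<lambda>(t, z). \<theta> t z) ` ({0..1} \<times> cball 0 r)"
      using that by (intro imageI) simp
    with B have "norm ((\<lambda>(t, z). \<theta> t z) (s, z)) \<le> B" by (rule bspec)
    then show ?thesis by simp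
  qed
  then show ?thesis by (rule that[of "max 0 B", rotated]) auto
qed

text \<open>Momentum refreshment, a short stretch of flow, and a second refreshment.  The first refreshment
  spreads the position over a unit ball, uniformly in the starting point, because the short-time flow
  is a bi-Lipschitz map of the momentum; the second one spreads the momentum.\<close>

lemma two_refreshments_lower_bound:
  assumes r1: "0 \<le> r1"
  obtains \<sigma> \<kappa> :: real where "0 < \<sigma>" "\<sigma> \<le> 1" "0 < \<kappa>"
    "\<And>s w g. \<lbrakk>\<sigma> / 2 \<le> s; s \<le> \<sigma>; norm w \<le> r1; g \<in> borel_measurable borel\<rbrakk> \<Longrightarrow>
      ennreal \<kappa> * (\<integral>\<^sup>+y. g y * indicator (cball 0 1 \<times> cball 0 1) y \<partial>lborel)
      \<le> (\<integral>\<^sup>+\<xi>1. \<integral>\<^sup>+\<xi>2. g (momentum_randomization \<phi> \<xi>2 (\<theta> s (momentum_randomization \<phi> \<xi>1 w)))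
            \<partial>std_gaussian \<partial>std_gaussian)"
proof -
  \<comment> \<open>Targets lie in the unit ball and starting points in the ball of radius \<open>r1\<close>; hence the momenta involved
    satisfy \<open>s \<bar>p\<bar> \<le> 2 (2 + r1)\<close>, and the trajectories do not leave the ball of radius
    \<open>r1 + 2 (2 + r1) + 1\<close> before time \<open>s\<close>.\<close>
  define Rc where "Rc = 3 * r1 + 5"
  have Rc: "0 \<le> Rc" using r1 by (simp add: Rc_def)
  let ?F = "cutoff force Rc"
  from cutoff_force_lipschitz[OF Rc] obtain L where L: "L-lipschitz_on UNIV ?F" ..
  have L0: "0 \<le> L" by (rule lipschitz_on_nonneg[OF L])
  have "compact (force ` cball 0 Rc)"
    by (intro compact_continuous_image continuous_on_subset[OF continuous_force]) auto
  from compact_imp_bounded[OF this] obtain G where "\<And>q. q \<in> cball 0 Rc \<Longrightarrow> norm (force q) \<le> G"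
    unfolding bounded_iff by fast
  then have G: "norm (?F q) \<le> G" for q
    using Rc by (intro cutoff_bounded) auto
  have G0: "0 \<le> G" using G[of 0] norm_ge_zero order_trans by blast
  define \<sigma> where "\<sigma> = 1 / (4 * (L + G + 1))"
  have \<sigma>: "0 < \<sigma>" "\<sigma> \<le> 1" using L0 G0 by (auto simp: \<sigma>_def field_simps)
  have \<sigma>L: "\<sigma> * L \<le> 1 / 4" and \<sigma>G: "\<sigma> * G \<le> 1 / 4"
    using L0 G0 by (auto simp: \<sigma>_def field_simps)
  \<comment> \<open>bound for the momenta that reach the unit ball at some time \<open>s \<ge> \<sigma> / 2\<close>\<close>
  define \<rho> where "\<rho> = 4 / \<sigma> * (2 + r1)"
  obtain \<kappa>1 where \<kappa>1: "0 < \<kappa>1" and low1: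
    "\<And>(c :: real ^ 'n) g. \<lbrakk>norm c \<le> r1; g \<in> borel_measurable borel\<rbrakk> \<Longrightarrow>
       ennreal \<kappa>1 * (\<integral>\<^sup>+p. g p * indicator (cball 0 \<rho>) p \<partial>lborel) \<le> (\<integral>\<^sup>+\<xi>. ennreal (gauss \<xi>) * g (c + sin \<phi> *\<^sub>R \<xi>) \<partial>lborel)"
    by (rule gaussian_lower_bound[OF sin_phi_pos, of r1 \<rho>], rule that)
  obtain \<kappa>2 where \<kappa>2: "0 < \<kappa>2" and low2:
    "\<And>(c :: real ^ 'n) g. \<lbrakk>norm c \<le> \<rho> + G; g \<in> borel_measurable borel\<rbrakk> \<Longrightarrow>
       ennreal \<kappa>2 * (\<integral>\<^sup>+p. g p * indicator (cball 0 1) p \<partial>lborel) \<le> (\<integral>\<^sup>+\<xi>. ennreal (gauss \<xi>) * g (c + sin \<phi> *\<^sub>R \<xi>) \<partial>lborel)"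
    by (rule gaussian_lower_bound[OF sin_phi_pos, of "\<rho> + G" 1], rule that)
  define d where "d = DIM(real ^ 'n)"
  define \<kappa> where "\<kappa> = \<kappa>1 * \<kappa>2 / 2 ^ d"
  have \<kappa>: "0 < \<kappa>" using \<kappa>1 \<kappa>2 by (simp add: \<kappa>_def)
  have main: "ennreal \<kappa> * (\<integral>\<^sup>+y. g y * indicator (cball 0 1 \<times> cball 0 1) y \<partial>lborel)
      \<le> (\<integral>\<^sup>+\<xi>1. \<integral>\<^sup>+\<xi>2. g (momentum_randomization \<phi> \<xi>2 (\<theta> s (momentum_randomization \<phi> \<xi>1 w)))
            \<partial>std_gaussian \<partial>std_gaussian)"
    if s: "\<sigma> / 2 \<le> s" "s \<le> \<sigma>" and w: "norm w \<le> r1" and g [measurable]: "g \<in> borel_measurable borel" for s w and g :: "'n phase \<Rightarrow> ennreal"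
  proof -
    obtain q1 p1 where w_eq: "w = (q1, p1)" by (cases w)
    have q1: "norm q1 \<le> r1" and p1: "norm p1 \<le> r1"
      using norm_fst_snd_le[of w] w by (auto simp: w_eq)
    have s0: "0 < s" "s \<le> 1" using s \<sigma> by auto
    have sL: "s\<^sup>2 * L \<le> 1 / 4"
    proof -
      have "s\<^sup>2 * L = s * (s * L)" by (simp add: power2_eq_square)
      also have "\<dots> \<le> 1 * (\<sigma> * L)" using s s0 L0 by (intro mult_mono) (auto intro: mult_right_mono)
      finally show ?thesis using \<sigma>L by simp
    qed
    have sG: "s * G \<le> 1 / 4" using \<sigma>G mult_right_mono[OF s(2) G0] by linarith
    have sGs: "G * u * u \<le> 1" if u: "0 \<le> u" "u \<le> s" for u
    proof -
      have "G * u * u \<le> G * s * 1" using u s0 G0 by (intro mult_mono) (auto intro: mult_left_mono)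
      then show ?thesis using sG by (simp add: mult.commute)
    qed
    define X where "X p = fst (nflow ?F s (q1, p))" for p
    have Xlip: "(2 * s)-lipschitz_on UNIV X"
      unfolding X_def using s0 sL by (intro nflow_position_lipschitz[OF L G]) auto
    have Xsurj: "surj X" unfolding X_def by (rule nflow_position_surj[OF L G s0(1) sL])
    have [measurable]: "X \<in> borel_measurable borel"
      by (intro borel_measurable_continuous_onI lipschitz_on_continuous_on[OF Xlip])
    have reached: "norm p \<le> \<rho>" "\<theta> s (q1, p) = nflow ?F s (q1, p)" "norm (snd (\<theta> s (q1, p))) \<le> \<rho> + G"
      if X1: "norm (X p) \<le> 1" for p
    proof -
      have "norm p \<le> 2 / s * (norm (X p - q1) + G * s * s)"
        unfolding X_def by (rule nflow_position_inverse_bound[OF L G s0(1) sL])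
      also have "\<dots> \<le> 2 / s * (2 + r1)"
      proof (rule mult_left_mono)
        have "norm (X p - q1) \<le> 1 + r1" using norm_triangle_ineq4[of "X p" q1] X1 q1 by linarith
        then show "norm (X p - q1) + G * s * s \<le> 2 + r1" using sGs[of s] s0 by linarith
      qed (use s0 in simp)
      finally have pb: "norm p \<le> 2 / s * (2 + r1)" .
      then have spb: "s * norm p \<le> 2 * (2 + r1)" using s0 by (simp add: field_simps)
      have "2 / s \<le> 4 / \<sigma>" using s \<sigma> s0 by (simp add: field_simps)
      then have "2 / s * (2 + r1) \<le> \<rho>" unfolding \<rho>_def using r1 by (intro mult_right_mono) auto
      with pb show p\<rho>: "norm p \<le> \<rho>" by linarith
      have ball: "norm (fst (nflow ?F u (q1, p))) \<le> Rc" if u: "0 \<le> u" "u \<le> s" for u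
      proof -
        have "norm (fst (nflow ?F u (q1, p))) \<le> norm (fst (nflow ?F u (q1, p)) - (q1 + u *\<^sub>R p)) + norm (q1 + u *\<^sub>R p)"
          using norm_triangle_ineq[of "fst (nflow ?F u (q1, p)) - (q1 + u *\<^sub>R p)" "q1 + u *\<^sub>R p"] by simp
        also have "\<dots> \<le> G * u * u + (norm q1 + u * norm p)"
          using nflow_position_bound[OF L G u(1), of q1 p] norm_triangle_ineq[of q1 "u *\<^sub>R p"] u by simp
        also have "u * norm p \<le> s * norm p" using u by (intro mult_right_mono) auto
        finally show ?thesis using sGs[OF u] q1 spb by (simp add: Rc_def)
      qed
      have "(\<lambda>t. nflow ?F t (q1, p)) s = (\<lambda>t. \<theta> t (q1, p)) s"
      proof (rule newton_force_unique_forward[where x="\<lambda>t. nflow ?F t (q1, p)" and y="\<lambda>t. \<theta> t (q1, p)"])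
        show "((\<lambda>t. nflow ?F t (q1, p)) has_vector_derivative newton force (nflow ?F u (q1, p))) (at u)"
          if "0 \<le> u" "u \<le> s" for u
          using nflow_deriv[OF L, of "(q1, p)" u] newton_cutoff_eq[OF ball[OF that]] by simp
        show "nflow ?F 0 (q1, p) = \<theta> 0 (q1, p)" by (simp add: nflow_0[OF L])
      qed (use s0 flow_deriv in auto)
      then show eq: "\<theta> s (q1, p) = nflow ?F s (q1, p)" by simp
      have "norm (snd (\<theta> s (q1, p))) \<le> norm (snd (nflow ?F s (q1, p)) - p) + norm p"
        using norm_triangle_ineq[of "snd (nflow ?F s (q1, p)) - p" p] by (simp add: eq)
      also have "\<dots> \<le> G * s + \<rho>" using nflow_momentum_bound[OF L G, of s q1 p] s0 p\<rho> by (intro add_mono) auto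
      also have "\<dots> \<le> \<rho> + G" using mult_left_mono[OF s0(2) G0] by simp
      finally show "norm (snd (\<theta> s (q1, p))) \<le> \<rho> + G" .
    qed
    define inner where "inner z = (\<integral>\<^sup>+\<xi>2. g (momentum_randomization \<phi> \<xi>2 z) \<partial>std_gaussian)" for z
    have inner_m [measurable]: "inner \<in> borel_measurable borel"
      unfolding inner_def
      by (rule measurable_nn_integral_borel[OF prob_space_std_gaussian sets_std_gaussian]) measurable
    define h where "h x = (\<integral>\<^sup>+p. g (x, p) * indicator (cball 0 1) p \<partial>lborel) * indicator (cball 0 1) x" for x
    have [measurable]: "cball 0 c \<in> sets (borel :: (real ^ 'n) measure)" for c by simp
    have gpair: "(\<lambda>y. g y * indicator (cball 0 1 \<times> cball 0 1) y) \<in> borel_measurable (borel \<Otimes>\<^sub>M borel)"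
    proof -
      have "(\<lambda>y. g y * indicator (cball 0 1 \<times> cball 0 1) y) \<in> borel_measurable borel"
        by (intro borel_measurable_times_ennreal g borel_measurable_indicator) (simp add: closed_Times)
      then show ?thesis unfolding borel_prod .
    qed
    have hint: "(\<lambda>x. \<integral>\<^sup>+p. g (x, p) * indicator (cball 0 1 \<times> cball 0 1) (x, p) \<partial>lborel) \<in> borel_measurable borel"
      using lborel.borel_measurable_nn_integral_fst[of "\<lambda>y. g y * indicator (cball 0 1 \<times> cball 0 1) y" borel] gpair
      by (simp cong: measurable_cong_sets sets_pair_measure_cong)
    have h_eq: "h x = (\<integral>\<^sup>+p. g (x, p) * indicator (cball 0 1 \<times> cball 0 1) (x, p) \<partial>lborel)" for x
      unfolding h_def
      by (subst nn_integral_multc[symmetric]) (auto simp: indicator_times mult_ac intro!: nn_integral_cong)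
    have h_m [measurable]: "h \<in> borel_measurable borel" unfolding h_eq[abs_def] by (rule hint)
    have h_total: "(\<integral>\<^sup>+x. h x \<partial>lborel) = (\<integral>\<^sup>+y. g y * indicator (cball 0 1 \<times> cball 0 1) y \<partial>lborel)"
    proof -
      have "(\<integral>\<^sup>+x. h x \<partial>lborel) = (\<integral>\<^sup>+y. g y * indicator (cball 0 1 \<times> cball 0 1) y \<partial>(lborel \<Otimes>\<^sub>M lborel))"
        unfolding h_eq using gpair
        by (intro lborel.nn_integral_fst) (simp cong: measurable_cong_sets sets_pair_measure_cong)
      then show ?thesis unfolding lborel_prod .
    qed
    \<comment> \<open>the second refreshment, for those intermediate momenta that lead into the unit ball\<close>
    have step2: "ennreal \<kappa>2 * h (X p) \<le> inner (\<theta> s (q1, p)) * indicator (cball 0 \<rho>) p" for p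
    proof (cases "norm (X p) \<le> 1")
      case True
      note r = reached[OF True]
      have fst: "fst (\<theta> s (q1, p)) = X p" by (simp add: r(2) X_def)
      have c: "norm (cos \<phi> *\<^sub>R snd (\<theta> s (q1, p))) \<le> \<rho> + G"
        using r(3) cos_phi mult_right_mono[of "cos \<phi>" 1 "norm (snd (\<theta> s (q1, p)))"] by simp
      have "ennreal \<kappa>2 * h (X p) = ennreal \<kappa>2 * (\<integral>\<^sup>+p'. g (X p, p') * indicator (cball 0 1) p' \<partial>lborel)"
        using True by (simp add: h_def)
      also have "\<dots> \<le> (\<integral>\<^sup>+\<xi>. ennreal (gauss \<xi>) * g (X p, cos \<phi> *\<^sub>R snd (\<theta> s (q1, p)) + sin \<phi> *\<^sub>R \<xi>) \<partial>lborel)"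
        by (rule low2[OF c, of "\<lambda>p'. g (X p, p')"]) measurable
      also have "\<dots> = inner (\<theta> s (q1, p))"
        unfolding inner_def by (subst nn_integral_std_gaussian) (auto simp: momentum_randomization_def fst)
      finally show ?thesis using r(1) by simp
    qed (simp add: h_def)
    have "ennreal \<kappa> * (\<integral>\<^sup>+x. h x \<partial>lborel) \<le> ennreal \<kappa> * (ennreal ((2 * s) ^ d) * (\<integral>\<^sup>+p. h (X p) \<partial>lborel))"
      unfolding d_def by (intro mult_left_mono lipschitz_change_of_variables[OF Xlip Xsurj h_m]) auto
    also have "\<dots> \<le> ennreal \<kappa> * (ennreal (2 ^ d) * (\<integral>\<^sup>+p. h (X p) \<partial>lborel))"
      using s0 by (intro mult_left_mono mult_right_mono ennreal_leI power_mono) auto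
    also have "\<dots> = ennreal \<kappa>1 * (ennreal \<kappa>2 * (\<integral>\<^sup>+p. h (X p) \<partial>lborel))"
      using \<kappa>1 \<kappa>2 by (simp add: \<kappa>_def mult.assoc[symmetric] flip: ennreal_mult)
    also have "ennreal \<kappa>2 * (\<integral>\<^sup>+p. h (X p) \<partial>lborel) = (\<integral>\<^sup>+p. ennreal \<kappa>2 * h (X p) \<partial>lborel)"
      by (rule nn_integral_cmult[symmetric]) measurable
    also have "ennreal \<kappa>1 * \<dots> \<le> ennreal \<kappa>1 * (\<integral>\<^sup>+p. inner (\<theta> s (q1, p)) * indicator (cball 0 \<rho>) p \<partial>lborel)"
      by (intro mult_left_mono nn_integral_mono step2) auto
    also have "\<dots> \<le> (\<integral>\<^sup>+\<xi>. ennreal (gauss \<xi>) * inner (\<theta> s (q1, cos \<phi> *\<^sub>R p1 + sin \<phi> *\<^sub>R \<xi>)) \<partial>lborel)"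
    proof (rule low1[of _ "\<lambda>p. inner (\<theta> s (q1, p))"])
      show "norm (cos \<phi> *\<^sub>R p1) \<le> r1"
        using p1 cos_phi mult_right_mono[of "cos \<phi>" 1 "norm p1"] by simp
    qed measurable
    also have "\<dots> = (\<integral>\<^sup>+\<xi>1. inner (\<theta> s (momentum_randomization \<phi> \<xi>1 w)) \<partial>std_gaussian)"
      by (subst nn_integral_std_gaussian) (auto simp: momentum_randomization_def w_eq)
    finally show ?thesis unfolding inner_def h_total .
  qed
  show ?thesis by (rule that[OF \<sigma> \<kappa> main])
qed

text \<open>The next three bounds keep, in the renewal equation, only the event that there is no jump, or that the
  first jump falls into a given set of times, or that in addition no second jump follows.\<close>

lemma semigroup_ge_no_jump:
  assumes [measurable]: "f \<in> borel_measurable borel" and u: "0 \<le> u"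
  shows "ennreal (exp (- u / lam)) * f (\<theta> u z) \<le> semigroup f u z"
proof -
  have "ennreal (exp (- u / lam)) * f (\<theta> u z) = (\<integral>\<^sup>+x. (if u < fst x then f (\<theta> u z) else 0) \<partial>clock_noise)"
    by (rule nn_integral_clock_gt[OF u, symmetric])
  also have "\<dots> \<le> semigroup f u z"
    by (subst semigroup_renewal) (auto intro!: nn_integral_mono)
  finally show ?thesis .
qed

lemma semigroup_ge_one_jump:
  assumes [measurable]: "f \<in> borel_measurable borel" and "B \<subseteq> {..u}" and [measurable]: "B \<in> sets borel"
  shows "(\<integral>\<^sup>+x. indicator B (fst x) * semigroup f (u - fst x) (jump x z) \<partial>clock_noise) \<le> semigroup f u z"
  by (subst (2) semigroup_renewal) (use assms(2) in \<open>auto intro!: nn_integral_mono split: split_indicator\<close>)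

lemma semigroup_ge_delayed_jump:
  assumes [measurable]: "f \<in> borel_measurable borel" and x: "0 \<le> x" and y: "y \<le> u" and u: "u \<le> \<tau>"
  shows "ennreal (exp (- \<tau> / lam)) * (\<integral>\<^sup>+s. indicator {x..y} s *
      (\<integral>\<^sup>+\<xi>. f (\<theta> (u - s) (jump (s, \<xi>) w)) \<partial>std_gaussian) \<partial>hold) \<le> semigroup f u w"
proof -
  have "(\<lambda>s. \<integral>\<^sup>+\<xi>. f (\<theta> (u - s) (jump (s, \<xi>) w)) \<partial>std_gaussian) \<in> borel_measurable borel"
    by (rule measurable_nn_integral_borel[OF prob_space_std_gaussian sets_std_gaussian]) measurable
  then have "ennreal (exp (- \<tau> / lam)) * (\<integral>\<^sup>+s. indicator {x..y} s * (\<integral>\<^sup>+\<xi>. f (\<theta> (u - s) (jump (s, \<xi>) w)) \<partial>std_gaussian) \<partial>hold)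
      = (\<integral>\<^sup>+s. \<integral>\<^sup>+\<xi>. indicator {x..y} s * (ennreal (exp (- \<tau> / lam)) * f (\<theta> (u - s) (jump (s, \<xi>) w))) \<partial>std_gaussian \<partial>hold)"
    by (subst nn_integral_cmult[symmetric]) (auto simp: nn_integral_cmult mult_ac intro!: nn_integral_cong)
  also have "\<dots> = (\<integral>\<^sup>+v. indicator {x..y} (fst v) * (ennreal (exp (- \<tau> / lam)) * f (\<theta> (u - fst v) (jump v w))) \<partial>clock_noise)"
    by (subst nn_integral_clock) auto
  also have "\<dots> \<le> (\<integral>\<^sup>+v. indicator {x..y} (fst v) * semigroup f (u - fst v) (jump v w) \<partial>clock_noise)"
  proof (rule nn_integral_mono)
    fix v :: "real \<times> (real ^ 'n)"
    show "indicator {x..y} (fst v) * (ennreal (exp (- \<tau> / lam)) * f (\<theta> (u - fst v) (jump v w)))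
        \<le> indicator {x..y} (fst v) * semigroup f (u - fst v) (jump v w)"
    proof (cases "fst v \<in> {x..y}")
      case True
      then have le: "0 \<le> u - fst v" "u - fst v \<le> \<tau>" using x y u by auto
      have "ennreal (exp (- \<tau> / lam)) * f (\<theta> (u - fst v) (jump v w))
          \<le> ennreal (exp (- (u - fst v) / lam)) * f (\<theta> (u - fst v) (jump v w))"
        using le lam by (intro mult_right_mono ennreal_leI) (auto simp: field_simps)
      also have "\<dots> \<le> semigroup f (u - fst v) (jump v w)"
        using le by (intro semigroup_ge_no_jump) auto
      finally show ?thesis using True by simp
    qed simp
  qed
  also have "\<dots> \<le> semigroup f u w"
    using y by (intro semigroup_ge_one_jump) auto
  finally show ?thesis .
qed

lemma hold_interval_pos:
  assumes "0 \<le> x" "x < y"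
  shows "0 < emeasure hold {x..y}"
proof -
  have "ennreal (exp (- x / lam)) = emeasure hold {x<..}" using assms by (simp add: hold_gt)
  also have "\<dots> \<le> emeasure hold ({x..y} \<union> {y<..})" by (intro emeasure_mono) auto
  also have "\<dots> \<le> emeasure hold {x..y} + emeasure hold {y<..}" by (rule emeasure_subadditive) auto
  also have "emeasure hold {y<..} = ennreal (exp (- y / lam))" using assms by (simp add: hold_gt)
  finally have *: "ennreal (exp (- x / lam)) \<le> emeasure hold {x..y} + ennreal (exp (- y / lam))" .
  show ?thesis
  proof (rule ccontr)
    assume "\<not> 0 < emeasure hold {x..y}"
    then have "ennreal (exp (- x / lam)) \<le> ennreal (exp (- y / lam))" using * by simp
    then have "exp (- x / lam) \<le> exp (- y / lam)" by (subst (asm) ennreal_le_iff) auto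
    then show False using assms lam by (simp add: divide_le_cancel)
  qed
qed

lemma flow_stays_near_origin:
  obtains e where "0 < e" "\<And>u y. \<lbrakk>\<bar>u\<bar> \<le> e; norm y \<le> e\<rbrakk> \<Longrightarrow> \<theta> u y \<in> cball 0 1 \<times> cball 0 1"
proof -
  have "isCont (\<lambda>(t, z). \<theta> t z) (0, 0)"
    using continuous_flow unfolding continuous_on_eq_continuous_at[OF open_UNIV] by blast
  from this[unfolded continuous_at_eps_delta, rule_format, OF zero_less_one]
  obtain d where d: "0 < d"
    and near: "\<forall>v. dist v (0, 0) < d \<longrightarrow> dist (case v of (t, z) \<Rightarrow> \<theta> t z) (case (0, 0) of (t, z) \<Rightarrow> \<theta> t z) < 1"
    by (elim exE conjE) (rule that)
  show ?thesis
  proof (rule that[of "d / 4"])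
    fix u :: real and y :: "'n phase" assume "\<bar>u\<bar> \<le> d / 4" "norm y \<le> d / 4"
    then have "dist (u, y) (0, 0) < d"
      using norm_Pair_le[of u y] d by (simp add: dist_norm)
    from near[rule_format, OF this] show "\<theta> u y \<in> cball 0 1 \<times> cball 0 1"
      using flow_0[of 0] norm_fst_snd_le[of "\<theta> u y"] by (simp add: mem_Times_iff)
  qed (use d in simp)
qed

text \<open>The bound comes from the trajectories with exactly two jumps up to time \<open>\<tau> = \<sigma> + \<eta>\<close>, the first before \<open>\<eta>\<close>
  and the second after a holding time between \<open>\<sigma> - \<eta>\<close> and \<open>\<sigma>\<close>.  Given the holding times, the law after the second
  jump dominates a multiple of Lebesgue measure on a product of unit balls.  The remaining flow lasts at most
  \<open>2 \<eta>\<close>; it preserves volume and, run backwards, keeps a small ball within that product.\<close>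

theorem minorization:
  "\<exists>\<tau>>0. \<exists>\<nu>. sets \<nu> = sets borel \<and> 0 < emeasure \<nu> UNIV \<and>
     (\<forall>z. V z \<le> R \<longrightarrow> (\<forall>f\<in>borel_measurable borel. (\<integral>\<^sup>+y. f y \<partial>\<nu>) \<le> (\<integral>\<^sup>+y. f y \<partial>law \<tau> z)))"
proof -
  obtain r where r: "\<And>z. V z \<le> R \<Longrightarrow> norm z \<le> r" by (rule sublevel_bounded, rule that)
  obtain r1 where r1: "0 \<le> r1"
    "\<And>s z. \<lbrakk>0 \<le> s; s \<le> 1; norm z \<le> r\<rbrakk> \<Longrightarrow> norm (\<theta> s z) \<le> r1" by (rule flow_bounded_on_cball, rule that)
  let ?Q = "cball 0 1 \<times> cball 0 1 :: 'n phase set"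
  obtain \<sigma> \<kappa> where \<sigma>: "0 < \<sigma>" "\<sigma> \<le> 1" and \<kappa>: "0 < \<kappa>"
    and low: "\<And>s w g. \<lbrakk>\<sigma> / 2 \<le> s; s \<le> \<sigma>; norm w \<le> r1; g \<in> borel_measurable borel\<rbrakk> \<Longrightarrow>
      ennreal \<kappa> * (\<integral>\<^sup>+y. g y * indicator ?Q y \<partial>lborel)
      \<le> (\<integral>\<^sup>+\<xi>1. \<integral>\<^sup>+\<xi>2. g (momentum_randomization \<phi> \<xi>2 (\<theta> s (momentum_randomization \<phi> \<xi>1 w)))
            \<partial>std_gaussian \<partial>std_gaussian)"
    by (rule two_refreshments_lower_bound[OF r1(1)], rule that)
  obtain e where e: "0 < e" and stay: "\<And>u y. \<lbrakk>\<bar>u\<bar> \<le> e; norm y \<le> e\<rbrakk> \<Longrightarrow> \<theta> u y \<in> ?Q"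
    by (rule flow_stays_near_origin, rule that)
  define \<eta> where "\<eta> = min (\<sigma> / 2) (e / 2)"
  have \<eta>: "0 < \<eta>" "\<eta> \<le> \<sigma> / 2" "2 * \<eta> \<le> e" using \<sigma> e by (auto simp: \<eta>_def)
  define \<tau> where "\<tau> = \<sigma> + \<eta>"
  have \<tau>: "0 < \<tau>" using \<sigma> \<eta> by (simp add: \<tau>_def)
  define \<epsilon> where "\<epsilon> = exp (- \<tau> / lam)"
  have [measurable]: "cball 0 e \<in> sets (borel :: 'n phase measure)" by simp
  define k where "k = emeasure hold {0..\<eta>} * (ennreal \<epsilon> * (emeasure hold {\<sigma> - \<eta>..\<sigma>} * ennreal \<kappa>))"
  define \<nu> :: "'n phase measure" where "\<nu> = density lborel (\<lambda>y. k * indicator (cball 0 e) y)"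
  have int_\<nu>: "(\<integral>\<^sup>+y. f y \<partial>\<nu>) = k * (\<integral>\<^sup>+y. f y * indicator (cball 0 e) y \<partial>lborel)"
    if [measurable]: "f \<in> borel_measurable borel" for f
    unfolding \<nu>_def by (subst nn_integral_density) (auto simp: nn_integral_cmult[symmetric] mult_ac)
  have "sets \<nu> = sets borel" by (simp add: \<nu>_def)
  moreover have "0 < emeasure \<nu> UNIV"
  proof -
    have "emeasure \<nu> UNIV = k * emeasure lborel (cball 0 e :: 'n phase set)"
      using int_\<nu>[of "\<lambda>_. 1"] by (simp add: \<nu>_def)
    also have "0 < \<dots>"
      using hold_interval_pos[of 0 \<eta>] hold_interval_pos[of "\<sigma> - \<eta>" \<sigma>] \<sigma> \<eta> \<kappa> e
      by (simp add: k_def \<epsilon>_def ennreal_zero_less_mult_iff emeasure_cball unit_ball_vol_pos)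
    finally show ?thesis .
  qed
  moreover have "(\<integral>\<^sup>+y. f y \<partial>\<nu>) \<le> (\<integral>\<^sup>+y. f y \<partial>law \<tau> z)"
    if z: "V z \<le> R" and f [measurable]: "f \<in> borel_measurable borel" for z f
  proof -
    let ?J = "\<lambda>s1 \<xi>1 s2 \<xi>2. f (\<theta> (\<tau> - s1 - s2) (jump (s2, \<xi>2) (jump (s1, \<xi>1) z)))"
    interpret GH: pair_sigma_finite "std_gaussian :: (real ^ 'n) measure" hold ..
    have Jm [measurable]: "(\<lambda>v. \<integral>\<^sup>+\<xi>2. ?J (fst v) (fst (snd v)) (snd (snd v)) \<xi>2 \<partial>std_gaussian) \<in> borel_measurable borel"
      by (rule measurable_nn_integral_borel[OF prob_space_std_gaussian sets_std_gaussian]) measurable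
    have J2 [measurable]: "(\<lambda>v. \<integral>\<^sup>+\<xi>2. ?J s1 (fst v) (snd v) \<xi>2 \<partial>std_gaussian) \<in> borel_measurable borel" for s1
      using measurable_compose[OF _ Jm, of "\<lambda>v. (s1, v)" borel] by simp
    let ?m = "\<integral>\<^sup>+y. f y * indicator (cball 0 e) y \<partial>lborel"
    have lowJ: "ennreal \<kappa> * ?m \<le> (\<integral>\<^sup>+\<xi>1. \<integral>\<^sup>+\<xi>2. ?J s1 \<xi>1 s2 \<xi>2 \<partial>std_gaussian \<partial>std_gaussian)"
      if s1: "s1 \<in> {0..\<eta>}" and s2: "s2 \<in> {\<sigma> - \<eta>..\<sigma>}" for s1 s2
    proof -
      let ?u = "\<tau> - s1 - s2"
      have "?m = (\<integral>\<^sup>+y. f y * indicator (cball 0 e) y \<partial>distr lborel borel (\<theta> ?u))" by (simp only: liouville)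
      also have "\<dots> = (\<integral>\<^sup>+y. f (\<theta> ?u y) * indicator (cball 0 e) (\<theta> ?u y) \<partial>lborel)"
        by (rule nn_integral_distr) measurable
      also have "\<dots> \<le> (\<integral>\<^sup>+y. f (\<theta> ?u y) * indicator ?Q y \<partial>lborel)"
      proof (rule nn_integral_mono)
        fix y
        have u: "\<bar>- ?u\<bar> \<le> e" using s1 s2 \<eta> by (simp add: \<tau>_def)
        have "y \<in> ?Q" if "\<theta> ?u y \<in> cball 0 e"
          using stay[OF u, of "\<theta> ?u y", unfolded flow_inverse] that by simp
        then show "f (\<theta> ?u y) * indicator (cball 0 e) (\<theta> ?u y) \<le> f (\<theta> ?u y) * indicator ?Q y"
          by (auto split: split_indicator)
      qed
      finally have "ennreal \<kappa> * ?m \<le> ennreal \<kappa> * (\<integral>\<^sup>+y. f (\<theta> ?u y) * indicator ?Q y \<partial>lborel)"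
        by (rule mult_left_mono) simp
      also have "\<dots> \<le> (\<integral>\<^sup>+\<xi>1. \<integral>\<^sup>+\<xi>2. ?J s1 \<xi>1 s2 \<xi>2 \<partial>std_gaussian \<partial>std_gaussian)"
      proof -
        have "norm (\<theta> s1 z) \<le> r1" using s1 \<eta> \<sigma> r[OF z] by (intro r1(2)) auto
        from low[OF _ _ this, of s2 "\<lambda>y. f (\<theta> ?u y)"] show ?thesis
          using s2 \<eta> by (simp add: jump_def)
      qed
      finally show ?thesis .
    qed
    have "(\<integral>\<^sup>+y. f y \<partial>\<nu>) = (\<integral>\<^sup>+s1. indicator {0..\<eta>} s1 * (ennreal \<epsilon> *
        (\<integral>\<^sup>+s2. indicator {\<sigma> - \<eta>..\<sigma>} s2 * (ennreal \<kappa> * ?m) \<partial>hold)) \<partial>hold)"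
      by (simp add: int_\<nu>[OF f] k_def nn_integral_multc mult.assoc)
    also have "\<dots> \<le> (\<integral>\<^sup>+s1. \<integral>\<^sup>+\<xi>1. indicator {0..\<eta>} s1 * semigroup f (\<tau> - s1) (jump (s1, \<xi>1) z) \<partial>std_gaussian \<partial>hold)"
    proof (rule nn_integral_mono)
      fix s1 :: real
      let ?k = "\<lambda>\<xi>1 s2. \<integral>\<^sup>+\<xi>2. ?J s1 \<xi>1 s2 \<xi>2 \<partial>std_gaussian"
      let ?I = "\<lambda>s2. indicator {\<sigma> - \<eta>..\<sigma>} s2 :: ennreal"
      have km: "(\<lambda>s2. ?k \<xi>1 s2) \<in> borel_measurable borel" "(\<lambda>\<xi>1. ?k \<xi>1 s2) \<in> borel_measurable borel" for \<xi>1 s2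
        using measurable_compose[OF _ J2, of "\<lambda>s2. (\<xi>1, s2)" borel s1]
          measurable_compose[OF _ J2, of "\<lambda>\<xi>1. (\<xi>1, s2)" borel s1] by simp_all
      have kp: "(\<lambda>(\<xi>1, s2). ?I s2 * ?k \<xi>1 s2) \<in> borel_measurable (std_gaussian \<Otimes>\<^sub>M hold)"
      proof -
        have "(\<lambda>v. ?I (snd v) * ?k (fst v) (snd v)) \<in> borel_measurable (borel :: ((real ^ 'n) \<times> real) measure)"
          by measurable
        then show ?thesis
          unfolding borel_prod[symmetric] by (simp add: case_prod_beta' cong: measurable_cong_sets sets_pair_measure_cong)
      qed
      have cm: "(\<lambda>\<xi>1. \<integral>\<^sup>+s2. ?I s2 * ?k \<xi>1 s2 \<partial>hold) \<in> borel_measurable std_gaussian"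
        using hold.borel_measurable_nn_integral_fst[OF kp] by simp
      have "(\<integral>\<^sup>+s2. ?I s2 * (\<integral>\<^sup>+\<xi>1. ?k \<xi>1 s2 \<partial>std_gaussian) \<partial>hold)
          = (\<integral>\<^sup>+s2. \<integral>\<^sup>+\<xi>1. ?I s2 * ?k \<xi>1 s2 \<partial>std_gaussian \<partial>hold)"
        using km by (intro nn_integral_cong nn_integral_cmult[symmetric]) (simp cong: measurable_cong_sets)
      also have "\<dots> = (\<integral>\<^sup>+\<xi>1. \<integral>\<^sup>+s2. ?I s2 * ?k \<xi>1 s2 \<partial>hold \<partial>std_gaussian)"
        by (rule GH.Fubini'[OF kp])
      finally have swap: "(\<integral>\<^sup>+s2. ?I s2 * (\<integral>\<^sup>+\<xi>1. ?k \<xi>1 s2 \<partial>std_gaussian) \<partial>hold)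
          = (\<integral>\<^sup>+\<xi>1. \<integral>\<^sup>+s2. ?I s2 * ?k \<xi>1 s2 \<partial>hold \<partial>std_gaussian)" .
      show "indicator {0..\<eta>} s1 * (ennreal \<epsilon> * (\<integral>\<^sup>+s2. ?I s2 * (ennreal \<kappa> * ?m) \<partial>hold))
          \<le> (\<integral>\<^sup>+\<xi>1. indicator {0..\<eta>} s1 * semigroup f (\<tau> - s1) (jump (s1, \<xi>1) z) \<partial>std_gaussian)"
      proof (cases "s1 \<in> {0..\<eta>}")
        case True
        have "(\<integral>\<^sup>+s2. ?I s2 * (ennreal \<kappa> * ?m) \<partial>hold) \<le> (\<integral>\<^sup>+s2. ?I s2 * (\<integral>\<^sup>+\<xi>1. ?k \<xi>1 s2 \<partial>std_gaussian) \<partial>hold)"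
          using lowJ[OF True] by (intro nn_integral_mono) (auto split: split_indicator)
        then have "ennreal \<epsilon> * (\<integral>\<^sup>+s2. ?I s2 * (ennreal \<kappa> * ?m) \<partial>hold)
            \<le> ennreal \<epsilon> * (\<integral>\<^sup>+\<xi>1. \<integral>\<^sup>+s2. ?I s2 * ?k \<xi>1 s2 \<partial>hold \<partial>std_gaussian)"
          unfolding swap by (rule mult_left_mono) simp
        also have "\<dots> = (\<integral>\<^sup>+\<xi>1. ennreal \<epsilon> * (\<integral>\<^sup>+s2. ?I s2 * ?k \<xi>1 s2 \<partial>hold) \<partial>std_gaussian)"
          by (rule nn_integral_cmult[OF cm, symmetric])
        also have "\<dots> \<le> (\<integral>\<^sup>+\<xi>1. semigroup f (\<tau> - s1) (jump (s1, \<xi>1) z) \<partial>std_gaussian)"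
          using True \<sigma> \<eta> unfolding \<epsilon>_def
          by (intro nn_integral_mono semigroup_ge_delayed_jump) (auto simp: \<tau>_def)
        finally show ?thesis using True by simp
      qed simp
    qed
    also have "\<dots> = (\<integral>\<^sup>+x. indicator {0..\<eta>} (fst x) * semigroup f (\<tau> - fst x) (jump x z) \<partial>clock_noise)"
      by (subst nn_integral_clock) auto
    also have "\<dots> \<le> semigroup f \<tau> z"
      using \<sigma> \<eta> by (intro semigroup_ge_one_jump) (auto simp: \<tau>_def)
    also have "\<dots> = (\<integral>\<^sup>+y. f y \<partial>law \<tau> z)" using \<tau> by (intro nn_integral_law[symmetric]) auto
    finally show ?thesis .
  qed
  ultimately show ?thesis using \<tau> by blast
qed

end

section \<open>Harris' theorem and convergence\<close>

text \<open>Both \<open>h - f\<close> and \<open>h + f\<close> are nonnegative, so their integrals are at least those with respect to \<open>\<nu>\<close>; in the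
  sum of the latter \<open>f\<close> cancels.\<close>

lemma difference_le_of_common_minorant:
  fixes f h :: "'a \<Rightarrow> real"
  assumes "prob_space M" "prob_space M'" and [measurable_cong]: "sets M' = sets M" "sets \<nu> = sets M"
    and min: "\<And>g. g \<in> borel_measurable M \<Longrightarrow> (\<integral>\<^sup>+x. g x \<partial>\<nu>) \<le> (\<integral>\<^sup>+x. g x \<partial>M)"
      "\<And>g. g \<in> borel_measurable M \<Longrightarrow> (\<integral>\<^sup>+x. g x \<partial>\<nu>) \<le> (\<integral>\<^sup>+x. g x \<partial>M')"
    and int: "integrable M f" "integrable M' f" "integrable M h" "integrable M' h"
    and fh: "\<And>x. \<bar>f x\<bar> \<le> h x" and dh: "\<And>x. d \<le> h x" and d: "0 \<le> d"
    and e: "0 \<le> e" "ennreal e \<le> emeasure \<nu> (space \<nu>)"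
  shows "(LINT x|M. f x) - (LINT x|M'. f x) \<le> (LINT x|M. h x) + (LINT x|M'. h x) - 2 * d * e"
proof -
  have [measurable]: "f \<in> borel_measurable M" "h \<in> borel_measurable M" using int by auto
  have nn: "0 \<le> h x - f x" "0 \<le> h x + f x" for x using fh[of x] by auto
  have 1: "(\<integral>\<^sup>+x. ennreal (h x - f x) \<partial>M) = ennreal ((LINT x|M. h x) - (LINT x|M. f x))"
    using int nn by (subst nn_integral_eq_integral) auto
  have 2: "(\<integral>\<^sup>+x. ennreal (h x + f x) \<partial>M') = ennreal ((LINT x|M'. h x) + (LINT x|M'. f x))"
    using int nn by (subst nn_integral_eq_integral) auto
  have p1: "0 \<le> (LINT x|M. h x) - (LINT x|M. f x)"
    using int nn(1) integral_nonneg_AE[where M=M and f="\<lambda>x. h x - f x"] by simp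
  have p2: "0 \<le> (LINT x|M'. h x) + (LINT x|M'. f x)"
    using int nn(2) integral_nonneg_AE[where M=M' and f="\<lambda>x. h x + f x"] by simp
  have "ennreal (2 * d * e) = ennreal (2 * d) * ennreal e" using d by (simp add: ennreal_mult')
  also have "\<dots> \<le> ennreal (2 * d) * emeasure \<nu> (space \<nu>)" by (intro mult_left_mono e) auto
  also have "\<dots> = (\<integral>\<^sup>+x. ennreal (2 * d) \<partial>\<nu>)" by simp
  also have "\<dots> \<le> (\<integral>\<^sup>+x. ennreal (h x - f x) + ennreal (h x + f x) \<partial>\<nu>)"
  proof (rule nn_integral_mono)
    fix x
    have "ennreal (2 * d) \<le> ennreal ((h x - f x) + (h x + f x))" using dh[of x] by (intro ennreal_leI) simp
    then show "ennreal (2 * d) \<le> ennreal (h x - f x) + ennreal (h x + f x)"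
      using nn[of x] by (simp only: ennreal_plus)
  qed
  also have "\<dots> = (\<integral>\<^sup>+x. ennreal (h x - f x) \<partial>\<nu>) + (\<integral>\<^sup>+x. ennreal (h x + f x) \<partial>\<nu>)"
    by (rule nn_integral_add) measurable
  also have "\<dots> \<le> (\<integral>\<^sup>+x. ennreal (h x - f x) \<partial>M) + (\<integral>\<^sup>+x. ennreal (h x + f x) \<partial>M')"
    by (intro add_mono min) measurable
  also have "\<dots> = ennreal (((LINT x|M. h x) - (LINT x|M. f x)) + ((LINT x|M'. h x) + (LINT x|M'. f x)))"
    unfolding 1 2 using p1 p2 by (rule ennreal_plus[symmetric])
  finally have "2 * d * e \<le> ((LINT x|M. h x) - (LINT x|M. f x)) + ((LINT x|M'. h x) + (LINT x|M'. f x))"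
    using p1 p2 by (subst (asm) ennreal_le_iff) auto
  then show ?thesis by simp
qed

text \<open>A bound on the oscillation of \<open>f\<close> becomes a bound on \<open>f\<close> itself after subtracting a constant.\<close>

lemma oscillation_recentering:
  fixes f w :: "'a \<Rightarrow> real"
  assumes osc: "\<And>x y. f x - f y \<le> w x + w y"
  obtains c where "\<And>x. \<bar>f x - c\<bar> \<le> w x"
proof -
  have bdd: "bdd_above (range (\<lambda>x. f x - w x))"
    using osc[of _ undefined] by (intro bdd_aboveI[of _ "f undefined + w undefined"]) (auto simp: algebra_simps)
  define c where "c = (SUP x. f x - w x)"
  have "f x - w x \<le> c" for x unfolding c_def by (rule cSUP_upper[OF _ bdd]) simp
  moreover have "c \<le> f y + w y" for y
    unfolding c_def using osc[of _ y] by (intro cSUP_least) (auto simp: algebra_simps)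
  ultimately have "\<bar>f x - c\<bar> \<le> w x" for x
    using abs_le_iff[of "f x - c" "w x"] by (simp add: algebra_simps) 
  then show ?thesis by (rule that)
qed

text \<open>Harris' theorem in the form of Hairer and Mattingly.  If one of the two starting points lies high, the
  drift lowers the weight by a definite factor; if both lie in the sublevel set, the common part \<open>\<nu>\<close> cancels
  in the difference.  The weight \<open>\<beta>\<close> is taken so small that the second gain absorbs the drift constant.\<close>

theorem harris_contraction:
  fixes P :: "'a::topological_space \<Rightarrow> 'a measure" and V :: "'a \<Rightarrow> real"
  assumes P: "\<And>x. prob_space (P x)" "\<And>x. sets (P x) = sets borel"
    and V: "V \<in> borel_measurable borel" "\<And>x. 0 \<le> V x"
    and drift: "\<And>x. (\<integral>\<^sup>+y. ennreal (V y) \<partial>P x) \<le> ennreal (\<gamma> * V x + K)"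
    and \<gamma>: "0 \<le> \<gamma>" "\<gamma> < 1" and K: "0 \<le> K" and R: "2 * K < (1 - \<gamma>) * R"
    and \<nu>: "sets \<nu> = sets borel" "0 < emeasure \<nu> UNIV"
    and min: "\<And>x g. \<lbrakk>V x \<le> R; g \<in> borel_measurable borel\<rbrakk> \<Longrightarrow> (\<integral>\<^sup>+y. g y \<partial>\<nu>) \<le> (\<integral>\<^sup>+y. g y \<partial>P x)"
  obtains \<alpha> \<beta> :: real where "0 < \<alpha>" "\<alpha> < 1" "0 < \<beta>"
    "\<And>(f :: 'a \<Rightarrow> real) d x y. \<lbrakk>f \<in> borel_measurable borel; \<And>x. \<bar>f x\<bar> \<le> 1; 0 \<le> d;
        \<And>x y. \<bar>f x - f y\<bar> \<le> d * (2 + \<beta> * V x + \<beta> * V y)\<rbrakk>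
      \<Longrightarrow> \<bar>(LINT u|P x. f u) - (LINT u|P y. f u)\<bar> \<le> \<alpha> * d * (2 + \<beta> * V x + \<beta> * V y)"
proof -
  note [measurable_cong] = P(2) \<nu>(1)
  note [measurable] = V(1)
  have sp\<nu>: "space \<nu> = UNIV" using sets_eq_imp_space_eq[OF \<nu>(1)] by simp
  obtain e where e: "0 < e" "e \<le> 1" "ennreal e \<le> emeasure \<nu> UNIV"
  proof (cases "emeasure \<nu> UNIV")
    case (real r)
    then have "0 < r" using \<nu>(2) by simp
    then show ?thesis using that[of "min r 1"] real by (auto intro!: ennreal_leI)
  next
    case top
    then show ?thesis using that[of 1] by simp
  qed
  define \<beta> where "\<beta> = e / (2 * (K + 1))"
  have \<beta>: "0 < \<beta>" using e K by (simp add: \<beta>_def)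
  have \<beta>K: "2 * \<beta> * K \<le> e"
    using e K by (simp add: \<beta>_def field_simps)
  have R0: "0 < R" using R K \<gamma> by (smt (verit) mult_nonneg_nonpos)
  \<comment> \<open>the contraction factor that the drift provides at \<open>V x + V y = R\<close>\<close>
  define \<alpha>0 where "\<alpha>0 = (2 + 2 * \<beta> * K + \<beta> * \<gamma> * R) / (2 + \<beta> * R)"
  have den: "0 < 2 + \<beta> * R" using \<beta> R0 by (simp add: add_pos_pos)
  have \<alpha>0: "\<alpha>0 < 1"
  proof -
    have "\<beta> * (2 * K) < \<beta> * ((1 - \<gamma>) * R)" using \<beta> R by (intro mult_strict_left_mono)
    then show ?thesis using den by (simp add: \<alpha>0_def field_simps)
  qed
  define \<alpha> where "\<alpha> = max \<alpha>0 (max \<gamma> (1 - e / 2))"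
  have \<alpha>: "0 < \<alpha>" "\<alpha> < 1" "\<alpha>0 \<le> \<alpha>" "\<gamma> \<le> \<alpha>" "1 - e / 2 \<le> \<alpha>"
    using e \<gamma> \<alpha>0 by (auto simp: \<alpha>_def)
  have one_sided: "(LINT u|P x. f u) - (LINT u|P y. f u) \<le> \<alpha> * d * (2 + \<beta> * V x + \<beta> * V y)"
    if f [measurable]: "f \<in> borel_measurable borel" and f1: "\<And>x. \<bar>f x\<bar> \<le> 1" and d: "0 \<le> d"
      and osc: "\<And>x y. \<bar>f x - f y\<bar> \<le> d * (2 + \<beta> * V x + \<beta> * V y)" for f :: "'a \<Rightarrow> real" and d x y
  proof -
    define h where "h x = d * (1 + \<beta> * V x)" for x
    have "f x - f y \<le> h x + h y" for x y using osc[of x y] by (simp add: h_def algebra_simps)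
    then obtain c where c: "\<And>x. \<bar>f x - c\<bar> \<le> h x" using oscillation_recentering by blast
    have dh: "d \<le> h x" for x using d \<beta> V(2)[of x] by (simp add: h_def algebra_simps)
    have Vint: "integrable (P x) V" and Vle: "(LINT u|P x. V u) \<le> \<gamma> * V x + K" for x
    proof -
      show i: "integrable (P x) V"
        by (rule integrableI_nonneg) (use V drift[of x] in \<open>auto simp: order_le_less_trans\<close>)
      have "ennreal (LINT u|P x. V u) \<le> ennreal (\<gamma> * V x + K)"
        using nn_integral_eq_integral[OF i] V(2) drift[of x] by simp
      then show "(LINT u|P x. V u) \<le> \<gamma> * V x + K"
        using \<gamma> K V(2)[of x] by (subst (asm) ennreal_le_iff) auto
    qed
    have fint: "integrable (P x) f" for x
    proof -
      interpret prob_space "P x" by (rule P)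
      show ?thesis using f1 by (intro integrable_const_bound[of _ 1]) auto
    qed
    have const: "integrable (P x) (\<lambda>_. k)" "(LINT u|P x. k) = k" for x and k :: real
    proof -
      interpret prob_space "P x" by (rule P)
      show "integrable (P x) (\<lambda>_. k)" "(LINT u|P x. k) = k" using prob_space by auto
    qed
    have hint: "integrable (P x) h" for x
      unfolding h_def using Vint const by (intro integrable_mult_right Bochner_Integration.integrable_add) auto
    have hle: "(LINT u|P x. h u) \<le> d * (1 + \<beta> * (\<gamma> * V x + K))" for x
    proof -
      have "(LINT u|P x. h u) = d * (1 + \<beta> * (LINT u|P x. V u))"
        unfolding h_def integral_mult_right_zero
        using Vint const by (subst Bochner_Integration.integral_add) auto
      also have "\<dots> \<le> d * (1 + \<beta> * (\<gamma> * V x + K))"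
        using d \<beta> Vle by (intro mult_left_mono add_left_mono) auto
      finally show ?thesis .
    qed
    have gint: "integrable (P x) (\<lambda>u. f u - c)" "(LINT u|P x. f u - c) = (LINT u|P x. f u) - c" for x
      using fint const by auto
    define S where "S = V x + V y"
    have S0: "0 \<le> S" using V(2) by (simp add: S_def)
    have hsum: "(LINT u|P x. h u) + (LINT u|P y. h u) \<le> d * (2 + \<beta> * \<gamma> * S + 2 * \<beta> * K)"
      using hle[of x] hle[of y] by (simp add: S_def algebra_simps)
    have "(LINT u|P x. f u) - (LINT u|P y. f u) \<le> \<alpha> * d * (2 + \<beta> * S)"
    proof (cases "S \<le> R")
      case True
      then have xy: "V x \<le> R" "V y \<le> R" using V(2)[of x] V(2)[of y] by (auto simp: S_def)
      have "(LINT u|P x. f u - c) - (LINT u|P y. f u - c) \<le> (LINT u|P x. h u) + (LINT u|P y. h u) - 2 * d * e"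
      proof (rule difference_le_of_common_minorant[where \<nu>=\<nu>])
        show "ennreal e \<le> emeasure \<nu> (space \<nu>)" using e(3) by (simp add: sp\<nu>)
        show "(\<integral>\<^sup>+u. g u \<partial>\<nu>) \<le> (\<integral>\<^sup>+u. g u \<partial>P x)" if "g \<in> borel_measurable (P x)" for g
          using min[OF xy(1)] that by (simp cong: measurable_cong_sets)
        show "(\<integral>\<^sup>+u. g u \<partial>\<nu>) \<le> (\<integral>\<^sup>+u. g u \<partial>P y)" if "g \<in> borel_measurable (P x)" for g
          using min[OF xy(2)] that by (simp cong: measurable_cong_sets)
      qed (use P \<nu> gint hint c dh d e in auto)
      also have "\<dots> \<le> d * (2 + \<beta> * \<gamma> * S + 2 * \<beta> * K) - 2 * d * e" using hsum by simp
      also have "\<dots> \<le> d * (2 - e + \<beta> * \<gamma> * S)"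
        using mult_left_mono[OF \<beta>K d] by (simp add: algebra_simps)
      also have "\<dots> \<le> d * (\<alpha> * 2 + \<alpha> * (\<beta> * S))"
      proof (intro mult_left_mono add_mono d)
        show "2 - e \<le> \<alpha> * 2" using \<alpha>(5) by simp
        show "\<beta> * \<gamma> * S \<le> \<alpha> * (\<beta> * S)"
          using mult_right_mono[OF \<alpha>(4), of "\<beta> * S"] \<beta> S0 by (simp add: mult_ac)
      qed
      finally show ?thesis by (simp add: gint algebra_simps)
    next
      case False
      have "(LINT u|P x. f u - c) - (LINT u|P y. f u - c) \<le> (LINT u|P x. h u) + (LINT u|P y. h u) - 2 * d * 0"
        by (rule difference_le_of_common_minorant[where \<nu>="null_measure (P x)"])
          (use P gint hint c dh d in auto)
      also have "\<dots> \<le> d * (2 + \<beta> * \<gamma> * S + 2 * \<beta> * K)" using hsum by simp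
      also have "\<dots> \<le> d * (\<alpha> * (2 + \<beta> * S))"
      proof (rule mult_left_mono[OF _ d])
        have "2 + 2 * \<beta> * K + \<beta> * \<gamma> * R = \<alpha>0 * (2 + \<beta> * R)" using den by (simp add: \<alpha>0_def)
        also have "\<dots> \<le> \<alpha> * (2 + \<beta> * R)" using den \<alpha>(3) by (intro mult_right_mono) auto
        finally have "2 + 2 * \<beta> * K + \<beta> * \<gamma> * R \<le> \<alpha> * (2 + \<beta> * R)" .
        moreover have "\<gamma> * (\<beta> * (S - R)) \<le> \<alpha> * (\<beta> * (S - R))"
          using False \<beta> \<alpha>(4) by (intro mult_right_mono) auto
        ultimately show "2 + \<beta> * \<gamma> * S + 2 * \<beta> * K \<le> \<alpha> * (2 + \<beta> * S)" by (simp add: algebra_simps)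
      qed
      finally show ?thesis by (simp add: gint algebra_simps)
    qed
    then show ?thesis by (simp add: S_def algebra_simps)
  qed
  show ?thesis
  proof (rule that[OF \<alpha>(1,2) \<beta>])
    fix f :: "'a \<Rightarrow> real" and d x y
    assume *: "f \<in> borel_measurable borel" "\<And>x. \<bar>f x\<bar> \<le> 1" "0 \<le> d"
      "\<And>x y. \<bar>f x - f y\<bar> \<le> d * (2 + \<beta> * V x + \<beta> * V y)"
    from one_sided[OF *, of x y] one_sided[OF *, of y x]
    show "\<bar>(LINT u|P x. f u) - (LINT u|P y. f u)\<bar> \<le> \<alpha> * d * (2 + \<beta> * V x + \<beta> * V y)"
      by (simp add: abs_le_iff algebra_simps)
  qed
qed

context rhmc_lyapunov begin

lemma measure_law_markov:
  assumes "0 \<le> s" "0 \<le> t" and A: "A \<in> sets borel"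
  shows "measure (law (t + s) z) A = (LINT y|law t z. measure (law s y) A)"
proof -
  interpret L: prob_space "law s y" for y by (rule prob_space_law)
  interpret M: prob_space "law (t + s) z" by (rule prob_space_law)
  have "(LINT y|law t z. measure (law s y) A) = enn2real (\<integral>\<^sup>+y. ennreal (measure (law s y) A) \<partial>law t z)"
  proof (rule integral_eq_nn_integral)
    have "(\<lambda>y. emeasure (law s y) A) \<in> borel_measurable borel" using assms by measurable
    then show "(\<lambda>y. measure (law s y) A) \<in> borel_measurable (law t z)"
      unfolding measure_def by (simp cong: measurable_cong_sets)
  qed simp
  also have "(\<integral>\<^sup>+y. ennreal (measure (law s y) A) \<partial>law t z) = emeasure (law (t + s) z) A"
    using markov_property[OF assms, of z] by (simp add: L.emeasure_eq_measure)
  finally show ?thesis by (simp add: measure_def)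
qed

lemma measurable_measure_law:
  assumes "0 \<le> t" "A \<in> sets borel"
  shows "(\<lambda>z. measure (law t z) A) \<in> borel_measurable borel"
proof -
  have [measurable]: "(\<lambda>z. emeasure (law t z) A) \<in> borel_measurable borel"
    by (rule measurable_emeasure_law[OF assms])
  show ?thesis unfolding measure_def by measurable
qed

text \<open>Iterating the contraction along the times \<open>k * \<tau> + s\<close>, starting from the trivial bound \<open>2\<close> at time \<open>s\<close>.  The
  level \<open>R\<close> depends on the ratio of the drift constants only, which is why it can be fixed before \<open>\<tau>\<close>.\<close>

lemma measure_law_oscillation:
  obtains \<alpha> \<beta> \<tau> :: real where "0 < \<alpha>" "\<alpha> < 1" "0 < \<beta>" "0 < \<tau>"
    "\<And>k s A x y. \<lbrakk>0 \<le> s; A \<in> sets borel\<rbrakk> \<Longrightarrow>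
       \<bar>measure (law (real k * \<tau> + s) x) A - measure (law (real k * \<tau> + s) y) A\<bar> \<le> \<alpha> ^ k * (2 + \<beta> * V x + \<beta> * V y)"
proof -
  define B where "B = noise_level / rate"
  have B: "0 \<le> B" using noise_level_nonneg rate_pos by (simp add: B_def)
  define R where "R = 2 * B + 1"
  obtain \<tau> \<nu> where \<tau>: "0 < \<tau>" and \<nu>: "sets \<nu> = sets borel" "0 < emeasure \<nu> UNIV"
    and min: "\<And>z g. \<lbrakk>V z \<le> R; g \<in> borel_measurable borel\<rbrakk> \<Longrightarrow> (\<integral>\<^sup>+y. g y \<partial>\<nu>) \<le> (\<integral>\<^sup>+y. g y \<partial>law \<tau> z)"
    using minorization[of R] by blast
  define \<gamma> where "\<gamma> = exp (- rate * \<tau>)"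
  have \<gamma>: "0 \<le> \<gamma>" "\<gamma> < 1" using rate_pos \<tau> by (auto simp: \<gamma>_def)
  have drift: "(\<integral>\<^sup>+y. ennreal (V y) \<partial>law \<tau> z) \<le> ennreal (\<gamma> * V z + B * (1 - \<gamma>))" for z
    using lyapunov_drift[of \<tau> z] \<tau> by (simp add: drift_bound_def \<gamma>_def B_def)
  obtain \<alpha> \<beta> where \<alpha>: "0 < \<alpha>" "\<alpha> < 1" and \<beta>: "0 < \<beta>" and contr:
    "\<And>f d x y. \<lbrakk>f \<in> borel_measurable borel; \<And>x. \<bar>f x\<bar> \<le> 1; 0 \<le> d;
        \<And>x y. \<bar>f x - f y\<bar> \<le> d * (2 + \<beta> * V x + \<beta> * V y)\<rbrakk>
      \<Longrightarrow> \<bar>(LINT u|law \<tau> x. f u) - (LINT u|law \<tau> y. f u)\<bar> \<le> \<alpha> * d * (2 + \<beta> * V x + \<beta> * V y)"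
  proof (rule harris_contraction[of "law \<tau>" V \<gamma> "B * (1 - \<gamma>)" R \<nu>])
    show "2 * (B * (1 - \<gamma>)) < (1 - \<gamma>) * R" using \<gamma> by (simp add: R_def algebra_simps)
  qed (use \<gamma> \<nu> B prob_space_law drift in \<open>auto intro: min that\<close>)
  have osc: "\<bar>measure (law (real k * \<tau> + s) x) A - measure (law (real k * \<tau> + s) y) A\<bar> \<le> \<alpha> ^ k * (2 + \<beta> * V x + \<beta> * V y)"
    if s: "0 \<le> s" and A: "A \<in> sets borel" for k s A x y
  proof (induction k arbitrary: x y)
    case 0
    interpret L: prob_space "law t z" for t z by (rule prob_space_law)
    have "\<bar>measure (law s x) A - measure (law s y) A\<bar> \<le> 2"
      using L.prob_le_1[of s x A] L.prob_le_1[of s y A]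
        measure_nonneg[of "law s x" A] measure_nonneg[of "law s y" A] by linarith
    also have "\<dots> \<le> 2 + \<beta> * V x + \<beta> * V y" using \<beta> by simp
    finally show ?case by simp
  next
    case (Suc k)
    have t: "0 \<le> real k * \<tau> + s" using s \<tau> by simp
    have eq: "measure (law (real (Suc k) * \<tau> + s) z) A = (LINT y|law \<tau> z. measure (law (real k * \<tau> + s) y) A)" for z
      using measure_law_markov[OF t, of \<tau> A z] \<tau> A by (simp add: algebra_simps)
    have "\<bar>(LINT u|law \<tau> x. measure (law (real k * \<tau> + s) u) A) - (LINT u|law \<tau> y. measure (law (real k * \<tau> + s) u) A)\<bar>
        \<le> \<alpha> * \<alpha> ^ k * (2 + \<beta> * V x + \<beta> * V y)"
    proof (rule contr)
      interpret L: prob_space "law t z" for t z by (rule prob_space_law)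
      show "\<bar>measure (law (real k * \<tau> + s) x) A\<bar> \<le> 1" for x by simp
    qed (use Suc.IH \<alpha> measurable_measure_law[OF t A] in auto)
    then show ?case by (simp only: eq power_Suc)
  qed
  show ?thesis by (rule that[OF \<alpha> \<beta> \<tau> osc])
qed

text \<open>Invariance and drift bound the stationary mean of \<open>min V N\<close> by that of
  \<open>min (exp (- rate * t) * V + noise_level / rate) N\<close>; let \<open>t\<close>, then \<open>N\<close>, tend to infinity.\<close>

lemma BG_mean_V_finite: "integrable BG V"
proof -
  interpret BG: prob_space BG by (rule prob_space_BG)
  define B where "B = noise_level / rate"
  have B: "0 \<le> B" using noise_level_nonneg rate_pos by (simp add: B_def)
  have trunc_le: "(\<integral>\<^sup>+z. ennreal (min (V z) N) \<partial>BG) \<le> ennreal B" if N: "0 \<le> N" for N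
  proof -
    have le: "(\<integral>\<^sup>+z. ennreal (min (V z) N) \<partial>BG) \<le> (\<integral>\<^sup>+z. ennreal (min (exp (- rate * real n) * V z + B) N) \<partial>BG)" for n
    proof -
      let ?f = "\<lambda>z. ennreal (min (V z) N)" and ?f' = "\<lambda>z. ennreal (N - min (V z) N)"
      have sum: "?f z + ?f' z = ennreal N" for z using N by (subst ennreal_plus[symmetric]) auto
      have sm: "(\<lambda>z. \<integral>\<^sup>+y. g y \<partial>law (real n) z) \<in> borel_measurable BG" if "g \<in> borel_measurable borel" for g
        using that by (subst nn_integral_law) (auto cong: measurable_cong_sets)
      have fm [measurable]: "?f \<in> borel_measurable borel" "?f' \<in> borel_measurable borel" by measurable
      have "(\<integral>\<^sup>+z. ?f z \<partial>BG) + (\<integral>\<^sup>+z. ?f' z \<partial>BG) = ennreal N"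
        by (subst nn_integral_add[symmetric]) (auto simp: sum BG.emeasure_space_1[simplified])
      also have "\<dots> = (\<integral>\<^sup>+z. (\<integral>\<^sup>+y. ?f y \<partial>law (real n) z) + (\<integral>\<^sup>+y. ?f' y \<partial>law (real n) z) \<partial>BG)"
      proof -
        have "(\<integral>\<^sup>+y. ?f y \<partial>law (real n) z) + (\<integral>\<^sup>+y. ?f' y \<partial>law (real n) z) = ennreal N" for z
          using prob_space.emeasure_space_1[OF prob_space_law, of "real n" z]
          by (subst nn_integral_add[symmetric]) (auto simp: sum)
        then show ?thesis by (simp add: BG.emeasure_space_1[simplified])
      qed
      also have "\<dots> = (\<integral>\<^sup>+z. (\<integral>\<^sup>+y. ?f y \<partial>law (real n) z) \<partial>BG) + (\<integral>\<^sup>+z. (\<integral>\<^sup>+y. ?f' y \<partial>law (real n) z) \<partial>BG)"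
        by (intro nn_integral_add sm fm)
      also have "(\<integral>\<^sup>+z. (\<integral>\<^sup>+y. ?f' y \<partial>law (real n) z) \<partial>BG) \<le> (\<integral>\<^sup>+z. ?f' z \<partial>BG)"
        using BG_semigroup_le[of "real n" ?f'] by (simp add: nn_integral_law)
      finally have "(\<integral>\<^sup>+z. ?f z \<partial>BG) + (\<integral>\<^sup>+z. ?f' z \<partial>BG)
          \<le> (\<integral>\<^sup>+z. (\<integral>\<^sup>+y. ?f y \<partial>law (real n) z) \<partial>BG) + (\<integral>\<^sup>+z. ?f' z \<partial>BG)" by (simp add: add_left_mono)
      moreover have "(\<integral>\<^sup>+z. ?f' z \<partial>BG) \<noteq> top"
      proof -
        have "(\<integral>\<^sup>+z. ?f' z \<partial>BG) \<le> (\<integral>\<^sup>+z. ennreal N \<partial>BG)" using N by (intro nn_integral_mono ennreal_leI) auto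
        also have "\<dots> = ennreal N" by (simp add: BG.emeasure_space_1[simplified])
        finally show ?thesis by (auto simp: top_unique)
      qed
      ultimately have "(\<integral>\<^sup>+z. ?f z \<partial>BG) \<le> (\<integral>\<^sup>+z. (\<integral>\<^sup>+y. ?f y \<partial>law (real n) z) \<partial>BG)"
        by (simp add: add.commute[of _ "\<integral>\<^sup>+z. ?f' z \<partial>BG"] ennreal_add_left_cancel_le)
      also have "\<dots> \<le> (\<integral>\<^sup>+z. ennreal (min (exp (- rate * real n) * V z + B) N) \<partial>BG)"
      proof (rule nn_integral_mono)
        fix z
        have "(\<integral>\<^sup>+y. ?f y \<partial>law (real n) z) \<le> (\<integral>\<^sup>+y. ennreal (V y) \<partial>law (real n) z)"
          by (intro nn_integral_mono ennreal_leI) simp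
        also have "\<dots> \<le> ennreal (drift_bound (real n) z)" by (rule lyapunov_drift) simp
        also have "\<dots> \<le> ennreal (exp (- rate * real n) * V z + B)"
          using B by (intro ennreal_leI) (simp add: drift_bound_def B_def[symmetric] mult_left_le)
        finally have 1: "(\<integral>\<^sup>+y. ?f y \<partial>law (real n) z) \<le> ennreal (exp (- rate * real n) * V z + B)" .
        have "(\<integral>\<^sup>+y. ?f y \<partial>law (real n) z) \<le> (\<integral>\<^sup>+y. ennreal N \<partial>law (real n) z)"
          by (intro nn_integral_mono ennreal_leI) simp
        also have "\<dots> = ennreal N"
          using prob_space.emeasure_space_1[OF prob_space_law, of "real n" z] by simp
        finally show "(\<integral>\<^sup>+y. ?f y \<partial>law (real n) z) \<le> ennreal (min (exp (- rate * real n) * V z + B) N)"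
          using 1 by (simp add: min_def)
      qed
      finally show ?thesis .
    qed
    have "(\<lambda>n. \<integral>\<^sup>+z. ennreal (min (exp (- rate * real n) * V z + B) N) \<partial>BG) \<longlonglongrightarrow> (\<integral>\<^sup>+z. ennreal (min (0 * V z + B) N) \<partial>BG)"
    proof (rule nn_integral_dominated_convergence[where w="\<lambda>_. ennreal N"])
      show "(\<integral>\<^sup>+z. ennreal N \<partial>BG) < \<infinity>" by (simp add: BG.emeasure_space_1[simplified])
      have "(\<lambda>n. exp (- rate * real n)) \<longlonglongrightarrow> 0"
      proof -
        have "(\<lambda>n. exp (- rate) ^ n) \<longlonglongrightarrow> 0" using rate_pos by (intro LIMSEQ_realpow_zero) auto
        then show ?thesis by (simp add: exp_of_nat_mult[symmetric] mult.commute)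
      qed
      then show "AE z in BG. (\<lambda>n. ennreal (min (exp (- rate * real n) * V z + B) N)) \<longlonglongrightarrow> ennreal (min (0 * V z + B) N)"
        by (intro AE_I2 tendsto_ennrealI tendsto_intros)
    qed (auto intro!: ennreal_leI)
    then have "(\<integral>\<^sup>+z. ennreal (min (V z) N) \<partial>BG) \<le> (\<integral>\<^sup>+z. ennreal (min (0 * V z + B) N) \<partial>BG)"
      by (rule tendsto_lowerbound) (use le in auto)
    also have "\<dots> \<le> ennreal B" by (simp add: BG.emeasure_space_1[simplified] ennreal_leI)
    finally show ?thesis .
  qed
  have "(\<integral>\<^sup>+z. ennreal (V z) \<partial>BG) = (\<integral>\<^sup>+z. (SUP n. ennreal (min (V z) (real n))) \<partial>BG)"
  proof (rule nn_integral_cong)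
    fix z
    obtain n :: nat where n: "V z \<le> real n" using real_arch_simple by blast
    show "ennreal (V z) = (SUP n. ennreal (min (V z) (real n)))"
      by (intro antisym SUP_least SUP_upper2[of n] ennreal_leI) (use n in auto)
  qed
  also have "\<dots> = (SUP n. \<integral>\<^sup>+z. ennreal (min (V z) (real n)) \<partial>BG)"
    by (rule nn_integral_monotone_convergence_SUP) (auto simp: incseq_def le_fun_def intro!: ennreal_leI)
  also have "\<dots> \<le> ennreal B" by (intro SUP_least trunc_le) simp
  finally show ?thesis by (intro integrableI_nonneg) (auto simp: order_le_less_trans)
qed

lemma measure_law_convergence:
  obtains r C :: real where "0 < r" "0 < C"
    "\<And>t z A. \<lbrakk>0 \<le> t; A \<in> sets borel\<rbrakk> \<Longrightarrow> \<bar>measure (law t z) A - measure BG A\<bar> \<le> C * (1 + V z) * exp (- r * t)"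
proof -
  interpret BG: prob_space BG by (rule prob_space_BG)
  interpret L: prob_space "law t z" for t z by (rule prob_space_law)
  obtain \<alpha> \<beta> \<tau> :: real where \<alpha>: "0 < \<alpha>" "\<alpha> < 1" and \<beta>: "0 < \<beta>" and \<tau>: "0 < \<tau>" and osc:
    "\<And>k s A x y. \<lbrakk>0 \<le> s; A \<in> sets borel\<rbrakk> \<Longrightarrow>
       \<bar>measure (law (real k * \<tau> + s) x) A - measure (law (real k * \<tau> + s) y) A\<bar> \<le> \<alpha> ^ k * (2 + \<beta> * V x + \<beta> * V y)"
    by (rule measure_law_oscillation, rule that)
  define m where "m = (LINT z|BG. V z)"
  have m: "0 \<le> m" unfolding m_def by (rule integral_nonneg_AE) simp
  define r where "r = - ln \<alpha> / \<tau>"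
  define C where "C = (2 + \<beta> + \<beta> * m) / \<alpha>"
  have r: "0 < r" using \<alpha> \<tau> by (simp add: r_def divide_neg_pos)
  have C: "0 < C" using \<alpha> \<beta> m by (simp add: C_def add_pos_nonneg)
  show ?thesis
  proof (rule that[OF r C])
    fix t :: real and z and A :: "'n phase set"
    assume t: "0 \<le> t" and A: "A \<in> sets borel"
    define k where "k = nat \<lfloor>t / \<tau>\<rfloor>"
    have k: "real k \<le> t / \<tau>" "t / \<tau> \<le> real k + 1"
      using t \<tau> by (auto simp: k_def)
    define s where "s = t - real k * \<tau>"
    have s: "0 \<le> s" "real k * \<tau> + s = t" using k(1) \<tau> by (auto simp: s_def field_simps)
    note le = osc[OF s(1) A, of k, unfolded s(2)]
    have pm: "(\<lambda>y. measure (law t y) A) \<in> borel_measurable BG"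
      using measurable_measure_law[OF t A] by (simp cong: measurable_cong_sets)
    have int: "integrable BG (\<lambda>y. measure (law t y) A)"
      by (rule BG.integrable_const_bound[of _ 1]) (use pm in auto)
    have inv: "measure BG A = (LINT y|BG. measure (law t y) A)"
    proof -
      have "(LINT y|BG. measure (law t y) A) = enn2real (\<integral>\<^sup>+y. ennreal (measure (law t y) A) \<partial>BG)"
        by (rule integral_eq_nn_integral) (use pm in auto)
      also have "(\<integral>\<^sup>+y. ennreal (measure (law t y) A) \<partial>BG) = emeasure BG A"
        using BG_invariant t A by (auto simp: invariant_prob_def L.emeasure_eq_measure[symmetric])
      finally show ?thesis by (simp add: measure_def)
    qed
    have "measure (law t z) A - measure BG A = (LINT y|BG. measure (law t z) A - measure (law t y) A)"
      using int BG.prob_space by (simp add: inv)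
    also have "\<bar>\<dots>\<bar> \<le> (LINT y|BG. \<bar>measure (law t z) A - measure (law t y) A\<bar>)"
      by (rule integral_abs_bound)
    also have "\<dots> \<le> (LINT y|BG. \<alpha> ^ k * (2 + \<beta> * V z + \<beta> * V y))"
      using int BG_mean_V_finite le
      by (intro integral_mono integrable_abs Bochner_Integration.integrable_diff integrable_mult_right
          Bochner_Integration.integrable_add) auto
    also have "\<dots> = \<alpha> ^ k * (2 + \<beta> * V z + \<beta> * m)"
      using BG_mean_V_finite BG.prob_space by (simp add: m_def)
    also have "\<dots> \<le> (exp (- r * t) / \<alpha>) * ((2 + \<beta> + \<beta> * m) * (1 + V z))"
    proof (rule mult_mono)
      have "\<alpha> ^ k = exp (real k * ln \<alpha>)" using \<alpha> by (simp add: exp_of_nat_mult)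
      also have "\<dots> \<le> exp ((t / \<tau> - 1) * ln \<alpha>)"
        using \<alpha> k(2) by (simp add: mult_le_cancel_right)
      also have "\<dots> = exp (- r * t) / \<alpha>"
        using \<alpha> by (simp add: r_def left_diff_distrib exp_diff)
      finally show "\<alpha> ^ k \<le> exp (- r * t) / \<alpha>" .
      have "0 \<le> \<beta> * m * V z" "0 \<le> V z" using \<beta> m by auto
      then show "2 + \<beta> * V z + \<beta> * m \<le> (2 + \<beta> + \<beta> * m) * (1 + V z)"
        using \<beta> by (simp add: algebra_simps)
    qed (use \<alpha> \<beta> m in auto)
    also have "\<dots> = C * (1 + V z) * exp (- r * t)" by (simp add: C_def)
    finally show "\<bar>measure (law t z) A - measure BG A\<bar> \<le> C * (1 + V z) * exp (- r * t)" .
  qed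
qed

text \<open>For an invariant \<open>\<mu>\<close> the average over \<open>\<mu>\<close> of \<open>law t z A\<close> is \<open>\<mu> A\<close> for every \<open>t\<close>, while the integrand tends to
  \<open>BG A\<close> pointwise.\<close>

lemma BG_unique:
  assumes "invariant_prob law \<mu>"
  shows "\<mu> = BG"
proof -
  have \<mu>: "prob_space \<mu>" "sets \<mu> = sets borel"
    and inv: "\<And>t A. \<lbrakk>0 \<le> t; A \<in> sets borel\<rbrakk> \<Longrightarrow> (\<integral>\<^sup>+z. emeasure (law t z) A \<partial>\<mu>) = emeasure \<mu> A"
    using assms by (auto simp: invariant_prob_def)
  interpret \<mu>: prob_space \<mu> by (rule \<mu>)
  interpret BG: prob_space BG by (rule prob_space_BG)
  interpret L: prob_space "law t z" for t z by (rule prob_space_law)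
  obtain r C :: real where r: "0 < r" and conv:
    "\<And>t z A. \<lbrakk>0 \<le> t; A \<in> sets borel\<rbrakk> \<Longrightarrow> \<bar>measure (law t z) A - measure BG A\<bar> \<le> C * (1 + V z) * exp (- r * t)"
    by (rule measure_law_convergence, rule that)
  show ?thesis
  proof (rule measure_eqI)
    fix A assume "A \<in> sets \<mu>"
    then have A: "A \<in> sets borel" using \<mu>(2) by simp
    have "(\<lambda>n. \<integral>\<^sup>+z. emeasure (law (real n) z) A \<partial>\<mu>) \<longlonglongrightarrow> (\<integral>\<^sup>+z. emeasure BG A \<partial>\<mu>)"
    proof (rule nn_integral_dominated_convergence[where w="\<lambda>_. 1"])
      show "(\<lambda>z. emeasure (law (real n) z) A) \<in> borel_measurable \<mu>" for n
        using measurable_emeasure_law[of "real n" A] A \<mu>(2) by (simp cong: measurable_cong_sets)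
      show "AE z in \<mu>. emeasure (law (real n) z) A \<le> 1" for n
        by (rule AE_I2) (rule L.measure_le_1)
      show "AE z in \<mu>. (\<lambda>n. emeasure (law (real n) z) A) \<longlonglongrightarrow> emeasure BG A"
      proof (rule AE_I2)
        fix z
        have "(\<lambda>n. exp (- r) ^ n) \<longlonglongrightarrow> 0" using r by (intro LIMSEQ_realpow_zero) auto
        then have "(\<lambda>n. exp (- r * real n)) \<longlonglongrightarrow> 0"
          by (simp add: exp_of_nat_mult[symmetric] mult.commute)
        then have "(\<lambda>n. C * (1 + V z) * exp (- r * real n)) \<longlonglongrightarrow> 0" by (rule tendsto_mult_right_zero)
        then have "(\<lambda>n. measure (law (real n) z) A - measure BG A) \<longlonglongrightarrow> 0"
          by (rule Lim_null_comparison[rotated]) (use conv[OF _ A] in auto)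
        then have "(\<lambda>n. measure (law (real n) z) A) \<longlonglongrightarrow> measure BG A" by (rule LIM_zero_cancel)
        then show "(\<lambda>n. emeasure (law (real n) z) A) \<longlonglongrightarrow> emeasure BG A"
          by (simp add: L.emeasure_eq_measure BG.emeasure_eq_measure tendsto_ennrealI)
      qed
    qed (auto simp: \<mu>.emeasure_space_1)
    then have "(\<lambda>n. emeasure \<mu> A) \<longlonglongrightarrow> emeasure BG A"
      using inv[OF _ A] by (simp add: \<mu>.emeasure_space_1)
    then show "emeasure \<mu> A = emeasure BG A" by (simp add: LIMSEQ_const_iff)
  qed (simp add: \<mu>(2))
qed

text \<open>If \<open>\<Phi> 0 > 0\<close>, then \<open>V\<close> is bounded away from zero: near \<open>q = 0\<close> by continuity of the potential, elsewhere by
  its quadratic part.\<close>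

lemma V_absorbs_constant:
  obtains k :: real where "1 \<le> k" "\<And>z. 0 < \<Phi> 0 \<Longrightarrow> 1 + V z \<le> k * V z"
proof (cases "0 < \<Phi> 0")
  case True
  have "\<forall>\<^sub>F q in nhds 0. \<Phi> 0 / 2 < \<Phi> q"
    using continuous_potential True
    by (intro order_tendstoD(1)[where y="\<Phi> 0"]) (auto simp: continuous_on_eq_continuous_at isCont_def tendsto_at_iff_tendsto_nhds)
  then obtain \<delta> where \<delta>: "0 < \<delta>" "\<And>q. norm q < \<delta> \<Longrightarrow> \<Phi> 0 / 2 < \<Phi> q"
    unfolding eventually_nhds_metric by (auto simp: dist_norm)
  define v where "v = min (\<Phi> 0 / 2) (\<gamma>2 * \<delta>\<^sup>2 / 6)"
  have v: "0 < v" using True \<delta>(1) gamma2_pos by (simp add: v_def)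
  have Vv: "v \<le> V z" for z
  proof (cases "norm (fst z) < \<delta>")
    case True
    have "0 \<le> \<gamma>2 * (norm (fst z))\<^sup>2 / 6" using gamma2_pos by simp
    then have "\<Phi> (fst z) \<le> V z" using V_lower[of z] zero_le_power2[of "norm (snd z)"] by linarith
    then show ?thesis using \<delta>(2)[OF True] by (simp add: v_def)
  next
    case False
    then have "\<delta>\<^sup>2 \<le> (norm (fst z))\<^sup>2" using \<delta>(1) by (intro power_mono) auto
    then have "\<gamma>2 * \<delta>\<^sup>2 / 6 \<le> \<gamma>2 * (norm (fst z))\<^sup>2 / 6" using gamma2_pos by simp
    then have "\<gamma>2 * \<delta>\<^sup>2 / 6 \<le> V z"
      using V_lower[of z] nonneg[of "fst z"] zero_le_power2[of "norm (snd z)"] by linarith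
    then show ?thesis by (simp add: v_def)
  qed
  show ?thesis
  proof (rule that[of "1 + 1 / v"])
    show "1 + V z \<le> (1 + 1 / v) * V z" for z
      using Vv[of z] v by (simp add: algebra_simps)
  qed (use v in simp)
qed (rule that[of 1], auto)

theorem convergence_to_BG:
  obtains r C :: real where "0 < r" "0 < C"
    "\<And>t z. 0 \<le> t \<Longrightarrow> tv_norm (law t z) BG \<le> C * (1 + V z) * exp (- r * t)"
    "\<And>t z. \<lbrakk>0 \<le> t; 0 < \<Phi> 0\<rbrakk> \<Longrightarrow> tv_norm (law t z) BG \<le> C * V z * exp (- r * t)"
proof -
  obtain r C :: real where r: "0 < r" and C: "0 < C" and conv:
    "\<And>t z A. \<lbrakk>0 \<le> t; A \<in> sets borel\<rbrakk> \<Longrightarrow> \<bar>measure (law t z) A - measure BG A\<bar> \<le> C * (1 + V z) * exp (- r * t)"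
    by (rule measure_law_convergence, rule that)
  obtain k where k: "1 \<le> k" "\<And>z. 0 < \<Phi> 0 \<Longrightarrow> 1 + V z \<le> k * V z" by (rule V_absorbs_constant, rule that)
  have tv: "tv_norm (law t z) BG \<le> 2 * C * (1 + V z) * exp (- r * t)" if t: "0 \<le> t" for t z
  proof -
    have "(SUP A\<in>sets (law t z). \<bar>measure (law t z) A - measure BG A\<bar>) \<le> C * (1 + V z) * exp (- r * t)"
      by (rule cSUP_least) (use conv[OF t] in auto)
    then show ?thesis by (simp add: tv_norm_def)
  qed
  show ?thesis
  proof (rule that[of r "2 * C * k"])
    fix t z assume t: "(0::real) \<le> t"
    have "2 * C * 1 \<le> 2 * C * k" using k C by (intro mult_left_mono) auto
    then have "2 * C * (1 + V z) * exp (- r * t) \<le> 2 * C * k * (1 + V z) * exp (- r * t)"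
      by (intro mult_right_mono) auto
    with tv[OF t, of z] show "tv_norm (law t z) BG \<le> 2 * C * k * (1 + V z) * exp (- r * t)" by linarith
    assume "0 < \<Phi> 0"
    then have "2 * C * (1 + V z) * exp (- r * t) \<le> 2 * C * (k * V z) * exp (- r * t)"
      using k C by (intro mult_right_mono mult_left_mono) auto
    with tv[OF t, of z] show "tv_norm (law t z) BG \<le> 2 * C * k * V z * exp (- r * t)" by (simp add: mult.assoc)
  qed (use r C k in auto)
qed

end

theorem theorem3p9:
  fixes \<Phi> :: "real ^ 'n::finite \<Rightarrow> real" and lam \<phi> :: real
  assumes lam: "lam > 0"
    and phi: "0 < \<phi>" "\<phi> \<le> pi / 2"
    and smooth: "C2 \<Phi>"
    and H1: "\<forall>q. \<Phi> q \<ge> 0" "integrable lborel (\<lambda>q. (norm q)\<^sup>2 * exp (- \<Phi> q))"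
    and H2: "\<exists>a>0. \<exists>b. 0 < b \<and> b < 1 \<and>
      (\<forall>q. (grad \<Phi> q \<bullet> q) / 2 \<ge> b * \<Phi> q
        + ((c1 lam \<phi> * b)\<^sup>2 + c2 lam \<phi> * b * (1 - b)) / (2 * (1 - b)) * (norm q)\<^sup>2 - a)"
  shows "invariant_prob (rhmc_law \<Phi> lam \<phi>) (boltzmann_gibbs \<Phi>) \<and>
    (\<forall>\<mu>. invariant_prob (rhmc_law \<Phi> lam \<phi>) \<mu> \<longrightarrow> \<mu> = boltzmann_gibbs \<Phi>) \<and>
    (\<exists>r>0. \<exists>C>0. \<forall>t\<ge>0. \<forall>z.
       tv_norm (rhmc_law \<Phi> lam \<phi> t z) (boltzmann_gibbs \<Phi>)
         \<le> C * (1 + lyapunov \<Phi> lam \<phi> z) * exp (- r * t) \<and>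
       (\<Phi> 0 > 0 \<longrightarrow>
         tv_norm (rhmc_law \<Phi> lam \<phi> t z) (boltzmann_gibbs \<Phi>)
           \<le> C * lyapunov \<Phi> lam \<phi> z * exp (- r * t)))"
proof -
  from H2 obtain a b where ab: "0 < a" "0 < b" "b < 1" and coercive:
    "\<And>q. (grad \<Phi> q \<bullet> q) / 2 \<ge> b * \<Phi> q
        + ((c1 lam \<phi> * b)\<^sup>2 + c2 lam \<phi> * b * (1 - b)) / (2 * (1 - b)) * (norm q)\<^sup>2 - a"
    by blast
  interpret rhmc_lyapunov \<Phi> lam \<phi> a b
    by unfold_locales (use smooth H1 lam phi ab coercive in auto)
  obtain r C where rC: "0 < r" "0 < C"
    "\<And>t z. 0 \<le> t \<Longrightarrow> tv_norm (law t z) BG \<le> C * (1 + V z) * exp (- r * t)"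
    "\<And>t z. \<lbrakk>0 \<le> t; 0 < \<Phi> 0\<rbrakk> \<Longrightarrow> tv_norm (law t z) BG \<le> C * V z * exp (- r * t)"
    by (rule convergence_to_BG, rule that)
  show ?thesis
  proof (intro conjI)
    show "invariant_prob law BG" by (rule BG_invariant)
    show "\<forall>\<mu>. invariant_prob law \<mu> \<longrightarrow> \<mu> = BG" using BG_unique by blast
    show "\<exists>r>0. \<exists>C>0. \<forall>t\<ge>0. \<forall>z.
        tv_norm (law t z) BG \<le> C * (1 + V z) * exp (- r * t) \<and>
        (\<Phi> 0 > 0 \<longrightarrow> tv_norm (law t z) BG \<le> C * V z * exp (- r * t))"
      using rC by blast
  qed
qed

end
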